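(* With $Q:=q^7$, the following hold: $$\frac{(1,0,21)-(5,4,5)}{(3,0,7)+(2,2,11)}=q\frac{E(q^2)E(Q^6)}{E(q^6)E(Q^2)},$$ $$\frac{(3,0,7)-(2,2,11)}{(1,0,21)+(5,4,5)}=-q^2\frac{E(q^6)E(Q^2)\psi^2(-q)\psi^2(-Q^3)}{E(q^2)E(Q^6)\psi^2(-q^3)\psi^2(-Q)}.$$
   Context: $|q|<1$, $E(q)=(q;q)_\infty=\prod_{k\ge1}(1-q^k)$, $\psi(q)=\sum_{n\ge0}q^{n(n+1)/2}$, and $\psi^2(x)=\psi(x)^2$. For integers $a,b,c$ with $a,c>0$, $b^2-4ac<0$, $(a,b,c)$ denotes $\sum_{n,m=-\infty}^{\infty}q^{an^2+bnm+cm^2}$. *)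

theory Defs
  imports "HOL-Analysis.Analysis"
begin

definition euler_E :: "complex \<Rightarrow> complex" where
  "euler_E q = (\<Prod>k. 1 - q ^ Suc k)"

definition ramanujan_psi :: "complex \<Rightarrow> complex" where
  "ramanujan_psi q = (\<Sum>n. q ^ (n * (n + 1) div 2))"

(* The series written (a,b,c) for integers with a, c > 0 and b^2 - 4ac < 0.  For such a, b, c
   every exponent is a nonnegative integer, so the value at q = 0 is 1, and the family is
   absolutely summable for norm q < 1. *)
definition qf_theta :: "int \<Rightarrow> int \<Rightarrow> int \<Rightarrow> complex \<Rightarrow> complex" where
  "qf_theta a b c q =
     (\<Sum>\<^sub>\<infinity>(n, m)\<in>(UNIV :: (int \<times> int) set). q powi (a * n\<^sup>2 + b * n * m + c * m\<^sup>2))"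

end

theory Submission
  imports Defs "HOL-Complex_Analysis.Complex_Analysis" "HOL-Real_Asymp.Real_Asymp"
begin

text \<open>
  Write \<open>q = exp (\<pi>\<i>\<tau>)\<close>. The four series are products and sums of products of Jacobi theta functions at
  \<open>k\<tau>\<close> and \<open>2k\<tau>\<close> with \<open>k\<close> dividing 21, and \<open>\<phi>(q) \<psi>(-q)\<^sup>2 = E(q\<^sup>2)\<^sup>3\<close>; so each identity says that
  a certain function of weight 0 vanishes. Together with its two conjugates (indexed 3, 4, 2 like the
  Jacobi theta functions) this function is permuted, up to roots of unity, by \<open>\<tau> \<mapsto> \<tau> + 1\<close>, by
  \<open>\<tau> \<mapsto> -1/(21\<tau>)\<close> and by two further Atkin-Lehner elements of level 21, centred at \<open>-2/3\<close> and \<open>-1/2\<close>.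
  The isometric circles of these maps cover a period of the real line, hence every point can be moved
  to height at least 1/50. As all three functions tend to 0 at \<open>\<i>\<infinity>\<close>, the maximum of their moduli is
  attained, and the maximum modulus principle forces them to be 0.
\<close>

subsection \<open>Inversion of the theta series\<close>

text \<open>All transformation laws grow from one analytic fact, the value of
  \<open>theta3 (- 1 / t)\<close>: \<open>theta4\<close> and \<open>theta2\<close> follow by
  splitting series by parity, \<open>eta\<close> by a cube root of
  \<open>theta2 * theta3 * theta4\<close>. The obstacle is that (2,2,11) and (5,4,5) are not single
  theta products. Each is a sum of two products, one per coset of an index 2 sublattice; inversion
  mixes the two, so only whole sums such as \<open>A3\<close> or \<open>mixed1\<close> transform
  well. A matrix permutes the indices 3, 4, 2 according to its residue mod 2: translation swaps 3
  and 4, the Fricke map and the element at -2/3 swap 4 and 2, the element at -1/2 is the identity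
  mod 2. This last one fills the gap around 1/2 left by the circles about 0 and +-1/3. Only moduli
  are compared, so multipliers matter only through the relative phase of the two terms of a
  function. Since every orbit reaches height 1/50, a single cusp has to be inspected. There the eta
  quotients produce negative powers of q for three of the functions, which cancel thanks to the
  first coefficients of the series; a positive fractional power is left.\<close>

text \<open>Polya's proof: the sum of the even powers \<open>(2 cos (\<pi>l/n))\<^sup>2\<^sup>m\<close> over \<open>l\<close> is a sum of binomial coefficients
  in arithmetic progression; both sides become theta series when \<open>m/n\<^sup>2\<close> tends to a positive limit.\<close>

lemma sum_cis_multiples:
  fixes n :: nat and d :: int
  assumes "n > 0"
  shows "(\<Sum>l<n. cis (2 * pi * real l * real_of_int d / real n)) = (if int n dvd d then of_nat n else 0)"
proof -
  define w where "w = cis (2 * pi * real_of_int d / real n)"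
  have eq: "cis (2 * pi * real l * real_of_int d / real n) = w ^ l" for l
    unfolding w_def Complex.DeMoivre by (rule arg_cong[of _ _ cis]) simp
  have wn: "w ^ n = 1"
  proof -
    have "w ^ n = cis (2 * pi * real_of_int d)"
      using assms by (simp add: w_def Complex.DeMoivre)
    also have "\<dots> = 1"
      by (simp add: complex_eq_iff sin_int_2pin cos_int_2pin)
    finally show ?thesis .
  qed
  have w1: "w = 1 \<longleftrightarrow> int n dvd d"
  proof
    assume "w = 1"
    then have "cos (2 * pi * real_of_int d / real n) = 1"
      by (simp add: w_def complex_eq_iff)
    then obtain k :: int where "2 * pi * real_of_int d / real n = real_of_int k * 2 * pi"
      using cos_one_2pi_int by blast
    then have "real_of_int d = real_of_int (k * int n)"
      using assms by (simp add: field_simps)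
    then show "int n dvd d" by (metis dvd_triv_right of_int_eq_iff)
  next
    assume "int n dvd d"
    then obtain k where "d = int n * k" by blast
    then have "2 * pi * real_of_int d / real n = 2 * pi * real_of_int k"
      using assms by simp
    then show "w = 1"
      by (simp add: w_def complex_eq_iff sin_int_2pin cos_int_2pin)
  qed
  show ?thesis
  proof (cases "w = 1")
    case True
    then show ?thesis using w1 by (simp add: eq)
  next
    case False
    then have "(\<Sum>l<n. w ^ l) = 0"
      using geometric_sum[of w n] wn by simp
    then show ?thesis using False w1 by (simp add: eq)
  qed
qed

lemma two_cos_power_even:
  fixes x :: real
  shows "complex_of_real ((2 * cos x) ^ (2 * m)) =
    (\<Sum>k\<le>2*m. of_nat (2*m choose k) * cis (2 * x * real_of_int (int k - int m)))"
proof -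
  have "complex_of_real (2 * cos x) = cis x + cis (- x)"
    by (simp add: complex_eq_iff)
  then have "complex_of_real ((2 * cos x) ^ (2 * m)) = (cis x + cis (- x)) ^ (2*m)"
    by (metis of_real_power)
  also have "\<dots> = (\<Sum>k\<le>2*m. of_nat (2*m choose k) * cis x ^ k * cis (-x) ^ (2*m-k))"
    by (rule binomial_ring)
  also have "\<dots> = (\<Sum>k\<le>2*m. of_nat (2*m choose k) * cis (2 * x * real_of_int (int k - int m)))"
  proof (rule sum.cong[OF refl])
    fix k assume "k \<in> {..2*m}"
    then have k: "k \<le> 2*m" by simp
    have "cis x ^ k * cis (-x) ^ (2*m-k) = cis (real k * x + real (2*m-k) * (-x))"
      by (simp only: Complex.DeMoivre cis_mult)
    also have "real k * x + real (2*m-k) * (-x) = 2 * x * real_of_int (int k - int m)"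
      using k by (simp add: of_nat_diff algebra_simps)
    finally show "of_nat (2*m choose k) * cis x ^ k * cis (-x) ^ (2*m-k) =
       of_nat (2*m choose k) * cis (2 * x * real_of_int (int k - int m))"
      by (simp add: mult.assoc)
  qed
  finally show ?thesis .
qed

text \<open>Expand each power binomially and sum over \<open>l\<close> first: the roots of unity
  keep only the indices k congruent to m mod n. Binomial symmetry then folds
  \<open>m - j * n\<close> onto \<open>m + j * n\<close>.\<close>

lemma sum_cos_powers_eq_binomials:
  fixes n m :: nat
  assumes n: "n > 0"
  shows "(\<Sum>l<n. (2 * cos (pi * real l / real n)) ^ (2*m)) =
    real n * (real (2*m choose m) + 2 * (\<Sum>j=1..m div n. real (2*m choose (m + j * n))))"
proof -
  define K where "K = {k. k \<le> 2*m \<and> int n dvd int k - int m}"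
  define J where "J = m div n"
  have "complex_of_real (\<Sum>l<n. (2 * cos (pi * real l / real n)) ^ (2*m)) =
    (\<Sum>l<n. \<Sum>k\<le>2*m. of_nat (2*m choose k) * cis (2 * pi * real l * real_of_int (int k - int m) / real n))"
    unfolding of_real_sum two_cos_power_even by (intro sum.cong refl) (simp add: mult.assoc)
  also have "\<dots> = (\<Sum>k\<le>2*m. of_nat (2*m choose k) *
      (\<Sum>l<n. cis (2 * pi * real l * real_of_int (int k - int m) / real n)))"
    by (subst sum.swap) (simp add: sum_distrib_left)
  also have "\<dots> = (\<Sum>k\<le>2*m. of_nat (2*m choose k) * (if int n dvd int k - int m then of_nat n else 0))"
    using n by (subst sum_cis_multiples) auto
  also have "\<dots> = (\<Sum>k\<in>K. of_nat (2*m choose k) * of_nat n)"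
    unfolding K_def by (intro sum.mono_neutral_cong_right) auto
  also have "\<dots> = complex_of_real (real n * (\<Sum>k\<in>K. real (2*m choose k)))"
    by (simp add: sum_distrib_left mult.commute)
  finally have 1: "(\<Sum>l<n. (2 * cos (pi * real l / real n)) ^ (2*m)) = real n * (\<Sum>k\<in>K. real (2*m choose k))"
    using of_real_eq_iff by blast
  have JM: "j * n \<le> m" if "j \<le> J" for j
    using that n unfolding J_def by (meson div_times_less_eq_dividend le_trans mult_le_mono1)
  have Keq: "K = {m} \<union> (\<lambda>j. m + j * n) ` {1..J} \<union> (\<lambda>j. m - j * n) ` {1..J}"
  proof (rule set_eqI, rule iffI)
    fix k assume "k \<in> K"
    then have k: "k \<le> 2*m" "int n dvd int k - int m" by (auto simp: K_def)
    then obtain c where c: "int k - int m = int n * c" by blast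
    consider "c = 0" | "c > 0" | "c < 0" by linarith
    then show "k \<in> {m} \<union> (\<lambda>j. m + j * n) ` {1..J} \<union> (\<lambda>j. m - j * n) ` {1..J}"
    proof cases
      case 1 then show ?thesis using c by auto
    next
      case 2
      define j where "j = nat c"
      have cj: "c = int j" "j \<ge> 1" using 2 by (auto simp: j_def)
      have kj: "k = m + j * n" using c cj by (metis (no_types, opaque_lifting) add.commute diff_add_cancel mult.commute of_nat_add of_nat_eq_iff of_nat_mult)
      then have "j * n \<le> m" using k by simp
      then have "j \<le> J" using n by (simp add: J_def less_eq_div_iff_mult_less_eq)
      then show ?thesis using kj cj by auto
    next
      case 3
      define j where "j = nat (-c)"
      have cj: "c = - int j" "j \<ge> 1" using 3 by (auto simp: j_def)
      have "int m = int k + int j * int n" using c cj by (simp add: algebra_simps)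
      then have mk: "m = k + j * n" by (metis of_nat_add of_nat_eq_iff of_nat_mult)
      then have "j \<le> J" using n by (simp add: J_def less_eq_div_iff_mult_less_eq)
      then show ?thesis using mk cj by force
    qed
  next
    fix k assume "k \<in> {m} \<union> (\<lambda>j. m + j * n) ` {1..J} \<union> (\<lambda>j. m - j * n) ` {1..J}"
    then show "k \<in> K"
      using JM by (auto simp: K_def of_nat_diff)
  qed
  have inj1: "inj_on (\<lambda>j. m + j * n) {1..J}" using n by (auto simp: inj_on_def)
  have inj2: "inj_on (\<lambda>j. m - j * n) {1..J}"
  proof (rule inj_onI)
    fix x y assume "x \<in> {1..J}" "y \<in> {1..J}" "m - x * n = m - y * n"
    then have "x * n = y * n" using JM[of x] JM[of y] by (metis atLeastAtMost_iff diff_diff_cancel)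
    then show "x = y" using n by simp
  qed
  have "(\<Sum>k\<in>K. real (2*m choose k)) = real (2*m choose m) + (\<Sum>j=1..J. real (2*m choose (m + j * n)))
     + (\<Sum>j=1..J. real (2*m choose (m - j * n)))"
  proof -
    have "(\<Sum>k\<in>K. real (2*m choose k)) = (\<Sum>k\<in>{m} \<union> (\<lambda>j. m + j * n) ` {1..J}. real (2*m choose k))
       + (\<Sum>k\<in>(\<lambda>j. m - j * n) ` {1..J}. real (2*m choose k))"
      unfolding Keq
    proof (rule sum.union_disjoint)
      show "({m} \<union> (\<lambda>j. m + j * n) ` {1..J}) \<inter> (\<lambda>j. m - j * n) ` {1..J} = {}"
      proof -
        have "m - j * n < m" if "j \<in> {1..J}" for j
          using that n JM[of j] by (intro diff_less) (auto simp: Suc_le_eq intro: order.strict_trans2[of 0 "j * n"])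
        then show ?thesis by fastforce
      qed
    qed auto
    also have "(\<Sum>k\<in>{m} \<union> (\<lambda>j. m + j * n) ` {1..J}. real (2*m choose k)) =
       real (2*m choose m) + (\<Sum>k\<in>(\<lambda>j. m + j * n) ` {1..J}. real (2*m choose k))"
      using n by (subst sum.union_disjoint) auto
    finally show ?thesis unfolding sum.reindex[OF inj1] sum.reindex[OF inj2] o_def by simp
  qed
  also have "(\<Sum>j=1..J. real (2*m choose (m - j * n))) = (\<Sum>j=1..J. real (2*m choose (m + j * n)))"
  proof (intro sum.cong refl)
    fix j assume "j \<in> {1..J}"
    then have "j * n \<le> m" using JM by simp
    then have "2*m choose (m - j * n) = 2*m choose (2*m - (m - j*n))" by (intro binomial_symmetric) simp
    also have "2*m - (m - j*n) = m + j * n" using \<open>j * n \<le> m\<close> by simp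
    finally show "real (2*m choose (m - j * n)) = real (2*m choose (m + j * n))" by simp
  qed
  finally show ?thesis unfolding 1 J_def by simp
qed

text \<open>For odd n the reflection \<open>l\<close> to \<open>n - l\<close> leaves only
  \<open>l = 0\<close> unpaired. The representatives \<open>1..r\<close> have angles below pi/2,
  where the Gaussian bound \<open>cos_le_exp_square\<close> applies.\<close>

lemma sum_cos_powers_odd:
  fixes r m :: nat
  shows "(\<Sum>l<2*r+1. (2 * cos (pi * real l / real (2*r+1))) ^ (2*m)) =
    4 ^ m * (1 + 2 * (\<Sum>l=1..r. cos (pi * real l / real (2*r+1)) ^ (2*m)))"
proof -
  define n where "n = 2*r+1"
  define g where "g l = cos (pi * real l / real n) ^ (2*m)" for l
  have refl_g: "g (n - l) = g l" if "l \<le> n" for l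
  proof -
    have "pi * real (n - l) / real n = pi - pi * real l / real n"
      using that by (simp add: n_def of_nat_diff field_simps)
    then have "cos (pi * real (n - l) / real n) = - cos (pi * real l / real n)"
      by simp
    then show ?thesis by (simp add: g_def)
  qed
  have "{..<n} = insert 0 ({1..r} \<union> {r+1..2*r})" by (auto simp: n_def)
  then have "(\<Sum>l<n. g l) = g 0 + (\<Sum>l\<in>{1..r} \<union> {r+1..2*r}. g l)" by simp
  also have "(\<Sum>l\<in>{1..r} \<union> {r+1..2*r}. g l) = (\<Sum>l=1..r. g l) + (\<Sum>l=r+1..2*r. g l)"
    by (intro sum.union_disjoint) auto
  also have "(\<Sum>l=r+1..2*r. g l) = (\<Sum>l=1..r. g l)"
    by (rule sum.reindex_bij_witness[of _ "\<lambda>l. n - l" "\<lambda>l. n - l"]) (use refl_g in \<open>auto simp: n_def\<close>)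
  finally have "(\<Sum>l<n. g l) = 1 + 2 * (\<Sum>l=1..r. g l)" by (simp add: g_def)
  moreover have "(\<Sum>l<n. (2 * cos (pi * real l / real n)) ^ (2*m)) = 4^m * (\<Sum>l<n. g l)"
    by (simp add: g_def sum_distrib_left power_mult_distrib power_mult)
  ultimately show ?thesis by (simp add: g_def n_def)
qed

section \<open>Gaussian behaviour of binomial coefficients near the centre\<close>

lemma central_binomial_ratio:
  fixes m J :: nat
  assumes "J \<le> m"
  shows "real (2*m choose (m + J)) = real (2*m choose m) * (\<Prod>i<J. (real m - real i) / (real m + real i + 1))"
  using assms
proof (induction J)
  case (Suc J)
  have "Suc (m + J) * (2*m choose Suc (m + J)) = (2*m - (m + J)) * (2*m choose (m + J))"
    by (metis binomial_absorb_comp binomial_absorption mult.commute)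
  then have "(real m + real J + 1) * real (2*m choose Suc (m + J)) = (real m - real J) * real (2*m choose (m + J))"
    using Suc.prems by (metis (no_types, lifting) Suc_leD add.commute add_diff_cancel_left' diff_diff_left mult_2 of_nat_Suc of_nat_add of_nat_diff of_nat_mult)
  then have "real (2*m choose Suc (m + J)) = real (2*m choose (m + J)) * ((real m - real J) / (real m + real J + 1))"
    by (simp add: field_simps)
  then show ?case using Suc by simp
qed simp

lemma prod_exp_odd:
  fixes c :: real
  shows "(\<Prod>i<J. exp (- (2 * real i + 1) / c)) = exp (- (real J)\<^sup>2 / c)"
proof -
  have sumodd: "(\<Sum>i<J. 2 * real i + 1) = (real J)\<^sup>2"
    by (induction J) (auto simp: power2_eq_square algebra_simps)
  have "(\<Prod>i<J. exp (- (2 * real i + 1) / c)) = exp (\<Sum>i<J. - (2 * real i + 1) / c)" by (simp add: exp_sum)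
  also have "(\<Sum>i<J. - (2 * real i + 1) / c) = - (real J)\<^sup>2 / c"
    by (simp only: sumodd[symmetric] sum_divide_distrib sum_negf minus_divide_left[symmetric])
  finally show ?thesis .
qed

text \<open>The reciprocal of a factor is 1 + (2i+1)/(m-i), hence at most an exponential; replacing
  m-i by m-J makes the exponents proportional to the odd numbers, which sum to \<open>J^2\<close>.
  The upper bound argues in the same way with the factor 1 - (2i+1)/(m+i+1) itself.\<close>

lemma central_binomial_ratio_ge:
  fixes m J :: nat
  assumes "J < m"
  shows "exp (- (real J)\<^sup>2 / (real m - real J)) \<le> (\<Prod>i<J. (real m - real i) / (real m + real i + 1))"
proof -
  have lo: "exp (- (2 * real i + 1) / (real m - real J)) \<le> (real m - real i) / (real m + real i + 1)" if "i < J" for i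
  proof -
    have pos: "real m - real i > 0" "real m - real J > 0" using that assms by auto
    have "(real m + real i + 1) / (real m - real i) = 1 + (2 * real i + 1) / (real m - real i)"
      using pos by (simp add: field_simps)
    also have "\<dots> \<le> exp ((2 * real i + 1) / (real m - real i))" by (rule exp_ge_add_one_self)
    also have "\<dots> \<le> exp ((2 * real i + 1) / (real m - real J))"
      using that pos by (simp add: frac_le)
    finally have "inverse (exp ((2 * real i + 1) / (real m - real J))) \<le> inverse ((real m + real i + 1) / (real m - real i))"
      using pos by (intro le_imp_inverse_le divide_pos_pos) auto
    then show ?thesis by (simp add: exp_minus[symmetric] minus_divide_left)
  qed
  show ?thesis
    unfolding prod_exp_odd[symmetric] by (intro prod_mono) (use lo in auto)
qed

lemma central_binomial_ratio_le:
  fixes m J :: nat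
  assumes "J \<le> m"
  shows "(\<Prod>i<J. (real m - real i) / (real m + real i + 1)) \<le> exp (- (real J)\<^sup>2 / (real m + real J))"
proof -
  have up: "(real m - real i) / (real m + real i + 1) \<le> exp (- (2 * real i + 1) / (real m + real J))" if "i < J" for i
  proof -
    have "(real m - real i) / (real m + real i + 1) = 1 + - (2 * real i + 1) / (real m + real i + 1)"
      by (simp add: field_simps)
    also have "\<dots> \<le> exp (- (2 * real i + 1) / (real m + real i + 1))" by (rule exp_ge_add_one_self)
    also have "\<dots> \<le> exp (- (2 * real i + 1) / (real m + real J))"
    proof -
      have "(2 * real i + 1) / (real m + real J) \<le> (2 * real i + 1) / (real m + real i + 1)"
        using that assms by (intro divide_left_mono) auto
      then show ?thesis by (simp only: exp_le_cancel_iff minus_divide_left[symmetric] neg_le_iff_le)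
    qed
    finally show ?thesis .
  qed
  show ?thesis
    unfolding prod_exp_odd[symmetric] using up assms by (intro prod_mono) auto
qed

text \<open>A rewriting of Wallis' product: its partial products are \<open>16^m\<close> divided by
  the squared central binomial coefficient times 2m+1.\<close>

lemma central_binomial_asymptotics:
  "(\<lambda>m. sqrt (real m) * real (2*m choose m) / 4 ^ m) \<longlonglongrightarrow> 1 / sqrt pi"
proof -
  have eq: "(\<Prod>k=1..m. (4*real k^2) / (4*real k^2 - 1)) = 16 ^ m / ((real (2*m choose m))\<^sup>2 * (2 * real m + 1))" for m
  proof (induction m)
    case (Suc m)
    have "Suc m * (2 * Suc m choose Suc m) = 2 * (2 * m + 1) * (2 * m choose m)"
    proof -
      have "Suc m * (Suc (2*m+1) choose Suc m) = Suc (2*m+1) * ((2*m+1) choose m)"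
        by (metis Suc_times_binomial)
      moreover have "Suc m * ((2*m+1) choose m) = (2*m+1) * (2*m choose m)"
        using binomial_absorb_comp[of "Suc (2*m)" m] by simp
      ultimately have "Suc m * (Suc m * (Suc (2*m+1) choose Suc m)) = Suc (2*m+1) * ((2*m+1) * (2*m choose m))"
        by (metis mult.left_commute)
      also have "\<dots> = Suc m * (2 * (2 * m + 1) * (2 * m choose m))" by simp
      finally show ?thesis by (simp only: mult_cancel1) simp
    qed
    then have "real (Suc m) * real (2 * Suc m choose Suc m) = 2 * (2 * real m + 1) * real (2 * m choose m)"
      by (metis (mono_tags, lifting) of_nat_1 of_nat_add of_nat_mult of_nat_numeral)
    then have C: "real (2 * Suc m choose Suc m) = 2 * (2 * real m + 1) * real (2 * m choose m) / (real m + 1)"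
      by (simp add: field_simps)
    have C0: "real (2 * m choose m) > 0" by simp
    have d0: "4*real (Suc m)^2 - 1 = (2 * real m + 1) * (2 * real m + 3)"
      by (simp add: power2_eq_square algebra_simps)
    have alg: "16 ^ m / (c\<^sup>2 * a) * (4 * b\<^sup>2 / (a * e)) = 16 ^ Suc m / ((2 * a * c / b)\<^sup>2 * e)"
      if "a > 0" "b > 0" "c > 0" "e > 0" for a b c e :: real
      using that by (simp add: field_simps power2_eq_square)
    have "(\<Prod>k=1..Suc m. (4*real k^2) / (4*real k^2 - 1)) =
       16 ^ m / ((real (2*m choose m))\<^sup>2 * (2 * real m + 1)) * (4*real (Suc m)^2 / ((2 * real m + 1) * (2 * real m + 3)))"
      using Suc by (simp add: d0[symmetric])
    also have "\<dots> = 16 ^ Suc m / ((2 * (2 * real m + 1) * real (2*m choose m) / (real m + 1))\<^sup>2 * (2 * real m + 3))"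
      using alg[of "2 * real m + 1" "real m + 1" "real (2*m choose m)" "2 * real m + 3"] C0 by (simp add: add.commute)
    finally show ?case unfolding C[symmetric] by (simp add: algebra_simps)
  qed simp
  have "(\<lambda>m. 16 ^ m / ((real (2*m choose m))\<^sup>2 * (2 * real m + 1))) \<longlonglongrightarrow> pi / 2"
    using wallis unfolding eq .
  then have "(\<lambda>m. (real m / (2 * real m + 1)) * inverse (16 ^ m / ((real (2*m choose m))\<^sup>2 * (2 * real m + 1)))) \<longlonglongrightarrow> (1/2) * inverse (pi/2)"
    by (intro tendsto_mult tendsto_inverse) (real_asymp, auto)
  moreover have "(real m / (2 * real m + 1)) * inverse (16 ^ m / ((real (2*m choose m))\<^sup>2 * (2 * real m + 1))) 
     = (sqrt (real m) * real (2*m choose m) / 4 ^ m)\<^sup>2" for m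
  proof -
    have "(4 ^ m)\<^sup>2 = ((4::real)\<^sup>2) ^ m" by (simp only: power_mult[symmetric] mult.commute)
    then have p: "(4 ^ m)\<^sup>2 = (16::real) ^ m" by simp
    have "(a / b) * inverse (e / (c\<^sup>2 * b)) = a * c\<^sup>2 / e" if "b > 0" for a b c e :: real
      using that by (simp add: divide_simps)
    from this[of "2 * real m + 1"] show ?thesis by (simp add: power_divide power_mult_distrib p)
  qed
  ultimately have "(\<lambda>m. ((sqrt (real m) * real (2*m choose m) / 4 ^ m))\<^sup>2) \<longlonglongrightarrow> 1 / pi"
    by simp
  then have "(\<lambda>m. sqrt (((sqrt (real m) * real (2*m choose m) / 4 ^ m))\<^sup>2)) \<longlonglongrightarrow> sqrt (1 / pi)"
    by (rule tendsto_real_sqrt)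
  then show ?thesis by (simp add: real_sqrt_divide)
qed

text \<open>The derivative of \<open>cos u * exp (u^2 / 2)\<close> has the sign of u cos u - sin u,
  which is nonpositive on [0, pi/2]. This supplies the dominating series for the cosine
  side.\<close>

lemma cos_le_exp_square:
  fixes x :: real
  assumes "0 \<le> x" "x \<le> pi / 2"
  shows "cos x \<le> exp (- x\<^sup>2 / 2)"
proof -
  have xcos: "y * cos y \<le> sin y" if "0 \<le> y" "y \<le> pi / 2" for y :: real
  proof -
    have "sin 0 - 0 * cos 0 \<le> sin y - y * cos y"
    proof (rule DERIV_nonneg_imp_nondecreasing[OF that(1)])
      fix u assume "0 \<le> u" "u \<le> y"
      then have "u * sin u \<ge> 0" using that by (intro mult_nonneg_nonneg sin_ge_zero) auto
      moreover have "((\<lambda>u. sin u - u * cos u) has_real_derivative u * sin u) (at u)"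
        by (auto intro!: derivative_eq_intros)
      ultimately show "\<exists>v. ((\<lambda>u. sin u - u * cos u) has_real_derivative v) (at u) \<and> 0 \<le> v" by blast
    qed
    then show ?thesis by simp
  qed
  have "cos x * exp (x\<^sup>2 / 2) \<le> cos 0 * exp (0\<^sup>2 / 2)"
  proof (rule DERIV_nonpos_imp_nonincreasing[OF assms(1)])
    fix u assume u: "0 \<le> u" "u \<le> x"
    have "((\<lambda>u. cos u * exp (u\<^sup>2 / 2)) has_real_derivative (u * cos u - sin u) * exp (u\<^sup>2 / 2)) (at u)"
      by (auto intro!: derivative_eq_intros simp: algebra_simps)
    moreover have "(u * cos u - sin u) * exp (u\<^sup>2 / 2) \<le> 0"
      using xcos[of u] u assms by (intro mult_nonpos_nonneg) auto
    ultimately show "\<exists>v. ((\<lambda>u. cos u * exp (u\<^sup>2 / 2)) has_real_derivative v) (at u) \<and> v \<le> 0" by blast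
  qed
  then show ?thesis by (simp add: exp_minus field_simps)
qed

lemma power_exp_le_exp:
  fixes c :: real
  assumes "c \<ge> 0"
  shows "exp (- c * (real (Suc l))\<^sup>2) \<le> exp (- c) ^ l"
proof -
  have "real l \<le> (real (Suc l))\<^sup>2"
    by (simp add: power2_eq_square algebra_simps)
  then have "- c * (real (Suc l))\<^sup>2 \<le> real l * (- c)"
    using assms by (simp add: mult.commute mult_left_mono)
  then show ?thesis by (simp add: exp_of_nat_mult[symmetric])
qed

text \<open>Both sides of the finite identity, divided by \<open>4 ^ m\<close>, converge term by
  term; Tannery's theorem exchanges limit and sum, with geometric series as majorants.\<close>

theorem theta_inversion_real:
  fixes t :: real
  assumes t: "t > 0"
  shows "1 + 2 * (\<Sum>l. exp (- pi\<^sup>2 * (real (Suc l))\<^sup>2 * t)) =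
         1 / sqrt (pi * t) * (1 + 2 * (\<Sum>j. exp (- (real (Suc j))\<^sup>2 / t)))"
proof -
  define n where "n r = 2 * r + (1::nat)" for r
  \<comment> \<open>The floor makes \<open>m / n^2\<close> tend to \<open>t\<close>, the only
    coupling of the two parameters that the limit sees.\<close>
  define m where "m r = nat \<lfloor>t * (real (n r))\<^sup>2\<rfloor>" for r
  have n1: "n r > 0" "real (n r) = 2 * real r + 1" for r by (auto simp: n_def)
  have mb: "t * (real (n r))\<^sup>2 - 1 \<le> real (m r)" "real (m r) \<le> t * (real (n r))\<^sup>2" for r
    using t by (auto simp: m_def)
  have lim_m: "(\<lambda>r. real (m r) / (real (n r))\<^sup>2) \<longlonglongrightarrow> t"
  proof (rule tendsto_sandwich)
    show "\<forall>\<^sub>F r in sequentially. t - 1 / (real (n r))\<^sup>2 \<le> real (m r) / (real (n r))\<^sup>2"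
    proof (rule always_eventually, rule allI)
      fix r
      have "t - 1 / (real (n r))\<^sup>2 = (t * (real (n r))\<^sup>2 - 1) / (real (n r))\<^sup>2"
        using n1(1)[of r] by (simp add: diff_divide_distrib)
      also have "\<dots> \<le> real (m r) / (real (n r))\<^sup>2" using mb(1)[of r] by (intro divide_right_mono) auto
      finally show "t - 1 / (real (n r))\<^sup>2 \<le> real (m r) / (real (n r))\<^sup>2" .
    qed
    show "\<forall>\<^sub>F r in sequentially. real (m r) / (real (n r))\<^sup>2 \<le> t"
      using mb(2) n1(1) by (intro always_eventually allI) (simp add: divide_le_eq)
    show "(\<lambda>r. t - 1 / (real (n r))\<^sup>2) \<longlonglongrightarrow> t"
      unfolding n1(2) by real_asymp
  qed simp
  have lim_n: "filterlim (\<lambda>r. real (n r)) at_top sequentially"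
    unfolding n1(2) by real_asymp
  have ev_m: "\<forall>\<^sub>F r in sequentially. real (m r) > t / 2 * (real (n r))\<^sup>2"
  proof -
    have "\<forall>\<^sub>F r in sequentially. real (m r) / (real (n r))\<^sup>2 > t / 2"
      using lim_m t by (intro order_tendstoD(1)[OF lim_m]) auto
    then show ?thesis by eventually_elim (use n1 in \<open>simp add: field_simps\<close>)
  qed
  have ev_m2: "\<forall>\<^sub>F r in sequentially. real (m r) < 2 * t * (real (n r))\<^sup>2"
  proof -
    have "\<forall>\<^sub>F r in sequentially. real (m r) / (real (n r))\<^sup>2 < 2 * t"
      using lim_m t by (intro order_tendstoD(2)[OF lim_m]) auto
    then show ?thesis by eventually_elim (use n1 in \<open>simp add: field_simps\<close>)
  qed
  have m_top: "filterlim m at_top sequentially"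
  proof -
    have "filterlim (\<lambda>r. t / 2 * (real (n r))\<^sup>2) at_top sequentially"
      unfolding n1(2) using t by real_asymp
    then have "filterlim (\<lambda>r. real (m r)) at_top sequentially"
      by (rule filterlim_at_top_mono) (use ev_m in eventually_elim, auto)
    then show ?thesis
      using filterlim_sequentially_iff_filterlim_real by blast
  qed

  \<comment> \<open>Indices are shifted so that the term 1 stands apart. Outside the finite range
    \<open>A\<close> is set to 0 and \<open>B\<close> vanishes with its binomial coefficient, so
    both finite sums become series over all naturals.\<close>
  define A where "A l r = (if Suc l \<le> r then cos (pi * real (Suc l) / real (n r)) ^ (2 * m r) else 0)" for l r
  define B where "B j r = real (2 * m r choose (m r + Suc j * n r)) / real (2 * m r choose m r)" for j r
  define C where "C r = real (n r) * real (2 * m r choose m r) / 4 ^ m r" for r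

  have A_sum: "(\<Sum>l. A l r) = (\<Sum>l=1..r. cos (pi * real l / real (n r)) ^ (2 * m r))" for r
  proof -
    have "(\<Sum>l. A l r) = (\<Sum>l<r. A l r)"
      by (rule suminf_finite) (auto simp: A_def)
    also have "\<dots> = (\<Sum>l<r. cos (pi * real (Suc l) / real (n r)) ^ (2 * m r))"
      by (intro sum.cong refl) (auto simp: A_def)
    also have "\<dots> = (\<Sum>l=1..r. cos (pi * real l / real (n r)) ^ (2 * m r))"
      by (rule sum.reindex_bij_witness[of _ "\<lambda>l. l - 1" Suc]) auto
    finally show ?thesis .
  qed
  have B_sum: "(\<Sum>j. B j r) = (\<Sum>j=1..m r div n r. real (2 * m r choose (m r + j * n r))) / real (2 * m r choose m r)" for r
  proof -
    have "(\<Sum>j. B j r) = (\<Sum>j<m r div n r. B j r)"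
    proof (rule suminf_finite)
      fix j assume "j \<notin> {..<m r div n r}"
      then have "m r div n r < Suc j" by simp
      then have "m r < Suc j * n r" using n1(1)[of r] by (simp only: div_less_iff_less_mult)
      then show "B j r = 0" by (simp add: B_def binomial_eq_0)
    qed auto
    also have "\<dots> = (\<Sum>j<m r div n r. real (2 * m r choose (m r + Suc j * n r))) / real (2 * m r choose m r)"
      by (simp add: B_def sum_divide_distrib)
    also have "(\<Sum>j<m r div n r. real (2 * m r choose (m r + Suc j * n r))) =
        (\<Sum>j=1..m r div n r. real (2 * m r choose (m r + j * n r)))"
      by (rule sum.reindex_bij_witness[of _ "\<lambda>l. l - 1" Suc]) auto
    finally show ?thesis .
  qed
  have finite_id: "1 + 2 * (\<Sum>l. A l r) = C r * (1 + 2 * (\<Sum>j. B j r))" for r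
  proof -
    have c0: "real (2 * m r choose m r) > 0" by simp
    have "4 ^ m r * (1 + 2 * (\<Sum>l. A l r)) =
       real (n r) * (real (2*m r choose m r) + 2 * (\<Sum>j=1..m r div n r. real (2*m r choose (m r + j * n r))))"
      using sum_cos_powers_odd[where r=r and m="m r"] sum_cos_powers_eq_binomials[of "n r" "m r", OF n1(1)]
      unfolding A_sum by (simp add: n_def)
    also have "\<dots> = real (n r) * real (2*m r choose m r) * (1 + 2 * (\<Sum>j. B j r))"
      unfolding B_sum using c0 by (simp add: field_simps)
    finally show ?thesis by (simp add: C_def field_simps)
  qed

  have arg_le: "pi * real (Suc l) / real (n r) < pi / 2" if "Suc l \<le> r" for l r
  proof -
    have "2 * Suc l < n r" using that by (simp add: n_def)
    then have "2 * real (Suc l) < real (n r)" by (metis of_nat_less_iff of_nat_mult of_nat_numeral)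
    then have "real (Suc l) / real (n r) < 1 / 2" using n1(1)[of r] by (simp add: divide_less_eq)
    then have "pi * (real (Suc l) / real (n r)) < pi * (1 / 2)" by (intro mult_strict_left_mono) auto
    then show ?thesis by simp
  qed
  have limA: "(\<lambda>r. A l r) \<longlonglongrightarrow> exp (- pi\<^sup>2 * (real (Suc l))\<^sup>2 * t)" for l
  proof -
    define a where "a = pi * real (Suc l)"
    have a0: "a > 0" by (simp add: a_def)
    \<comment> \<open>The second-order expansion ln cos x ~ \<open>- x^2 / 2\<close> at
      \<open>x = a / n\<close>; the power \<open>2 * m\<close> with \<open>m / n^2\<close> tending
      to \<open>t\<close> turns it into the Gaussian.\<close>
    have "(\<lambda>r. (real (n r))\<^sup>2 * ln (cos (a / real (n r)))) \<longlonglongrightarrow> - (a * a / 2)"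
      unfolding n1(2) using a0 by real_asymp
    then have "(\<lambda>r. (real (n r))\<^sup>2 * ln (cos (a / real (n r)))) \<longlonglongrightarrow> - a\<^sup>2 / 2"
      by (simp add: power2_eq_square)
    then have "(\<lambda>r. exp (2 * (real (m r) / (real (n r))\<^sup>2) * ((real (n r))\<^sup>2 * ln (cos (a / real (n r)))))) \<longlonglongrightarrow> exp (2 * t * (- a\<^sup>2 / 2))"
      by (intro tendsto_intros lim_m)
    moreover have "\<forall>\<^sub>F r in sequentially. exp (2 * (real (m r) / (real (n r))\<^sup>2) * ((real (n r))\<^sup>2 * ln (cos (a / real (n r))))) = A l r"
      using eventually_ge_at_top[of "Suc l"]
    proof eventually_elim
      case (elim r)
      have "a / real (n r) < pi / 2"
        using arg_le[OF elim] by (simp add: a_def)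
      then have c: "cos (a / real (n r)) > 0" using a0 n1(1)[of r] by (intro cos_gt_zero) auto
      have "exp (2 * (real (m r) / (real (n r))\<^sup>2) * ((real (n r))\<^sup>2 * ln (cos (a / real (n r))))) =
            exp (real (2 * m r) * ln (cos (a / real (n r))))"
        using n1(1)[of r] by simp
      also have "\<dots> = cos (a / real (n r)) ^ (2 * m r)"
        using c by (subst exp_of_nat_mult) simp
      finally show ?case using elim by (simp add: A_def a_def)
    qed
    ultimately have "(\<lambda>r. A l r) \<longlonglongrightarrow> exp (2 * t * (- a\<^sup>2 / 2))"
      by (rule Lim_transform_eventually)
    also have "2 * t * (- a\<^sup>2 / 2) = - pi\<^sup>2 * (real (Suc l))\<^sup>2 * t"
      by (simp add: a_def power_mult_distrib)
    finally show ?thesis .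
  qed
  have boundA: "\<forall>\<^sub>F (l, r) in at_top \<times>\<^sub>F sequentially. norm (A l r) \<le> exp (- (t * pi\<^sup>2 / 2)) ^ l"
  proof -
    have "\<forall>\<^sub>F r in sequentially. \<forall>l. norm (A l r) \<le> exp (- (t * pi\<^sup>2 / 2)) ^ l"
      using ev_m
    proof eventually_elim
      case (elim r)
      show ?case
      proof
        fix l
        show "norm (A l r) \<le> exp (- (t * pi\<^sup>2 / 2)) ^ l"
        proof (cases "Suc l \<le> r")
          case True
          define x where "x = pi * real (Suc l) / real (n r)"
          have x: "0 \<le> x" "x \<le> pi / 2" using arg_le[OF True] by (auto simp: x_def)
          have "cos x \<ge> 0" using x by (intro cos_ge_zero) auto
          have "norm (A l r) = cos x ^ (2 * m r)" using True \<open>cos x \<ge> 0\<close> by (simp add: A_def x_def)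
          also have "\<dots> \<le> exp (- x\<^sup>2 / 2) ^ (2 * m r)"
            using x \<open>cos x \<ge> 0\<close> by (intro power_mono cos_le_exp_square)
          also have "\<dots> = exp (- (real (m r) * x\<^sup>2))"
            by (simp add: exp_of_nat_mult[symmetric])
          also have "\<dots> \<le> exp (- (t * pi\<^sup>2 / 2) * (real (Suc l))\<^sup>2)"
          proof -
            have "(t / 2 * (real (n r))\<^sup>2) * x\<^sup>2 \<le> real (m r) * x\<^sup>2"
              using elim by (intro mult_right_mono) auto
            moreover have "(t / 2 * (real (n r))\<^sup>2) * x\<^sup>2 = t / 2 * pi\<^sup>2 * (real (Suc l))\<^sup>2"
              using n1(1)[of r] by (simp add: x_def power_divide power_mult_distrib)
            ultimately have "t / 2 * pi\<^sup>2 * (real (Suc l))\<^sup>2 \<le> real (m r) * x\<^sup>2" by (simp only:)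
            moreover have "t / 2 * pi\<^sup>2 = t * pi\<^sup>2 / 2" by simp
            ultimately show ?thesis by (simp only: exp_le_cancel_iff mult_minus_left neg_le_iff_le)
          qed
          also have "\<dots> \<le> exp (- (t * pi\<^sup>2 / 2)) ^ l" using t by (intro power_exp_le_exp) auto
          finally show ?thesis .
        next
          case False then show ?thesis by (simp add: A_def)
        qed
      qed
    qed
    then show ?thesis
      unfolding eventually_prod_filter
      by (intro exI[of _ "\<lambda>_. True"] exI[of _ "\<lambda>r. \<forall>l. norm (A l r) \<le> exp (- (t * pi\<^sup>2 / 2)) ^ l"]) simp
  qed
  have summA: "summable (\<lambda>l. exp (- (t * pi\<^sup>2 / 2)) ^ l)"
    using t by (intro summable_geometric) simp
  have tA: "(\<lambda>r. \<Sum>l. A l r) \<longlonglongrightarrow> (\<Sum>l. exp (- pi\<^sup>2 * (real (Suc l))\<^sup>2 * t))"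
    using tannerys_theorem[OF limA boundA summA] by simp

  have B_eq: "B j r = (\<Prod>i<Suc j * n r. (real (m r) - real i) / (real (m r) + real i + 1))"
    if "Suc j * n r \<le> m r" for j r
    using central_binomial_ratio[OF that] by (simp add: B_def)
  have ev_small: "\<forall>\<^sub>F r in sequentially. Suc j * n r < m r" for j
  proof -
    have "\<forall>\<^sub>F r in sequentially. real (Suc j) * (2 * real r + 1) < t / 2 * (2 * real r + 1)\<^sup>2"
      using t by real_asymp
    then show ?thesis using ev_m
    proof eventually_elim
      case (elim r)
      then have "real (Suc j) * real (n r) < real (m r)" unfolding n1(2) by linarith
      then show ?case by (metis of_nat_less_iff of_nat_mult)
    qed
  qed
  have limB: "(\<lambda>r. B j r) \<longlonglongrightarrow> exp (- (real (Suc j))\<^sup>2 / t)" for j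
  proof -
    have aux: "(\<lambda>r. - (real (Suc j * n r))\<^sup>2 / (real (m r) + c * real (Suc j * n r))) \<longlonglongrightarrow> - (real (Suc j))\<^sup>2 / t" for c
    proof -
      have "(\<lambda>r. - (real (Suc j))\<^sup>2 / (real (m r) / (real (n r))\<^sup>2 + c * (real (Suc j) * (1 / real (n r))))) \<longlonglongrightarrow> - (real (Suc j))\<^sup>2 / (t + c * (real (Suc j) * 0))"
      proof (intro tendsto_intros lim_m)
        show "(\<lambda>r. 1 / real (n r)) \<longlonglongrightarrow> 0" unfolding n1(2) by real_asymp
      qed (use t in auto)
      moreover have "- (real (Suc j))\<^sup>2 / (real (m r) / (real (n r))\<^sup>2 + c * (real (Suc j) * (1 / real (n r)))) =
         - (real (Suc j * n r))\<^sup>2 / (real (m r) + c * real (Suc j * n r))" for r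
      proof -
        have "real (m r) / (real (n r))\<^sup>2 + c * (real (Suc j) * (1 / real (n r))) = (real (m r) + c * real (Suc j * n r)) / (real (n r))\<^sup>2"
        proof -
          have "M / N\<^sup>2 + c * (J * (1 / N)) = (M + c * (J * N)) / N\<^sup>2" if "N > 0" for M N J :: real
            using that by (simp add: add_divide_distrib power2_eq_square)
          from this[of "real (n r)"] show ?thesis using n1(1)[of r] by (simp only: of_nat_mult of_nat_0_less_iff)
        qed
        then show ?thesis by (simp only: of_nat_mult power_mult_distrib) simp
      qed
      ultimately show ?thesis by simp
    qed
    show ?thesis
    proof (rule tendsto_sandwich)
      show "(\<lambda>r. exp (- (real (Suc j * n r))\<^sup>2 / (real (m r) + (-1) * real (Suc j * n r)))) \<longlonglongrightarrow> exp (- (real (Suc j))\<^sup>2 / t)"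
        by (intro tendsto_exp aux)
      show "(\<lambda>r. exp (- (real (Suc j * n r))\<^sup>2 / (real (m r) + 1 * real (Suc j * n r)))) \<longlonglongrightarrow> exp (- (real (Suc j))\<^sup>2 / t)"
        by (intro tendsto_exp aux)
      show "\<forall>\<^sub>F r in sequentially. exp (- (real (Suc j * n r))\<^sup>2 / (real (m r) + (-1) * real (Suc j * n r))) \<le> B j r"
        using ev_small[of j]
      proof eventually_elim
        case (elim r)
        have "real (m r) + (-1) * real (Suc j * n r) = real (m r) - real (Suc j * n r)" by simp
        then show ?case using central_binomial_ratio_ge[OF elim] B_eq[OF less_imp_le[OF elim]] by (simp only:)
      qed
      show "\<forall>\<^sub>F r in sequentially. B j r \<le> exp (- (real (Suc j * n r))\<^sup>2 / (real (m r) + 1 * real (Suc j * n r)))"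
        using ev_small[of j]
      proof eventually_elim
        case (elim r)
        show ?case using central_binomial_ratio_le[OF less_imp_le[OF elim]] B_eq[OF less_imp_le[OF elim]] by (simp only: mult_1)
      qed
    qed
  qed
  have boundB: "\<forall>\<^sub>F (j, r) in at_top \<times>\<^sub>F sequentially. norm (B j r) \<le> exp (- (1 / (4 * t))) ^ j"
  proof -
    have "\<forall>\<^sub>F r in sequentially. \<forall>j. norm (B j r) \<le> exp (- (1 / (4 * t))) ^ j"
      using ev_m2 ev_m
    proof eventually_elim
      case (elim r)
      have m0: "real (m r) > 0" using elim(2) t n1(1)[of r] by (meson mult_pos_pos half_gt_zero order.strict_trans zero_less_power of_nat_0_less_iff)
      show ?case
      proof
        fix j
        define J where "J = Suc j * n r"
        show "norm (B j r) \<le> exp (- (1 / (4 * t))) ^ j"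
        proof (cases "J \<le> m r")
          case False
          then show ?thesis by (simp add: B_def J_def binomial_eq_0)
        next
          case True
          have "norm (B j r) \<le> exp (- (real J)\<^sup>2 / (real (m r) + real J))"
          proof -
            have "B j r \<ge> 0" by (simp add: B_def)
            then have "norm (B j r) = B j r" by simp
            then show ?thesis using central_binomial_ratio_le[OF True] B_eq[of j r] True by (simp only: J_def)
          qed
          also have "\<dots> \<le> exp (- (1 / (4 * t)) * (real (Suc j))\<^sup>2)"
          proof -
            have "(real J)\<^sup>2 / (real (m r) + real J) \<ge> (real J)\<^sup>2 / (4 * t * (real (n r))\<^sup>2)"
              using elim True m0 t n1(1)[of r] by (intro divide_left_mono) (auto intro!: mult_pos_pos)
            also have "(real J)\<^sup>2 / (4 * t * (real (n r))\<^sup>2) = 1 / (4 * t) * (real (Suc j))\<^sup>2"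
            proof -
              have "(a * N)\<^sup>2 / (4 * t * N\<^sup>2) = 1 / (4 * t) * a\<^sup>2" if "N > 0" for a N :: real
                using that by (simp add: power_mult_distrib)
              from this[of "real (n r)" "real (Suc j)"] show ?thesis using n1(1)[of r] by (simp only: J_def of_nat_mult of_nat_0_less_iff)
            qed
            finally show ?thesis by (simp only: exp_le_cancel_iff mult_minus_left minus_divide_left[symmetric] neg_le_iff_le)
          qed
          also have "\<dots> \<le> exp (- (1 / (4 * t))) ^ j" using t by (intro power_exp_le_exp) auto
          finally show ?thesis .
        qed
      qed
    qed
    then show ?thesis
      unfolding eventually_prod_filter
      by (intro exI[of _ "\<lambda>_. True"] exI[of _ "\<lambda>r. \<forall>j. norm (B j r) \<le> exp (- (1 / (4 * t))) ^ j"]) simp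
  qed
  have summB: "summable (\<lambda>j. exp (- (1 / (4 * t))) ^ j)"
    using t by (intro summable_geometric) simp
  have tB: "(\<lambda>r. \<Sum>j. B j r) \<longlonglongrightarrow> (\<Sum>j. exp (- (real (Suc j))\<^sup>2 / t))"
    using tannerys_theorem[OF limB boundB summB] by simp

  \<comment> \<open>\<open>C r\<close> is n / sqrt m times (sqrt m times the central binomial
    coefficient over \<open>4 ^ m\<close>); the factors tend to 1 / sqrt t and 1 / sqrt pi.\<close>
  have tC: "C \<longlonglongrightarrow> 1 / sqrt (pi * t)"
  proof -
    have "(\<lambda>r. (1 / sqrt (real (m r) / (real (n r))\<^sup>2)) * (sqrt (real (m r)) * real (2*m r choose m r) / 4 ^ m r)) \<longlonglongrightarrow> (1 / sqrt t) * (1 / sqrt pi)"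
      using t by (intro tendsto_intros lim_m filterlim_compose[OF central_binomial_asymptotics m_top]) auto
    moreover have "\<forall>\<^sub>F r in sequentially. (1 / sqrt (real (m r) / (real (n r))\<^sup>2)) * (sqrt (real (m r)) * real (2*m r choose m r) / 4 ^ m r) = C r"
      using ev_m
    proof eventually_elim
      case (elim r)
      then have "real (m r) > 0" using t n1(1)[of r] by (meson mult_pos_pos half_gt_zero order.strict_trans zero_less_power of_nat_0_less_iff)
      then show ?case by (simp add: C_def real_sqrt_divide)
    qed
    ultimately have "C \<longlonglongrightarrow> (1 / sqrt t) * (1 / sqrt pi)"
      by (rule Lim_transform_eventually)
    then show ?thesis by (simp add: real_sqrt_mult mult.commute)
  qed
  have "(\<lambda>r. 1 + 2 * (\<Sum>l. A l r)) \<longlonglongrightarrow> 1 + 2 * (\<Sum>l. exp (- pi\<^sup>2 * (real (Suc l))\<^sup>2 * t))"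
    by (intro tendsto_intros tA)
  moreover have "(\<lambda>r. 1 + 2 * (\<Sum>l. A l r)) \<longlonglongrightarrow> 1 / sqrt (pi * t) * (1 + 2 * (\<Sum>j. exp (- (real (Suc j))\<^sup>2 / t)))"
    unfolding finite_id by (intro tendsto_intros tB tC)
  ultimately show ?thesis by (rule LIMSEQ_unique)
qed

subsection \<open>A product for \<open>\<psi>\<close>\<close>

text \<open>The product \<open>(q;q^2)_infinity\<close>, the part of \<open>euler_E\<close> over odd
  exponents.\<close>

definition odd_prod :: "complex \<Rightarrow> complex" where
  "odd_prod q = (\<Prod>k. 1 - q ^ (2 * k + 1))"

lemma norm_summable_power:
  fixes q :: complex
  assumes "norm q < 1" "\<And>k. f k \<ge> k"
  shows "summable (\<lambda>k. norm (q ^ f k))"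
proof (rule summable_comparison_test')
  show "summable (\<lambda>k. norm q ^ k)" using assms(1) by (intro summable_geometric) simp
  show "\<And>k. k \<ge> 0 \<Longrightarrow> norm (norm (q ^ f k)) \<le> norm q ^ k"
    using assms by (simp add: norm_power power_decreasing)
qed

lemma triangular_ge: "(k::nat) \<le> k * (k + 1) div 2"
proof -
  have "k * 2 \<le> k * (k + 1)" by (cases k) auto
  then show ?thesis by linarith
qed

lemma convergent_prod_1_minus_power:
  fixes q :: complex
  assumes "norm q < 1" "\<And>k. f k \<ge> k"
  shows "convergent_prod (\<lambda>k. 1 - q ^ f k)"
proof (rule abs_convergent_prod_imp_convergent_prod, rule summable_imp_abs_convergent_prod)
  show "summable (\<lambda>k. norm (1 - q ^ f k - 1))" using norm_summable_power[OF assms] by simp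
qed

lemma one_minus_power_nonzero:
  fixes q :: complex
  assumes "norm q < 1" "n > 0"
  shows "1 - q ^ n \<noteq> 0"
proof
  assume "1 - q ^ n = 0"
  then have "norm (q ^ n) = 1" by (metis eq_iff_diff_eq_0 norm_one)
  then have "norm q ^ n = 1" by (simp add: norm_power)
  then show False using assms by (metis less_irrefl norm_ge_zero power_less_one_iff)
qed

lemma norm_power_less_1: "norm (q :: complex) < 1 \<Longrightarrow> n > 0 \<Longrightarrow> norm (q ^ n) < 1"
  by (simp add: norm_power power_less_one_iff)

lemma euler_E_LIMSEQ:
  assumes "norm q < 1"
  shows "(\<lambda>n. \<Prod>k<n. 1 - q ^ Suc k) \<longlonglongrightarrow> euler_E q"
proof -
  have "(\<lambda>n. \<Prod>k\<le>n. 1 - q ^ Suc k) \<longlonglongrightarrow> euler_E q"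
    unfolding euler_E_def by (rule convergent_prod_LIMSEQ, rule convergent_prod_1_minus_power[OF assms]) simp
  then show ?thesis
    by (subst filterlim_sequentially_Suc[symmetric]) (simp add: lessThan_Suc_atMost)
qed

lemma odd_prod_LIMSEQ:
  assumes "norm q < 1"
  shows "(\<lambda>n. \<Prod>k<n. 1 - q ^ (2 * k + 1)) \<longlonglongrightarrow> odd_prod q"
proof -
  have "(\<lambda>n. \<Prod>k\<le>n. 1 - q ^ (2 * k + 1)) \<longlonglongrightarrow> odd_prod q"
    unfolding odd_prod_def by (rule convergent_prod_LIMSEQ, rule convergent_prod_1_minus_power[OF assms]) simp
  then show ?thesis
    by (subst filterlim_sequentially_Suc[symmetric]) (simp add: lessThan_Suc_atMost)
qed

lemma euler_E_nonzero: "norm q < 1 \<Longrightarrow> euler_E q \<noteq> 0"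
  unfolding euler_E_def
  by (intro prodinf_nonzero convergent_prod_1_minus_power one_minus_power_nonzero) auto

lemma odd_prod_nonzero: "norm q < 1 \<Longrightarrow> odd_prod q \<noteq> 0"
  unfolding odd_prod_def
  by (intro prodinf_nonzero convergent_prod_1_minus_power one_minus_power_nonzero) auto

lemma odd_prod_mult_minus:
  assumes "norm q < 1"
  shows "odd_prod q * odd_prod (- q) = odd_prod (q\<^sup>2)"
proof -
  have "(\<lambda>n. (\<Prod>k<n. 1 - q ^ (2 * k + 1)) * (\<Prod>k<n. 1 - (- q) ^ (2 * k + 1))) \<longlonglongrightarrow> odd_prod q * odd_prod (- q)"
    using assms by (intro tendsto_mult odd_prod_LIMSEQ) auto
  moreover have "(\<Prod>k<n. 1 - q ^ (2 * k + 1)) * (\<Prod>k<n. 1 - (- q) ^ (2 * k + 1)) = (\<Prod>k<n. 1 - (q\<^sup>2) ^ (2 * k + 1))" for n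
    unfolding prod.distrib[symmetric]
    by (intro prod.cong refl) (simp add: power_mult[symmetric] power_add power2_eq_square algebra_simps power_mult_distrib)
  ultimately have "(\<lambda>n. \<Prod>k<n. 1 - (q\<^sup>2) ^ (2 * k + 1)) \<longlonglongrightarrow> odd_prod q * odd_prod (- q)" by simp
  then show ?thesis
    using odd_prod_LIMSEQ[of "q\<^sup>2"] assms norm_power_less_1[of q 2] LIMSEQ_unique by fastforce
qed

lemma euler_E_split:
  assumes "norm q < 1"
  shows "euler_E q = odd_prod q * euler_E (q\<^sup>2)"
proof -
  have "(\<lambda>n. (\<Prod>k<n. 1 - q ^ (2 * k + 1)) * (\<Prod>k<n. 1 - (q\<^sup>2) ^ Suc k)) \<longlonglongrightarrow> odd_prod q * euler_E (q\<^sup>2)"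
    using assms norm_power_less_1[of q 2] by (intro tendsto_mult odd_prod_LIMSEQ euler_E_LIMSEQ) auto
  moreover have "(\<Prod>k<n. 1 - q ^ (2 * k + 1)) * (\<Prod>k<n. 1 - (q\<^sup>2) ^ Suc k) = (\<Prod>k<2*n. 1 - q ^ Suc k)" for n
  proof (induction n)
    case (Suc n)
    have "(q\<^sup>2) ^ Suc n = q ^ Suc (Suc (2 * n))" by (simp only: power_mult[symmetric]) simp
    then show ?case using Suc by (simp add: mult_ac)
  qed simp
  ultimately have "(\<lambda>n. \<Prod>k<2*n. 1 - q ^ Suc k) \<longlonglongrightarrow> odd_prod q * euler_E (q\<^sup>2)" by simp
  moreover have "(\<lambda>n. \<Prod>k<2*n. 1 - q ^ Suc k) \<longlonglongrightarrow> euler_E q"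
    using LIMSEQ_subseq_LIMSEQ[OF euler_E_LIMSEQ[OF assms], of "\<lambda>n. 2 * n"]
    by (simp add: strict_mono_def o_def)
  ultimately show ?thesis by (metis LIMSEQ_unique)
qed

context
  fixes q :: complex and P :: "nat \<Rightarrow> complex"
  assumes q: "norm q < 1"
  defines "P \<equiv> \<lambda>n. \<Prod>k<n. (1 - q ^ (2 * k + 2)) / (1 - q ^ (2 * k + 1))"
begin

private lemma P_nonzero: "P n \<noteq> 0"
  unfolding P_def using one_minus_power_nonzero[OF q]
  by (subst prod_zero_iff) (simp_all del: power_Suc add: divide_eq_0_iff)

private lemma P_Suc: "P (Suc n) = P n * ((1 - q ^ (2 * n + 2)) / (1 - q ^ (2 * n + 1)))"
  by (simp add: P_def)

text \<open>Shanks' finite form of the product for \<open>\<psi>\<close>: as \<open>n \<rightarrow> \<infinity>\<close> only the term \<open>s = 0\<close> survives.\<close>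

lemma shanks_identity: "(\<Sum>s<n. P n / P s * q ^ (s * (2 * n + 1))) = (\<Sum>s<2*n. q ^ (s * (s + 1) div 2))"
proof (induction n)
  case (Suc n)
  note nz = one_minus_power_nonzero[OF q]
  \<comment> \<open>The increments from n to n+1 sum in closed form for every upper bound k, so
    induction on k applies. At \<open>k = n\<close>, together with the new term
    \<open>s = n\<close>, this yields exactly the triangular powers with indices 2n and
    2n+1.\<close>
  have tel: "(\<Sum>s<k. P (Suc n) / P s * q ^ (s * (2 * Suc n + 1)) - P n / P s * q ^ (s * (2 * n + 1)))
     = P n / P k * (1 - q ^ (2 * k)) * q ^ (k * (2 * n + 1)) / (1 - q ^ (2 * n + 1))" for k
  proof (induction k)
    case (Suc k)
    define a where "a = q ^ (2 * k)"
    define b where "b = q ^ (2 * n)"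
    define c where "c = q ^ (k * (2 * n + 1))"
    have nzs: "1 - a * q\<^sup>2 \<noteq> 0" "1 - a * q \<noteq> 0" "1 - b * q \<noteq> 0"
      using nz[of "2*k+2"] nz[of "2*k+1"] nz[of "2*n+1"] by (auto simp: a_def b_def power_add power2_eq_square mult_ac)
    have "k * (2 * Suc n + 1) = k * (2 * n + 1) + 2 * k" "Suc k * (2 * n + 1) = k * (2 * n + 1) + (2 * n + 1)"
      by (simp_all add: algebra_simps)
    then have e1: "q ^ (k * (2 * Suc n + 1)) = c * a" and e2: "q ^ (Suc k * (2 * n + 1)) = c * (b * q)"
      by (simp_all only: c_def a_def b_def power_add power_one_right)
    have e3: "q ^ (2 * n + 1) = b * q" "q ^ (2 * n + 2) = b * q\<^sup>2" "q ^ (2 * Suc k) = a * q\<^sup>2"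
        "q ^ (2 * k + 2) = a * q\<^sup>2" "q ^ (2 * k + 1) = a * q"
      by (simp_all add: a_def b_def power_add power2_eq_square)
    have pk: "P k \<noteq> 0" by (rule P_nonzero)
    have "(\<Sum>s<Suc k. P (Suc n) / P s * q ^ (s * (2 * Suc n + 1)) - P n / P s * q ^ (s * (2 * n + 1))) =
       P n / P k * (1 - a) * c / (1 - b * q) + (P n * ((1 - b * q\<^sup>2) / (1 - b * q)) / P k * (c * a) - P n / P k * c)"
      by (subst sum.lessThan_Suc, subst Suc.IH) (simp only: P_Suc e1 e3 a_def[symmetric] c_def[symmetric])
    also have "\<dots> = P n / P k * (c * (b * q)) * (1 - a * q) / (1 - b * q)"
      using nzs pk by (simp add: divide_simps) (simp add: algebra_simps power2_eq_square)
    also have "\<dots> = P n / (P k * ((1 - a * q\<^sup>2) / (1 - a * q))) * (1 - a * q\<^sup>2) * (c * (b * q)) / (1 - b * q)"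
      using nzs pk by (simp add: divide_simps)
    finally show ?case by (simp only: P_Suc e2 e3)
  qed simp
  define b where "b = q ^ (2 * n)"
  define d where "d = q ^ (n * (2 * n + 1))"
  have nzs: "1 - b * q \<noteq> 0"
    using nz[of "2*n+1"] by (auto simp: b_def power_add mult_ac)
  have tri: "(2 * n) * (2 * n + 1) div 2 = n * (2 * n + 1)" "(2 * n + 1) * (2 * n + 1 + 1) div 2 = n * (2 * n + 1) + (2 * n + 1)"
    by (simp_all add: algebra_simps)
  have "n * (2 * Suc n + 1) = n * (2 * n + 1) + 2 * n" by (simp add: algebra_simps)
  then have e: "q ^ (n * (2 * Suc n + 1)) = d * b" by (simp only: d_def b_def power_add)
  have e3: "q ^ (2 * n + 1) = b * q" "q ^ (2 * n + 2) = b * q\<^sup>2"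
    by (simp_all add: b_def power_add power2_eq_square)
  have pn: "P n \<noteq> 0" by (rule P_nonzero)
  have "(\<Sum>s<Suc n. P (Suc n) / P s * q ^ (s * (2 * Suc n + 1))) =
     (\<Sum>s<n. P n / P s * q ^ (s * (2 * n + 1))) +
     (\<Sum>s<n. P (Suc n) / P s * q ^ (s * (2 * Suc n + 1)) - P n / P s * q ^ (s * (2 * n + 1))) +
     P (Suc n) / P n * q ^ (n * (2 * Suc n + 1))"
    by (simp add: sum_subtractf)
  also have "\<dots> = (\<Sum>s<2*n. q ^ (s * (s + 1) div 2)) + (P n / P n * (1 - b) * d / (1 - b * q) +
      P n * ((1 - b * q\<^sup>2) / (1 - b * q)) / P n * (d * b))"
    unfolding Suc.IH tel by (simp only: P_Suc e e3 b_def[symmetric] d_def[symmetric] add.assoc)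
  also have "P n / P n * (1 - b) * d / (1 - b * q) + P n * ((1 - b * q\<^sup>2) / (1 - b * q)) / P n * (d * b) = d + d * (b * q)"
    using nzs pn by (simp add: divide_simps) (simp add: algebra_simps power2_eq_square)
  also have "d = q ^ ((2 * n) * (2 * n + 1) div 2)" unfolding tri d_def ..
  also have "q ^ ((2 * n) * (2 * n + 1) div 2) * (b * q) = q ^ ((2 * n + 1) * (2 * n + 1 + 1) div 2)"
    unfolding tri b_def by (simp only: power_add power_one_right)
  finally show ?case by (simp add: add.assoc)
qed simp

lemma summable_psi: "summable (\<lambda>n. norm (q ^ (n * (n + 1) div 2)))"
  by (rule norm_summable_power[OF q triangular_ge])

text \<open>Gauss' product for psi, the limit of \<open>shanks_identity\<close>. As \<open>P\<close>
  has a nonzero limit, the quotients \<open>P n / P s\<close> are bounded uniformly, so the terms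
  with \<open>s > 0\<close> are dominated by \<open>n * r ^ n\<close>.\<close>

lemma psi_product: "ramanujan_psi q * odd_prod q = euler_E (q\<^sup>2)"
proof -
  have q2: "norm (q\<^sup>2) < 1" using norm_power_less_1[OF q, of 2] by simp
  define L where "L = euler_E (q\<^sup>2) / odd_prod q"
  have L0: "L \<noteq> 0" using euler_E_nonzero[OF q2] odd_prod_nonzero[OF q] by (simp add: L_def)
  have Plim: "P \<longlonglongrightarrow> L"
  proof -
    have "(\<lambda>n. (\<Prod>k<n. 1 - (q\<^sup>2) ^ Suc k) / (\<Prod>k<n. 1 - q ^ (2 * k + 1))) \<longlonglongrightarrow> L"
      unfolding L_def by (intro tendsto_divide euler_E_LIMSEQ odd_prod_LIMSEQ q q2 odd_prod_nonzero)
    moreover have "(\<Prod>k<n. 1 - (q\<^sup>2) ^ Suc k) / (\<Prod>k<n. 1 - q ^ (2 * k + 1)) = P n" for n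
      unfolding P_def prod_dividef power_mult[symmetric] by simp
    ultimately show ?thesis by simp
  qed
  obtain C1 where C1: "\<And>n. norm (P n) \<le> C1"
    using Plim by (metis Bseq_def convergentI convergent_imp_Bseq)
  have "(\<lambda>n. inverse (P n)) \<longlonglongrightarrow> inverse L" using Plim L0 by (rule tendsto_inverse)
  then obtain C2 where C2: "\<And>n. norm (inverse (P n)) \<le> C2"
    by (metis Bseq_def convergentI convergent_imp_Bseq)
  define C where "C = C1 * C2"
  have C: "norm (P n / P s) \<le> C" for n s
    unfolding C_def divide_inverse norm_mult
    using C1[of n] C2[of s] by (intro mult_mono) (auto intro: order.trans[OF norm_ge_zero C1])
  have C0: "C \<ge> 0" using C[of 0 0] norm_ge_zero order.trans by blast
  define r where "r = norm q"
  have r: "0 \<le> r" "r < 1" using q by (auto simp: r_def)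
  have rest: "(\<lambda>n. \<Sum>s\<in>{1..<n}. P n / P s * q ^ (s * (2 * n + 1))) \<longlonglongrightarrow> 0"
  proof (rule Lim_null_comparison)
    show "\<forall>\<^sub>F n in sequentially. norm (\<Sum>s\<in>{1..<n}. P n / P s * q ^ (s * (2 * n + 1))) \<le> C * (real n * r ^ n)"
    proof (rule always_eventually, rule allI)
      fix n
      have "norm (\<Sum>s\<in>{1..<n}. P n / P s * q ^ (s * (2 * n + 1))) \<le> (\<Sum>s\<in>{1..<n}. C * r ^ n)"
      proof (rule sum_norm_le)
        fix s assume s: "s \<in> {1..<n}"
        \<comment> \<open>A crude exponent suffices: n terms of size \<open>r ^ n\<close> still tend
          to 0.\<close>
        have "n \<le> s * (2 * n + 1)" using s by (cases s) auto
        then have "r ^ (s * (2 * n + 1)) \<le> r ^ n" using r by (intro power_decreasing) auto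
        then show "norm (P n / P s * q ^ (s * (2 * n + 1))) \<le> C * r ^ n"
          unfolding norm_mult norm_power r_def[symmetric] using C C0 r by (intro mult_mono) auto
      qed
      also have "\<dots> = real (n - 1) * (C * r ^ n)" by simp
      also have "\<dots> \<le> real n * (C * r ^ n)"
        using C0 r by (intro mult_right_mono) auto
      finally show "norm (\<Sum>s\<in>{1..<n}. P n / P s * q ^ (s * (2 * n + 1))) \<le> C * (real n * r ^ n)"
        by (simp add: mult_ac)
    qed
    have "(\<lambda>n. real n * r ^ n) \<longlonglongrightarrow> 0"
      using powser_times_n_limit_0[of r] r by simp
    then show "(\<lambda>n. C * (real n * r ^ n)) \<longlonglongrightarrow> 0"
      using tendsto_mult_left[of _ 0 _ C] by simp
  qed
  have "(\<lambda>n. P n + (\<Sum>s\<in>{1..<n}. P n / P s * q ^ (s * (2 * n + 1)))) \<longlonglongrightarrow> L + 0"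
    by (intro tendsto_add Plim rest)
  moreover have "\<forall>\<^sub>F n in sequentially. P n + (\<Sum>s\<in>{1..<n}. P n / P s * q ^ (s * (2 * n + 1))) =
      (\<Sum>s<2*n. q ^ (s * (s + 1) div 2))"
    using eventually_gt_at_top[of 0]
  proof eventually_elim
    case (elim n)
    have "{..<n} = insert 0 {1..<n}" using elim by auto
    then show ?case unfolding shanks_identity[symmetric] by (simp add: P_def)
  qed
  ultimately have "(\<lambda>n. \<Sum>s<2*n. q ^ (s * (s + 1) div 2)) \<longlonglongrightarrow> L + 0"
    by (rule Lim_transform_eventually)
  moreover have "(\<lambda>n. \<Sum>s<2*n. q ^ (s * (s + 1) div 2)) \<longlonglongrightarrow> ramanujan_psi q"
  proof -
    have "(\<lambda>n. \<Sum>s<n. q ^ (s * (s + 1) div 2)) \<longlonglongrightarrow> ramanujan_psi q"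
      unfolding ramanujan_psi_def by (rule summable_LIMSEQ, rule summable_norm_cancel, rule summable_psi)
    from LIMSEQ_subseq_LIMSEQ[OF this, of "\<lambda>n. 2 * n"] show ?thesis
      by (simp add: strict_mono_def o_def)
  qed
  ultimately have "L + 0 = ramanujan_psi q" by (rule LIMSEQ_unique)
  then show ?thesis using odd_prod_nonzero[OF q] by (simp add: L_def divide_eq_eq)
qed

end

subsection \<open>Theta series over the integers and binary forms\<close>

definition theta_phi :: "complex \<Rightarrow> complex" where
  "theta_phi q = 1 + 2 * (\<Sum>n. q ^ (Suc n)\<^sup>2)"

lemma has_sum_mult_Times:
  fixes f :: "'a \<Rightarrow> complex" and g :: "'b \<Rightarrow> complex"
  assumes f: "(f has_sum a) A" and g: "(g has_sum b) B"
  shows "((\<lambda>(x, y). f x * g y) has_sum a * b) (A \<times> B)"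
proof (rule has_sum_SigmaI)
  show "((\<lambda>y. case (x, y) of (x, y) \<Rightarrow> f x * g y) has_sum f x * b) B" if "x \<in> A" for x
    using has_sum_cmult_right[OF g, of "f x"] by simp
  show "((\<lambda>x. f x * b) has_sum a * b) A"
    by (rule has_sum_cmult_left[OF f])
  have fa: "(\<lambda>x. norm (f x)) summable_on A" and ga: "(\<lambda>y. norm (g y)) summable_on B"
    using f g summable_on_iff_abs_summable_on_complex has_sum_imp_summable by blast+
  have "(\<lambda>p. norm (case p of (x, y) \<Rightarrow> f x * g y)) summable_on A \<times> B"
  proof (rule summable_on_SigmaI)
    show "((\<lambda>y. norm (case (x, y) of (x, y) \<Rightarrow> f x * g y)) has_sum norm (f x) * infsum (\<lambda>y. norm (g y)) B) B" for x
      using has_sum_cmult_right[OF has_sum_infsum[OF ga], of "norm (f x)"] by (simp add: norm_mult)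
    show "(\<lambda>x. norm (f x) * infsum (\<lambda>y. norm (g y)) B) summable_on A"
      using fa by (rule summable_on_cmult_left)
  qed auto
  then show "(\<lambda>(x, y). f x * g y) summable_on A \<times> B"
    by (rule abs_summable_summable)
qed

lemma has_sum_two_images:
  fixes F :: "'b \<Rightarrow> 'c :: {topological_comm_monoid_add, t2_space}"
  assumes "((\<lambda>x. F (f x)) has_sum a) UNIV" "((\<lambda>x. F (g x)) has_sum b) UNIV"
    and "inj f" "inj g" "range f \<inter> range g = {}" "range f \<union> range g = UNIV"
  shows "(F has_sum (a + b)) UNIV"
proof -
  have "(F has_sum a) (range f)" "(F has_sum b) (range g)"
    using assms by (simp_all add: has_sum_reindex o_def)
  from has_sum_Un_disjoint[OF this] show ?thesis using assms by simp
qed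

lemma has_sum_theta_phi:
  assumes q: "norm q < 1"
  shows "((\<lambda>n::int. q powi n\<^sup>2) has_sum theta_phi q) UNIV"
proof -
  define S where "S = (\<Sum>n. q ^ (Suc n)\<^sup>2)"
  have "summable (\<lambda>n. norm (q ^ (Suc n)\<^sup>2))"
    by (rule norm_summable_power[OF q]) (simp add: power2_eq_square)
  then have S: "((\<lambda>n. q ^ (Suc n)\<^sup>2) has_sum S) UNIV"
    unfolding S_def by (intro norm_summable_imp_has_sum summable_sums) (auto dest: summable_norm_cancel)
  have pw: "q powi (int (Suc n))\<^sup>2 = q ^ (Suc n)\<^sup>2" for n
    by (metis of_nat_power power_int_of_nat)
  have 1: "((\<lambda>n::int. q powi n\<^sup>2) has_sum S) (range (\<lambda>n. int (Suc n)))"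
    using S by (subst has_sum_reindex) (auto simp: inj_on_def o_def pw simp del: of_nat_Suc)
  have 2: "((\<lambda>n::int. q powi n\<^sup>2) has_sum S) (range (\<lambda>n. - int (Suc n)))"
    using S by (subst has_sum_reindex) (auto simp: inj_on_def o_def pw simp del: of_nat_Suc)
  have 3: "((\<lambda>n::int. q powi n\<^sup>2) has_sum 1) {0}"
    by (intro has_sum_finiteI) auto
  have U: "UNIV = {0::int} \<union> (range (\<lambda>n. int (Suc n)) \<union> range (\<lambda>n. - int (Suc n)))"
  proof -
    have "n \<in> {0::int} \<union> (range (\<lambda>n. int (Suc n)) \<union> range (\<lambda>n. - int (Suc n)))" for n
    proof -
      consider "n = 0" | "n > 0" | "n < 0" by linarith
      then show ?thesis
      proof cases
        case 2
        then have "n = int (Suc (nat (n - 1)))" by simp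
        then show ?thesis by blast
      next
        case 3
        then have "n = - int (Suc (nat (- n - 1)))" by simp
        then show ?thesis by blast
      qed simp
    qed
    then show ?thesis by blast
  qed
  have "((\<lambda>n::int. q powi n\<^sup>2) has_sum (1 + (S + S))) ({0} \<union> (range (\<lambda>n. int (Suc n)) \<union> range (\<lambda>n. - int (Suc n))))"
    by (intro has_sum_Un_disjoint 1 2 3) (auto simp del: of_nat_Suc)
  then show ?thesis unfolding U[symmetric] by (simp add: theta_phi_def S_def)
qed

text \<open>n and -1-n give the same exponent, hence the factor 2. Passing to \<open>q^2\<close>
  replaces n(n+1)/2 by n(n+1) and avoids integer division.\<close>

lemma has_sum_psi:
  assumes q: "norm q < 1"
  shows "((\<lambda>n::int. q powi (n * (n + 1))) has_sum 2 * ramanujan_psi (q\<^sup>2)) UNIV"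
proof -
  define S where "S = ramanujan_psi (q\<^sup>2)"
  have ev: "(q\<^sup>2) ^ (n * (n + 1) div 2) = q ^ (n * (n + 1))" for n
  proof -
    have "2 * (n * (n + 1) div 2) = n * (n + 1)" by (intro dvd_mult_div_cancel) simp
    then show ?thesis by (metis power_mult)
  qed
  have q2: "norm (q\<^sup>2) < 1" using norm_power_less_1[OF q, of 2] by simp
  have "((\<lambda>n. (q\<^sup>2) ^ (n * (n + 1) div 2)) has_sum S) UNIV"
    unfolding S_def ramanujan_psi_def
    using summable_psi[OF q2] by (intro norm_summable_imp_has_sum summable_sums) (auto dest: summable_norm_cancel)
  then have S: "((\<lambda>n. q ^ (n * (n + 1))) has_sum S) UNIV" unfolding ev .
  have pw: "q powi (int n * (int n + 1)) = q ^ (n * (n + 1))" for n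
    by (metis of_nat_1 of_nat_add of_nat_mult power_int_of_nat)
  have "((\<lambda>n::int. q powi (n * (n + 1))) has_sum (S + S)) UNIV"
  proof -
    have 1: "((\<lambda>n::int. q powi (n * (n + 1))) has_sum S) (range int)"
      using S by (subst has_sum_reindex) (auto simp: inj_on_def o_def pw)
    have e: "(- 1 - int n) * (- 1 - int n + 1) = int n * (int n + 1)" for n by (simp add: algebra_simps)
    have 2: "((\<lambda>n::int. q powi (n * (n + 1))) has_sum S) (range (\<lambda>n. - 1 - int n))"
      using S by (subst has_sum_reindex) (simp_all only: inj_on_def o_def pw e, auto)
    have U: "range int \<union> range (\<lambda>n. - 1 - int n) = UNIV"
    proof -
      have "n \<in> range int \<union> range (\<lambda>n. - 1 - int n)" for n
      proof (cases "n \<ge> 0")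
        case True then show ?thesis by (metis UnI1 nonneg_int_cases rangeI)
      next
        case False
        then have "n = - 1 - int (nat (- 1 - n))" by simp
        then show ?thesis by blast
      qed
      then show ?thesis by blast
    qed
    have "((\<lambda>n::int. q powi (n * (n + 1))) has_sum (S + S)) (range int \<union> range (\<lambda>n. - 1 - int n))"
      by (intro has_sum_Un_disjoint 1 2) auto
    then show ?thesis unfolding U .
  qed
  then show ?thesis by (simp add: S_def)
qed

lemma power_int_power_nat: "(q ^ k) powi n = q powi (int k * n)" for q :: complex
  by (metis power_int_mult power_int_of_nat)

text \<open>Nonnegative exponents keep the law valid at \<open>q = 0\<close>, where
  \<open>powi\<close> is not additive in general; thus the series identities cover the whole
  disc.\<close>

lemma power_int_mult_nonneg:
  fixes q :: complex
  assumes "a \<ge> 0" "b \<ge> 0"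
  shows "q powi a * q powi b = q powi (a + b)"
  using assms by (cases "q = 0") (auto simp: power_int_add power_int_0_left_if)

lemma square_plus_self_nonneg: "(n::int) * (n + 1) \<ge> 0"
  by (cases "n \<ge> 0") (auto simp: mult_nonneg_nonneg mult_nonpos_nonpos)

text \<open>Split by the parity of n, using \<open>(2n+1)^2 = 1 + 4n(n+1)\<close>.\<close>

lemma theta_phi_dissection:
  assumes q: "norm q < 1"
  shows "theta_phi q = theta_phi (q ^ 4) + 2 * q * ramanujan_psi (q ^ 8)"
proof -
  have q4: "norm (q ^ 4) < 1" using norm_power_less_1[OF q, of 4] by simp
  have "((\<lambda>n::int. q powi n\<^sup>2) has_sum (theta_phi (q ^ 4) + q * (2 * ramanujan_psi ((q ^ 4)\<^sup>2)))) UNIV"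
  proof (rule has_sum_two_images[of _ "\<lambda>n. 2 * n" _ "\<lambda>n. 2 * n + 1"])
    have "q powi (2 * n)\<^sup>2 = (q ^ 4) powi n\<^sup>2" for n :: int
      unfolding power_int_power_nat by (simp add: power2_eq_square)
    then show "((\<lambda>n::int. q powi (2 * n)\<^sup>2) has_sum theta_phi (q ^ 4)) UNIV"
      using has_sum_theta_phi[OF q4] by simp
    have "q powi (2 * n + 1)\<^sup>2 = q * (q ^ 4) powi (n * (n + 1))" for n :: int
    proof -
      have "(2 * n + 1)\<^sup>2 = 1 + 4 * (n * (n + 1))" by (simp add: power2_eq_square algebra_simps)
      then show ?thesis unfolding power_int_power_nat
        using power_int_mult_nonneg[of 1 "4 * (n * (n + 1))" q] square_plus_self_nonneg[of n] by simp
    qed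
    then show "((\<lambda>n::int. q powi (2 * n + 1)\<^sup>2) has_sum q * (2 * ramanujan_psi ((q ^ 4)\<^sup>2))) UNIV"
      using has_sum_cmult_right[OF has_sum_psi[OF q4], of q] by simp
    show "inj (\<lambda>n::int. 2 * n)" "inj (\<lambda>n::int. 2 * n + 1)" by (auto simp: inj_def)
    show "range (\<lambda>n::int. 2 * n) \<inter> range (\<lambda>n. 2 * n + 1) = {}"
    proof (rule equals0I)
      fix p :: int assume "p \<in> range (\<lambda>n. 2 * n) \<inter> range (\<lambda>n. 2 * n + 1)"
      then obtain b d where "p = 2 * b" "p = 2 * d + 1" by blast
      then show False by presburger
    qed
    show "range (\<lambda>n::int. 2 * n) \<union> range (\<lambda>n. 2 * n + 1) = UNIV"
    proof -
      have "n \<in> range (\<lambda>n::int. 2 * n) \<union> range (\<lambda>n. 2 * n + 1)" for n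
        by (cases "even n") (auto elim!: evenE oddE)
      then show ?thesis by blast
    qed
  qed
  then have "theta_phi q = theta_phi (q ^ 4) + q * (2 * ramanujan_psi ((q ^ 4)\<^sup>2))"
    using has_sum_theta_phi[OF q] has_sum_unique by blast
  then show ?thesis by (simp add: power_mult[symmetric])
qed

lemma range_int_pair_even: "range (\<lambda>(a::int, b). (a + b, a - b)) = {(u, v). even (u + v)}" (is "range ?f = _")
proof (rule set_eqI, clarify)
  fix u v :: int
  show "(u, v) \<in> range ?f \<longleftrightarrow> (u, v) \<in> {(u, v). even (u + v)}"
  proof
    assume "(u, v) \<in> range ?f"
    then obtain a b where "u = a + b" "v = a - b" by auto
    then show "(u, v) \<in> {(u, v). even (u + v)}" by simp
  next
    assume "(u, v) \<in> {(u, v). even (u + v)}"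
    then have "even (u + v)" by simp
    then obtain c where "u + v = 2 * c" by (rule evenE)
    then have "(u, v) = ?f (c, c - v)" by simp
    then show "(u, v) \<in> range ?f" by (rule image_eqI) simp
  qed
qed

lemma range_int_pair_odd: "range (\<lambda>(a::int, b). (a + b + 1, a - b)) = {(u, v). odd (u + v)}" (is "range ?g = _")
proof (rule set_eqI, clarify)
  fix u v :: int
  show "(u, v) \<in> range ?g \<longleftrightarrow> (u, v) \<in> {(u, v). odd (u + v)}"
  proof
    assume "(u, v) \<in> range ?g"
    then obtain a b where "u = a + b + 1" "v = a - b" by auto
    then show "(u, v) \<in> {(u, v). odd (u + v)}" by simp
  next
    assume "(u, v) \<in> {(u, v). odd (u + v)}"
    then have "odd (u + v)" by simp
    then obtain c where "u + v = 2 * c + 1" by (rule oddE)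
    then have "(u, v) = ?g (c, c - v)" by simp
    then show "(u, v) \<in> range ?g" by (rule image_eqI) simp
  qed
qed

lemma int_pair_parity_images:
  fixes f g :: "int \<times> int \<Rightarrow> int \<times> int"
  defines "f \<equiv> (\<lambda>(a, b). (a + b, a - b))" and "g \<equiv> (\<lambda>(a, b). (a + b + 1, a - b))"
  shows "inj f" "inj g" "range f \<inter> range g = {}" "range f \<union> range g = UNIV"
proof -
  show "inj f" "inj g" unfolding f_def g_def inj_def by auto
  show "range f \<inter> range g = {}" "range f \<union> range g = UNIV"
    unfolding f_def g_def range_int_pair_even range_int_pair_odd by auto
qed

text \<open>Rotate the lattice by 45 degrees. On pairs (a+b, a-b) the exponent becomes
  \<open>2a(a+1) + 2b^2\<close>, on pairs (a+b+1, a-b) it becomes \<open>2(a+1)^2 + 2b(b+1)\<close>;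
  after a swap or a shift both cosets give the same product.\<close>

lemma psi_square_aux:
  assumes q: "norm q < 1"
  shows "ramanujan_psi (q\<^sup>2) ^ 2 = theta_phi (q\<^sup>2) * ramanujan_psi (q ^ 4)"
proof -
  have q2: "norm (q\<^sup>2) < 1" using norm_power_less_1[OF q, of 2] by simp
  have lhs: "((\<lambda>(a, b). q powi (a * (a + 1)) * q powi (b * (b + 1))) has_sum
      (2 * ramanujan_psi (q\<^sup>2)) * (2 * ramanujan_psi (q\<^sup>2))) (UNIV :: (int \<times> int) set)"
    using has_sum_mult_Times[OF has_sum_psi[OF q] has_sum_psi[OF q]] by simp
  have rhs: "((\<lambda>(m, n). (q\<^sup>2) powi m\<^sup>2 * (q\<^sup>2) powi (n * (n + 1))) has_sum
      theta_phi (q\<^sup>2) * (2 * ramanujan_psi (q ^ 4))) (UNIV :: (int \<times> int) set)"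
    using has_sum_mult_Times[OF has_sum_theta_phi[OF q2] has_sum_psi[OF q2]] by (simp add: power_mult[symmetric])
  define F where "F = (\<lambda>(a, b). q powi (a * (a + 1)) * q powi (b * (b + 1)))"
  have F: "F (a, b) = q powi (a * (a + 1) + b * (b + 1))" for a b
    unfolding F_def by (simp add: power_int_mult_nonneg square_plus_self_nonneg)
  have G: "(q\<^sup>2) powi m\<^sup>2 * (q\<^sup>2) powi (n * (n + 1)) = q powi (2 * m\<^sup>2 + 2 * (n * (n + 1)))" for m n :: int
    unfolding power_int_power_nat using square_plus_self_nonneg[of n] by (subst power_int_mult_nonneg) auto
  have "(F has_sum theta_phi (q\<^sup>2) * (2 * ramanujan_psi (q ^ 4)) + theta_phi (q\<^sup>2) * (2 * ramanujan_psi (q ^ 4))) UNIV"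
  proof (rule has_sum_two_images[OF _ _ int_pair_parity_images])
    have "F (case p of (a, b) \<Rightarrow> (a + b, a - b)) = (case prod.swap p of (m, n) \<Rightarrow> (q\<^sup>2) powi m\<^sup>2 * (q\<^sup>2) powi (n * (n + 1)))" for p
      unfolding G by (cases p) (simp add: F power2_eq_square algebra_simps)
    then show "((\<lambda>x. F (case x of (a, b) \<Rightarrow> (a + b, a - b))) has_sum theta_phi (q\<^sup>2) * (2 * ramanujan_psi (q ^ 4))) UNIV"
      using iffD2[OF has_sum_reindex_bij_betw[of prod.swap UNIV UNIV, OF bij_swap] rhs] by (simp only:)
    have "bij (\<lambda>(a::int, b::int). (a + 1, b))"
      by (rule o_bij[of "\<lambda>(a, b). (a - 1, b)"]) auto
    moreover have "F (case p of (a, b) \<Rightarrow> (a + b + 1, a - b)) =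
        (case (case p of (a, b) \<Rightarrow> (a + 1, b)) of (m, n) \<Rightarrow> (q\<^sup>2) powi m\<^sup>2 * (q\<^sup>2) powi (n * (n + 1)))" for p
      unfolding G by (cases p) (simp add: F power2_eq_square algebra_simps)
    ultimately show "((\<lambda>x. F (case x of (a, b) \<Rightarrow> (a + b + 1, a - b))) has_sum theta_phi (q\<^sup>2) * (2 * ramanujan_psi (q ^ 4))) UNIV"
      using iffD2[OF has_sum_reindex_bij_betw[of "\<lambda>(a::int, b::int). (a + 1, b)" UNIV UNIV] rhs] by (simp only:)
  qed
  from has_sum_unique[OF this lhs[folded F_def]] show ?thesis by (simp add: power2_eq_square)
qed

lemma psi_square:
  assumes q: "norm q < 1"
  shows "ramanujan_psi q ^ 2 = theta_phi q * ramanujan_psi (q\<^sup>2)"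
proof -
  \<comment> \<open>The auxiliary identity lives in \<open>q^2\<close>; any square root of q stays
    inside the unit disc and transfers it.\<close>
  define r where "r = csqrt q"
  have r: "r\<^sup>2 = q" by (simp add: r_def)
  then have "norm r ^ 2 < 1" using q by (metis norm_power)
  then have "norm r < 1" using power_less_one_iff[of "norm r" 2] by simp
  from psi_square_aux[OF this] show ?thesis
    by (simp add: r[symmetric] power_mult[symmetric])
qed

lemma psi_nonzero: "norm q < 1 \<Longrightarrow> ramanujan_psi q \<noteq> 0"
  using psi_product[of q] euler_E_nonzero[of "q\<^sup>2"] norm_power_less_1[of q 2] by force

text \<open>This removes the squares psi(-x) from the second identity in favour of
  \<open>euler_E\<close> and \<open>theta_phi\<close>. It comes from eliminating all odd products
  between the psi products at q, -q, \<open>q^2\<close> and the relation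
  \<open>psi_square\<close>.\<close>

lemma theta_phi_psi_cube:
  assumes q: "norm q < 1"
  shows "theta_phi q * (ramanujan_psi (- q))\<^sup>2 = euler_E (q\<^sup>2) ^ 3"
proof -
  have q2: "norm (q\<^sup>2) < 1" using norm_power_less_1[OF q, of 2] by simp
  have q': "norm (- q) < 1" using q by simp
  define a where "a = ramanujan_psi q" define b where "b = ramanujan_psi (- q)" define c where "c = ramanujan_psi (q\<^sup>2)"
  define o1 where "o1 = odd_prod q" define o2 where "o2 = odd_prod (- q)" define w where "w = odd_prod (q\<^sup>2)"
  define e where "e = euler_E (q\<^sup>2)" define e4 where "e4 = euler_E ((q\<^sup>2)\<^sup>2)"
  have 1: "a * o1 = e" "b * o2 = e" "c * w = e4" "o1 * o2 = w" "e = w * e4"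
    using psi_product[OF q] psi_product[OF q'] psi_product[OF q2] odd_prod_mult_minus[OF q] euler_E_split[OF q2]
    by (simp_all add: a_def b_def c_def o1_def o2_def w_def e_def e4_def)
  have 2: "a\<^sup>2 = theta_phi q * c" using psi_square[OF q] by (simp add: a_def c_def)
  have nz: "c \<noteq> 0" "w \<noteq> 0" using psi_nonzero[OF q2] odd_prod_nonzero[OF q2] by (auto simp: c_def w_def)
  have "(theta_phi q * b\<^sup>2) * c * w\<^sup>2 = (a * o1)\<^sup>2 * (b * o2)\<^sup>2"
    unfolding 1(4)[symmetric] using 2 by (simp add: power_mult_distrib mult_ac)
  also have "\<dots> = e ^ 4" unfolding 1 by (simp add: power2_eq_square eval_nat_numeral)
  also have "\<dots> = e ^ 3 * (w * (c * w))" using 1 by (simp add: eval_nat_numeral)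
  finally have "(theta_phi q * b\<^sup>2) * (c * w\<^sup>2) = e ^ 3 * (c * w\<^sup>2)" by (simp add: power2_eq_square mult_ac)
  then show ?thesis using nz by (simp add: b_def e_def)
qed

lemma theta_triple_product:
  assumes q: "norm q < 1"
  shows "theta_phi q * theta_phi (- q) * ramanujan_psi (q\<^sup>2) = euler_E (q\<^sup>2) ^ 3"
  using theta_phi_psi_cube[OF q] psi_square[of "- q"] q by (simp add: mult.assoc)

lemma theta_phi_nonzero: "norm q < 1 \<Longrightarrow> theta_phi q \<noteq> 0"
  using theta_phi_psi_cube[of q] euler_E_nonzero[of "q\<^sup>2"] norm_power_less_1[of q 2] by force

section \<open>The four forms of discriminant -84 as theta products\<close>

lemma qf_theta_diagonal:
  assumes q: "norm q < 1" and "a > 0" "c > 0"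
  shows "qf_theta (int a) 0 (int c) q = theta_phi (q ^ a) * theta_phi (q ^ c)"
proof -
  have *: "q powi (int a * n\<^sup>2 + 0 * n * m + int c * m\<^sup>2) = (q ^ a) powi n\<^sup>2 * (q ^ c) powi m\<^sup>2" for n m :: int
    unfolding power_int_power_nat by (subst power_int_mult_nonneg) auto
  have "((\<lambda>(n, m). (q ^ a) powi n\<^sup>2 * (q ^ c) powi m\<^sup>2) has_sum theta_phi (q ^ a) * theta_phi (q ^ c)) (UNIV :: (int \<times> int) set)"
    using has_sum_mult_Times[OF has_sum_theta_phi has_sum_theta_phi, of "q ^ a" "q ^ c"]
      norm_power_less_1[OF q] assms by simp
  then show ?thesis unfolding qf_theta_def * by (rule infsumI)
qed

text \<open>A form that becomes diagonal on an index 2 sublattice has, on the other coset, both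
  variables shifted by one half: squares turn into u(u+1), the constants collect in
  \<open>d\<close>, and the two factors 2 of \<open>has_sum_psi\<close> give the 4.\<close>

lemma qf_theta_two_cosets:
  fixes f g :: "int \<times> int \<Rightarrow> int \<times> int"
  assumes q: "norm q < 1" and "k > 0" "l > 0"
    and f: "\<And>u v. (case f (u, v) of (n, m) \<Rightarrow> a * n\<^sup>2 + b * n * m + c * m\<^sup>2) = int k * u\<^sup>2 + int l * v\<^sup>2"
    and g: "\<And>u v. (case g (u, v) of (n, m) \<Rightarrow> a * n\<^sup>2 + b * n * m + c * m\<^sup>2) =
              int d + (int k * (u * (u + 1)) + int l * (v * (v + 1)))"
    and img: "inj f" "inj g" "range f \<inter> range g = {}" "range f \<union> range g = UNIV"
  shows "qf_theta a b c q = theta_phi (q ^ k) * theta_phi (q ^ l) +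
           4 * q ^ d * ramanujan_psi (q ^ (2 * k)) * ramanujan_psi (q ^ (2 * l))"
proof -
  define F where "F = (\<lambda>(n, m). q powi (a * n\<^sup>2 + b * n * m + c * m\<^sup>2))"
  have qk: "norm (q ^ k) < 1" "norm (q ^ l) < 1" using norm_power_less_1[OF q] assms by auto
  have Ff: "F (f p) = (case p of (u, v) \<Rightarrow> (q ^ k) powi u\<^sup>2 * (q ^ l) powi v\<^sup>2)" for p
  proof (cases p)
    case (Pair u v)
    have "F (f p) = q powi (int k * u\<^sup>2 + int l * v\<^sup>2)"
      unfolding Pair f[symmetric] F_def by (simp add: case_prod_beta)
    then show ?thesis unfolding Pair power_int_power_nat by (simp add: power_int_mult_nonneg)
  qed
  have Fg: "F (g p) = q ^ d * (case p of (u, v) \<Rightarrow> (q ^ k) powi (u * (u + 1)) * (q ^ l) powi (v * (v + 1)))" for p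
  proof (cases p)
    case (Pair u v)
    have "F (g p) = q powi (int d + (int k * (u * (u + 1)) + int l * (v * (v + 1))))"
      unfolding Pair g[symmetric] F_def by (simp add: case_prod_beta)
    also have "\<dots> = q powi int d * q powi (int k * (u * (u + 1)) + int l * (v * (v + 1)))"
      using square_plus_self_nonneg by (intro power_int_mult_nonneg[symmetric]) auto
    also have "q powi (int k * (u * (u + 1)) + int l * (v * (v + 1))) = q powi (int k * (u * (u + 1))) * q powi (int l * (v * (v + 1)))"
      using square_plus_self_nonneg by (intro power_int_mult_nonneg[symmetric]) auto
    finally show ?thesis unfolding Pair power_int_power_nat by simp
  qed
  have "(F has_sum theta_phi (q ^ k) * theta_phi (q ^ l) +
      q ^ d * ((2 * ramanujan_psi ((q ^ k)\<^sup>2)) * (2 * ramanujan_psi ((q ^ l)\<^sup>2)))) UNIV"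
  proof (rule has_sum_two_images[OF _ _ img])
    show "((\<lambda>x. F (f x)) has_sum theta_phi (q ^ k) * theta_phi (q ^ l)) UNIV"
      unfolding Ff using has_sum_mult_Times[OF has_sum_theta_phi[OF qk(1)] has_sum_theta_phi[OF qk(2)]] by simp
    show "((\<lambda>x. F (g x)) has_sum q ^ d * ((2 * ramanujan_psi ((q ^ k)\<^sup>2)) * (2 * ramanujan_psi ((q ^ l)\<^sup>2)))) UNIV"
      unfolding Fg using has_sum_cmult_right[OF has_sum_mult_Times[OF has_sum_psi[OF qk(1)] has_sum_psi[OF qk(2)]]] by simp
  qed
  then show ?thesis
    unfolding qf_theta_def F_def by (subst infsumI) (auto simp: power_mult[symmetric] mult_ac)
qed

lemma qf_theta_5_4_5:
  assumes q: "norm q < 1"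
  shows "qf_theta 5 4 5 q = theta_phi (q ^ 14) * theta_phi (q ^ 6) +
           4 * q ^ 5 * ramanujan_psi (q ^ 28) * ramanujan_psi (q ^ 12)"
proof -
  have "qf_theta 5 4 5 q = theta_phi (q ^ 14) * theta_phi (q ^ 6) +
           4 * q ^ 5 * ramanujan_psi (q ^ (2 * 14)) * ramanujan_psi (q ^ (2 * 6))"
    by (rule qf_theta_two_cosets[OF q _ _ _ _ int_pair_parity_images]) (auto simp: power2_eq_square algebra_simps)
  then show ?thesis by simp
qed

lemma qf_theta_2_2_11:
  assumes q: "norm q < 1"
  shows "qf_theta 2 2 11 q = theta_phi (q ^ 2) * theta_phi (q ^ 42) +
           4 * q ^ 11 * ramanujan_psi (q ^ 4) * ramanujan_psi (q ^ 84)"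
proof -
  \<comment> \<open>Completing the square with m = 2b even gives \<open>2(n+b)^2 + 42b^2\<close>, so
    n = a - b; m = 2b+1 is the other coset. For (5,4,5) sum and difference of the variables do the
    same.\<close>
  let ?f = "\<lambda>(a::int, b::int). (a - b, 2 * b)" and ?g = "\<lambda>(a::int, b::int). (a - b, 2 * b + 1)"
  have img: "inj ?f" "inj ?g" "range ?f \<inter> range ?g = {}" "range ?f \<union> range ?g = UNIV"
  proof -
    show "inj ?f" by (rule injI) auto
    show "inj ?g" by (rule injI) auto
    show "range ?f \<inter> range ?g = {}"
    proof (rule equals0I)
      fix p assume "p \<in> range ?f \<inter> range ?g"
      then obtain x y where "p = ?f x" "p = ?g y" by blast
      then have "snd p = 2 * snd x" "snd p = 2 * snd y + 1" by (simp_all add: case_prod_beta)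
      then show False by presburger
    qed
    have "(n, m) \<in> range ?f \<union> range ?g" for n m
    proof (cases "even m")
      case True
      then have "(n, m) = ?f (n + m div 2, m div 2)" by simp
      then show ?thesis by (intro UnI1 image_eqI[of _ _ "(n + m div 2, m div 2)"]) auto
    next
      case False
      then have "(n, m) = ?g (n + (m - 1) div 2, (m - 1) div 2)" by simp
      then show ?thesis by (intro UnI2 image_eqI[of _ _ "(n + (m - 1) div 2, (m - 1) div 2)"]) auto
    qed
    then show "range ?f \<union> range ?g = UNIV" by auto
  qed
  have "qf_theta 2 2 11 q = theta_phi (q ^ 2) * theta_phi (q ^ 42) +
           4 * q ^ 11 * ramanujan_psi (q ^ (2 * 2)) * ramanujan_psi (q ^ (2 * 42))"
    by (rule qf_theta_two_cosets[OF q _ _ _ _ img]) (auto simp: power2_eq_square algebra_simps)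
  then show ?thesis by simp
qed

subsection \<open>Theta functions on the upper half-plane\<close>

lemma holomorphic_power_sum:
  assumes g: "\<And>k. g k \<ge> (k::nat)"
  shows "(\<lambda>z::complex. \<Sum>k. z ^ g k) holomorphic_on ball 0 1"
proof (rule holomorphic_uniform_sequence)
  show "open (ball (0::complex) 1)" by simp
  show "(\<lambda>z. \<Sum>k<n. z ^ g k) holomorphic_on ball 0 1" for n
    by (intro holomorphic_intros)
  fix x :: complex assume x: "x \<in> ball 0 1"
  define d where "d = (1 - norm x) / 2"
  define r where "r = norm x + d"
  have d: "d > 0" and r: "0 \<le> r" "r < 1" using x by (auto simp: d_def r_def field_simps)
  have le: "norm z \<le> r" if "z \<in> cball x d" for z
    using that norm_triangle_sub[of z x] by (auto simp: r_def dist_norm norm_minus_commute)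
  have "uniform_limit (cball x d) (\<lambda>n z. \<Sum>k<n. z ^ g k) (\<lambda>z. \<Sum>k. z ^ g k) sequentially"
  proof (rule Weierstrass_m_test)
    fix k z assume "z \<in> cball x d"
    then have "norm (z ^ g k) \<le> r ^ g k" using le by (simp add: norm_power power_mono)
    also have "\<dots> \<le> r ^ k" using r g by (intro power_decreasing) auto
    finally show "norm (z ^ g k) \<le> r ^ k" .
  next
    show "summable (\<lambda>k. r ^ k)" using r by (intro summable_geometric) simp
  qed
  moreover have "cball x d \<subseteq> ball 0 1" using le r by fastforce
  ultimately show "\<exists>d>0. cball x d \<subseteq> ball 0 1 \<and> uniform_limit (cball x d) (\<lambda>n z. \<Sum>k<n. z ^ g k) (\<lambda>z. \<Sum>k. z ^ g k) sequentially"
    using d by blast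
qed

lemma holomorphic_theta_phi: "theta_phi holomorphic_on ball 0 1"
  unfolding theta_phi_def[abs_def]
  by (intro holomorphic_intros holomorphic_power_sum) (simp add: power2_eq_square)

lemma holomorphic_psi: "ramanujan_psi holomorphic_on ball 0 1"
  unfolding ramanujan_psi_def[abs_def] by (rule holomorphic_power_sum) (rule triangular_ge)

lemma holomorphic_euler_E: "euler_E holomorphic_on ball 0 1"
proof (rule holomorphic_uniform_sequence)
  show "open (ball (0::complex) 1)" by simp
  show "(\<lambda>z. \<Prod>k<n. 1 - z ^ Suc k) holomorphic_on ball 0 1" for n
    by (intro holomorphic_intros)
  fix x :: complex assume x: "x \<in> ball 0 1"
  define d where "d = (1 - norm x) / 2"
  define r where "r = norm x + d"
  have d: "d > 0" and r: "0 \<le> r" "r < 1" using x by (auto simp: d_def r_def field_simps)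
  have le: "norm z \<le> r" if "z \<in> cball x d" for z
    using that norm_triangle_sub[of z x] by (auto simp: r_def dist_norm norm_minus_commute)
  have "uniformly_convergent_on (cball x d) (\<lambda>N z. \<Prod>k<N. 1 + (- (z ^ Suc k)))"
  proof (rule uniformly_convergent_on_prod)
    show "uniformly_convergent_on (cball x d) (\<lambda>N z. \<Sum>k<N. norm (- (z ^ Suc k)))"
    proof (rule Weierstrass_m_test')
      fix k z assume "z \<in> cball x d"
      then have "norm z ^ Suc k \<le> r ^ Suc k" using le by (intro power_mono) auto
      also have "\<dots> \<le> r ^ k" using r by (intro power_decreasing) auto
      finally show "norm (norm (- (z ^ Suc k))) \<le> r ^ k" by (simp add: norm_power norm_mult)
    next
      show "summable (\<lambda>k. r ^ k)" using r by (intro summable_geometric) simp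
    qed
  qed (auto intro!: continuous_intros)
  then obtain l where l: "uniform_limit (cball x d) (\<lambda>N z. \<Prod>k<N. 1 + (- (z ^ Suc k))) l sequentially"
    by (auto simp: uniformly_convergent_on_def)
  have "l z = euler_E z" if "z \<in> cball x d" for z
  proof -
    have "(\<lambda>N. \<Prod>k<N. 1 + (- (z ^ Suc k))) \<longlonglongrightarrow> l z"
      using tendsto_uniform_limitI[OF l that] .
    moreover have "norm z < 1" using le[OF that] r by simp
    ultimately show ?thesis using euler_E_LIMSEQ[of z] LIMSEQ_unique by force
  qed
  then have "uniform_limit (cball x d) (\<lambda>N z. \<Prod>k<N. 1 - z ^ Suc k) euler_E sequentially"
    using uniform_limit_cong'[THEN iffD1, OF _ _ l] by simp
  moreover have "cball x d \<subseteq> ball 0 1" using le r by fastforce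
  ultimately show "\<exists>d>0. cball x d \<subseteq> ball 0 1 \<and> uniform_limit (cball x d) (\<lambda>n z. \<Prod>k<n. 1 - z ^ Suc k) euler_E sequentially"
    using d by blast
qed

section \<open>Jacobi theta functions, Dedekind eta and their inversion\<close>

abbreviation uhp :: "complex set" where "uhp \<equiv> {t. Im t > 0}"

definition theta3 :: "complex \<Rightarrow> complex" where
  "theta3 t = theta_phi (exp (\<i> * pi * t))"

definition theta4 :: "complex \<Rightarrow> complex" where
  "theta4 t = theta_phi (- exp (\<i> * pi * t))"

definition theta2 :: "complex \<Rightarrow> complex" where
  "theta2 t = 2 * exp (\<i> * pi * t / 4) * ramanujan_psi (exp (2 * \<i> * pi * t))"

text \<open>Dedekind's eta in the usual normalisation. With the nome q = exp(pi i t) it equals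
  \<open>q^(1/12) * E(q^2)\<close>, which explains the doubled exponent.\<close>

definition eta :: "complex \<Rightarrow> complex" where
  "eta t = exp (\<i> * pi * t / 12) * euler_E (exp (2 * \<i> * pi * t))"

text \<open>For \<open>Im t > 0\<close> the number \<open>- \<i> * t\<close> lies in the right
  half-plane, so the principal root is holomorphic there, and positive on the imaginary
  axis.\<close>

definition aut_root :: "complex \<Rightarrow> complex" where
  "aut_root t = csqrt (- \<i> * t)"

lemma norm_exp_nome: "Im t > 0 \<Longrightarrow> norm (exp (\<i> * pi * t)) < 1"
  by (simp add: norm_exp_eq_Re)

lemma norm_exp_nome2: "Im t > 0 \<Longrightarrow> norm (exp (2 * \<i> * pi * t)) < 1"
  by (simp add: norm_exp_eq_Re)

lemma holomorphic_compose_exp: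
  assumes "f holomorphic_on ball 0 1" "\<And>t. Im t > 0 \<Longrightarrow> norm (h t) < 1" "h holomorphic_on uhp"
  shows "(\<lambda>t. f (h t)) holomorphic_on uhp"
proof -
  have "(f \<circ> h) holomorphic_on uhp"
    by (rule holomorphic_on_compose_gen[OF assms(3,1)]) (use assms(2) in auto)
  then show ?thesis by (simp add: o_def)
qed

lemma holomorphic_theta:
  "theta3 holomorphic_on uhp" "theta4 holomorphic_on uhp" "theta2 holomorphic_on uhp" "eta holomorphic_on uhp"
proof -
  show "theta3 holomorphic_on uhp" unfolding theta3_def[abs_def]
    by (rule holomorphic_compose_exp[OF holomorphic_theta_phi norm_exp_nome]) (auto intro!: holomorphic_intros)
  show "theta4 holomorphic_on uhp" unfolding theta4_def[abs_def]
    by (rule holomorphic_compose_exp[OF holomorphic_theta_phi])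
       (use norm_exp_nome in \<open>auto intro!: holomorphic_intros\<close>)
  have "(\<lambda>t. ramanujan_psi (exp (2 * \<i> * pi * t))) holomorphic_on uhp"
    by (rule holomorphic_compose_exp[OF holomorphic_psi norm_exp_nome2]) (auto intro!: holomorphic_intros)
  then show "theta2 holomorphic_on uhp" unfolding theta2_def[abs_def]
    by (intro holomorphic_on_mult holomorphic_on_exp holomorphic_intros) auto
  have "(\<lambda>t. euler_E (exp (2 * \<i> * pi * t))) holomorphic_on uhp"
    by (rule holomorphic_compose_exp[OF holomorphic_euler_E norm_exp_nome2]) (auto intro!: holomorphic_intros)
  then show "eta holomorphic_on uhp" unfolding eta_def[abs_def]
    by (intro holomorphic_on_mult holomorphic_on_exp holomorphic_intros) auto
qed

lemma open_uhp: "open uhp" and connected_uhp: "connected uhp"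
  by (simp_all add: open_halfspace_Im_gt convex_connected convex_halfspace_Im_gt)

lemma theta3_imaginary_axis:
  assumes y: "y > 0"
  shows "theta3 (\<i> * of_real y) = of_real (1 + 2 * (\<Sum>n. exp (- pi * y * (real (Suc n))\<^sup>2)))"
proof -
  have e: "exp (\<i> * pi * (\<i> * of_real y)) ^ k = of_real (exp (- pi * y * real k))" for k :: nat
  proof -
    have "\<i> * pi * (\<i> * of_real y) = of_real (- pi * y)" by (simp add: algebra_simps)
    then have "exp (\<i> * pi * (\<i> * of_real y)) ^ k = of_real (exp (- pi * y) ^ k)"
      by (simp only: exp_of_real of_real_power)
    also have "exp (- pi * y) ^ k = exp (- pi * y * real k)" by (simp add: exp_of_nat_mult[symmetric] mult_ac)
    finally show ?thesis .
  qed
  have "(\<Sum>n. exp (\<i> * pi * (\<i> * of_real y)) ^ (Suc n)\<^sup>2) = (\<Sum>n. complex_of_real (exp (- pi * y * (real (Suc n))\<^sup>2)))"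
    unfolding e by simp
  also have "\<dots> = of_real (\<Sum>n. exp (- pi * y * (real (Suc n))\<^sup>2))"
  proof (rule suminf_of_real[symmetric])
    show "summable (\<lambda>n. exp (- pi * y * (real (Suc n))\<^sup>2))"
    proof (rule summable_comparison_test')
      show "summable (\<lambda>n. exp (- (pi * y)) ^ n)" using y by (intro summable_geometric) simp
      show "norm (exp (- pi * y * (real (Suc n))\<^sup>2)) \<le> exp (- (pi * y)) ^ n" for n
        using power_exp_le_exp[of "pi * y" n] y by simp
    qed
  qed
  finally show ?thesis by (simp add: theta3_def theta_phi_def)
qed

lemma Im_minus_inverse_pos: "Im t > 0 \<Longrightarrow> Im (- 1 / t) > 0"
  by (auto simp: Im_divide intro!: divide_pos_pos sum_power2_gt_zero_iff[THEN iffD2])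

lemma aut_root_holomorphic: "aut_root holomorphic_on uhp"
  unfolding aut_root_def[abs_def]
  by (intro holomorphic_intros) (auto simp: complex_nonpos_Reals_iff)

lemma aut_root_nonzero: "Im t > 0 \<Longrightarrow> aut_root t \<noteq> 0"
  by (auto simp: aut_root_def)

lemma aut_root_scale: "r > 0 \<Longrightarrow> aut_root (of_real r * t) = of_real (sqrt r) * aut_root t"
proof -
  assume r: "r > 0"
  have "csqrt (of_real r * (- \<i> * t)) = csqrt (of_real r) * csqrt (- \<i> * t)"
    using r by (intro csqrt_mult) (auto simp: Arg_of_real mpi_less_Arg Arg_le_pi)
  then show ?thesis using r by (simp add: aut_root_def mult_ac csqrt_of_real)
qed

text \<open>Both arguments lie strictly between -pi/2 and pi/2, so no branch is crossed. The lemma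
  merges the factors of two successive inversions into one root.\<close>

lemma aut_root_mult:
  assumes "Im w > 0" "Im r > 0"
  shows "aut_root w * aut_root r = csqrt (- (w * r))"
proof -
  have "\<bar>Arg (- \<i> * w)\<bar> < pi / 2" "\<bar>Arg (- \<i> * r)\<bar> < pi / 2"
    unfolding Arg_Re_pos using assms by simp_all
  then have "csqrt ((- \<i> * w) * (- \<i> * r)) = csqrt (- \<i> * w) * csqrt (- \<i> * r)"
    by (intro csqrt_mult) auto
  then show ?thesis by (simp add: aut_root_def mult_ac)
qed

lemma aut_root_inverse:
  assumes "Im t > 0" shows "aut_root (- 1 / t) * aut_root t = 1"
proof -
  have "t \<noteq> 0" using assms by auto
  then show ?thesis using aut_root_mult[OF Im_minus_inverse_pos[OF assms] assms] by simp
qed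

text \<open>On the imaginary axis this is \<open>theta_inversion_real\<close>; the identity theorem
  extends it to the half-plane.\<close>

lemma theta3_S:
  assumes t: "Im t > 0"
  shows "theta3 (- 1 / t) = aut_root t * theta3 t"
proof -
  define F where "F = (\<lambda>t. theta3 (- 1 / t) - aut_root t * theta3 t)"
  have hol: "F holomorphic_on uhp"
  proof -
    have "(\<lambda>t. theta3 (- 1 / t)) holomorphic_on uhp"
      using holomorphic_on_compose_gen[of "\<lambda>t. - 1 / t" uhp theta3 uhp] holomorphic_theta(1) Im_minus_inverse_pos
      by (force simp: o_def intro!: holomorphic_intros)
    then show ?thesis unfolding F_def by (intro holomorphic_intros aut_root_holomorphic holomorphic_theta)
  qed
  have zero: "F (\<i> * of_real y) = 0" if y: "y > 0" for y
  proof -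
    have inv: "- 1 / (\<i> * complex_of_real y) = \<i> * of_real (1 / y)"
      using y by (simp add: field_simps)
    have "1 + 2 * (\<Sum>l. exp (- pi * (1 / y) * (real (Suc l))\<^sup>2)) = sqrt y * (1 + 2 * (\<Sum>j. exp (- pi * y * (real (Suc j))\<^sup>2)))"
    proof -
      \<comment> \<open>The choice t = 1 / (pi y) turns the two Gaussians into nomes at 1/y and y
        and the prefactor into sqrt y.\<close>
      have "1 + 2 * (\<Sum>l. exp (- pi\<^sup>2 * (real (Suc l))\<^sup>2 * (1 / (pi * y)))) =
         1 / sqrt (pi * (1 / (pi * y))) * (1 + 2 * (\<Sum>j. exp (- (real (Suc j))\<^sup>2 / (1 / (pi * y)))))"
        using y by (intro theta_inversion_real) simp
      moreover have "- pi\<^sup>2 * (real (Suc l))\<^sup>2 * (1 / (pi * y)) = - pi * (1 / y) * (real (Suc l))\<^sup>2" for l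
        using y by (simp add: field_simps power2_eq_square)
      moreover have "- (real (Suc j))\<^sup>2 / (1 / (pi * y)) = - pi * y * (real (Suc j))\<^sup>2" for j
        by simp
      moreover have "1 / sqrt (pi * (1 / (pi * y))) = sqrt y"
        using y by (simp add: real_sqrt_divide)
      ultimately show ?thesis by (simp only:)
    qed
    moreover have "aut_root (\<i> * of_real y) = of_real (sqrt y)"
      using y by (simp add: aut_root_def csqrt_of_real mult.assoc[symmetric])
    ultimately show ?thesis
      unfolding F_def inv using y theta3_imaginary_axis[of y] theta3_imaginary_axis[of "1 / y"] by (simp only: of_real_mult) simp
  qed
  have "F t = 0"
  proof (rule analytic_continuation[OF hol open_uhp connected_uhp])
    show "(\<lambda>y. \<i> * complex_of_real y) ` {0<..} \<subseteq> uhp" by auto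
    show "\<i> \<in> uhp" by simp
    show "F z = 0" if "z \<in> (\<lambda>y. \<i> * complex_of_real y) ` {0<..}" for z
      using that zero by auto
    show "t \<in> uhp" using t by simp
    show "\<i> islimpt (\<lambda>y. \<i> * complex_of_real y) ` {0<..}"
      unfolding islimpt_approachable
    proof (intro allI impI)
      fix e :: real assume "e > 0"
      have "\<i> * complex_of_real (1 + e / 2) - \<i> = \<i> * complex_of_real (e / 2)" by (simp add: algebra_simps)
      then have "dist (\<i> * complex_of_real (1 + e / 2)) \<i> = norm (\<i> * complex_of_real (e / 2))"
        by (simp only: dist_norm)
      also have "\<dots> = e / 2" using \<open>e > 0\<close> by (simp add: norm_mult)
      finally have "dist (\<i> * complex_of_real (1 + e / 2)) \<i> = e / 2" .
      moreover have "\<i> * complex_of_real (1 + e / 2) \<in> (\<lambda>y. \<i> * complex_of_real y) ` {0<..}"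
        using \<open>e > 0\<close> by (intro imageI) simp
      ultimately show "\<exists>x'\<in>(\<lambda>y. \<i> * complex_of_real y) ` {0<..}. x' \<noteq> \<i> \<and> dist x' \<i> < e"
        using \<open>e > 0\<close> by (intro bexI[of _ "\<i> * complex_of_real (1 + e / 2)"]) auto
    qed
  qed
  then show ?thesis by (simp add: F_def)
qed

lemma theta3_quarter: "Im t > 0 \<Longrightarrow> theta3 t = theta3 (4 * t) + theta2 (4 * t)"
  using theta_phi_dissection[OF norm_exp_nome, of t]
  by (simp add: theta3_def theta2_def exp_of_nat_mult[symmetric] mult_ac)

lemma theta4_quarter: "Im t > 0 \<Longrightarrow> theta4 t = theta3 (4 * t) - theta2 (4 * t)"
  using theta_phi_dissection[of "- exp (\<i> * pi * t)"] norm_exp_nome[of t]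
  by (simp add: theta3_def theta4_def theta2_def exp_of_nat_mult[symmetric] mult_ac)

text \<open>By the dissection, \<open>theta4\<close> at t is twice \<open>theta3\<close> at 4t minus
  \<open>theta3\<close> at t, and 4(-1/t) = -1/(t/4), so \<open>theta3_S\<close> applies
  twice.\<close>

lemma theta4_S:
  assumes t: "Im t > 0"
  shows "theta4 (- 1 / t) = aut_root t * theta2 t"
proof -
  have t4: "Im (t / 4) > 0" using t by simp
  have "theta4 (- 1 / t) = 2 * theta3 (4 * (- 1 / t)) - theta3 (- 1 / t)"
    using theta3_quarter[OF Im_minus_inverse_pos[OF t]] theta4_quarter[OF Im_minus_inverse_pos[OF t]] by simp
  also have "4 * (- 1 / t) = - 1 / (t / 4)" by simp
  also have "theta3 (- 1 / (t / 4)) = aut_root (t / 4) * theta3 (t / 4)" by (rule theta3_S[OF t4])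
  also have "aut_root (t / 4) = aut_root t / 2"
    using aut_root_scale[of "1/4" t] by (simp add: real_sqrt_divide)
  also have "theta3 (t / 4) = theta3 t + theta2 t" using theta3_quarter[OF t4] by simp
  finally show ?thesis unfolding theta3_S[OF t] by (simp add: algebra_simps)
qed

lemma theta2_S:
  assumes t: "Im t > 0"
  shows "theta2 (- 1 / t) = aut_root t * theta4 t"
proof -
  have "theta4 t = aut_root (- 1 / t) * theta2 (- 1 / t)"
    using theta4_S[OF Im_minus_inverse_pos[OF t]] by simp
  then have "aut_root t * theta4 t = (aut_root (- 1 / t) * aut_root t) * theta2 (- 1 / t)" by (simp only: mult_ac)
  then show ?thesis unfolding aut_root_inverse[OF t] by simp
qed

lemma eta_nonzero: "Im t > 0 \<Longrightarrow> eta t \<noteq> 0"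
  using euler_E_nonzero[OF norm_exp_nome2] by (simp add: eta_def)

lemma eta_cube:
  assumes "Im t > 0"
  shows "2 * eta t ^ 3 = theta2 t * theta3 t * theta4 t"
proof -
  have e: "exp (\<i> * pi * t / 12) ^ 3 = exp (\<i> * pi * t / 4)" "(exp (\<i> * pi * t))\<^sup>2 = exp (2 * \<i> * pi * t)"
    by (simp_all add: exp_of_nat_mult[symmetric] mult_ac)
  show ?thesis
    using theta_triple_product[OF norm_exp_nome[OF assms]]
    unfolding eta_def theta2_def theta3_def theta4_def power_mult_distrib e by (simp add: mult_ac)
qed

text \<open>By \<open>eta_cube\<close> the quotient of the two sides has cube 1. Being continuous on
  a connected set with finite range, it is constant, and it equals 1 at the fixed point i.\<close>

lemma eta_S:
  assumes t: "Im t > 0"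
  shows "eta (- 1 / t) = aut_root t * eta t"
proof -
  define r where "r = (\<lambda>t. eta (- 1 / t) / (aut_root t * eta t))"
  have cube: "r t ^ 3 = 1" if "Im t > 0" for t
  proof -
    have "2 * eta (- 1 / t) ^ 3 = 2 * (aut_root t * eta t) ^ 3"
      using eta_cube[OF Im_minus_inverse_pos[OF that]] eta_cube[OF that] theta2_S[OF that] theta3_S[OF that] theta4_S[OF that]
      by (simp add: power_mult_distrib eval_nat_numeral mult_ac)
    then show ?thesis using eta_nonzero[OF that] aut_root_nonzero[OF that] by (simp add: r_def power_divide)
  qed
  have "continuous_on uhp r"
  proof -
    have "(\<lambda>t. eta (- 1 / t)) holomorphic_on uhp"
      using holomorphic_on_compose_gen[of "\<lambda>t. - 1 / t" uhp eta uhp] holomorphic_theta(4) Im_minus_inverse_pos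
      by (force simp: o_def intro!: holomorphic_intros)
    then have "r holomorphic_on uhp"
      unfolding r_def using eta_nonzero aut_root_nonzero
      by (intro holomorphic_intros aut_root_holomorphic holomorphic_theta) auto
    then show ?thesis by (rule holomorphic_on_imp_continuous_on)
  qed
  moreover have "finite (r ` uhp)"
  proof (rule finite_subset)
    show "r ` uhp \<subseteq> {z. z ^ 3 = 1}" using cube by auto
    show "finite {z::complex. z ^ 3 = 1}" using finite_roots_unity[of 3] by simp
  qed
  ultimately have "r constant_on uhp"
    using continuous_finite_range_constant[OF connected_uhp] by blast
  then have "r t = r \<i>" using t unfolding constant_on_def by force
  also have "r \<i> = 1"
  proof -
    have "aut_root \<i> = 1" by (simp add: aut_root_def)
    moreover have "- 1 / \<i> = \<i>" by (simp add: field_simps)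
    ultimately show ?thesis using eta_nonzero[of \<i>] by (simp add: r_def)
  qed
  finally show ?thesis using eta_nonzero[OF t] aut_root_nonzero[OF t] by (simp add: r_def)
qed

section \<open>Multipliers in powers of a 24th root of unity; translations and words in S and
  T\<close>

definition omega :: complex where "omega = cis (pi / 12)"

lemma omega_power: "omega ^ n = cis (real n * (pi / 12))"
  by (simp add: omega_def Complex.DeMoivre)

lemma omega_6: "omega ^ 6 = \<i>"
proof -
  have "real 6 * (pi / 12) = pi / 2" by simp
  then show ?thesis unfolding omega_power by (simp add: cis_pi_half)
qed

lemma omega_12: "omega ^ 12 = - 1"
proof -
  have "omega ^ 12 = (omega ^ 6)\<^sup>2" by (simp flip: power_mult)
  then show ?thesis by (simp add: omega_6)
qed

lemma omega_3: "omega ^ 3 = (1 + \<i>) / sqrt 2"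
proof -
  have "real 3 * (pi / 12) = pi / 4" by simp
  then show ?thesis unfolding omega_power
    by (simp add: complex_eq_iff cos_45 sin_45 real_div_sqrt field_simps)
qed

lemma norm_omega [simp]: "norm omega = 1" and omega_nonzero [simp]: "omega \<noteq> 0"
  by (auto simp: omega_def)

text \<open>In terms of \<open>X = \<theta>\<^sub>3(2\<tau>)\<close> and \<open>Y = \<theta>\<^sub>2(2\<tau>)\<close> the inversion is linear, because \<open>\<theta>\<^sub>3(\<tau>/2)\<close> and \<open>\<theta>\<^sub>4(\<tau>/2)\<close> are \<open>X + Y\<close> and \<open>X - Y\<close>.\<close>

definition thetaX :: "complex \<Rightarrow> complex" where "thetaX t = theta3 (2 * t)"
definition thetaY :: "complex \<Rightarrow> complex" where "thetaY t = theta2 (2 * t)"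

lemma theta3_T: "theta3 (t + 1) = theta4 t" and theta4_T: "theta4 (t + 1) = theta3 t"
  by (simp_all add: theta3_def theta4_def exp_add distrib_left)

lemma theta2_T: "theta2 (t + 1) = omega ^ 3 * theta2 t"
proof -
  have "exp (\<i> * pi * (t + 1) / 4) = omega ^ 3 * exp (\<i> * pi * t / 4)"
    unfolding omega_power cis_conv_exp exp_add[symmetric] by (rule arg_cong[of _ _ exp]) (simp add: field_simps)
  moreover have "exp (2 * \<i> * pi * (t + 1)) = exp (2 * \<i> * pi * t)"
    by (simp add: exp_add distrib_left exp_two_pi_i mult_ac)
  ultimately show ?thesis by (simp add: theta2_def)
qed

lemma eta_T: "eta (t + 1) = omega * eta t"
proof -
  have "exp (\<i> * pi * (t + 1) / 12) = omega * exp (\<i> * pi * t / 12)"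
    unfolding omega_def cis_conv_exp exp_add[symmetric] by (rule arg_cong[of _ _ exp]) (simp add: field_simps)
  moreover have "exp (2 * \<i> * pi * (t + 1)) = exp (2 * \<i> * pi * t)"
    by (simp add: exp_add distrib_left exp_two_pi_i mult_ac)
  ultimately show ?thesis by (simp add: eta_def)
qed

lemma theta_shift:
  fixes n :: nat
  shows "theta3 (t + of_nat n) = (if even n then theta3 t else theta4 t)"
    and "theta4 (t + of_nat n) = (if even n then theta4 t else theta3 t)"
    and "theta2 (t + of_nat n) = omega ^ (3 * n) * theta2 t"
    and "eta (t + of_nat n) = omega ^ n * eta t"
    and "thetaX (t + of_nat n) = thetaX t"
    and "thetaY (t + of_nat n) = \<i> ^ n * thetaY t"
proof -
  show 1: "theta3 (t + of_nat n) = (if even n then theta3 t else theta4 t)"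
   and 2: "theta4 (t + of_nat n) = (if even n then theta4 t else theta3 t)" for n t
  proof (induction n)
    case (Suc n)
    have e: "t + of_nat (Suc n) = (t + of_nat n) + 1" by simp
    { case 1 show ?case unfolding e theta3_T using Suc by simp }
    { case 2 show ?case unfolding e theta4_T using Suc by simp }
  qed simp_all
  show 3: "theta2 (t + of_nat n) = omega ^ (3 * n) * theta2 t" for n t
  proof (induction n)
    case (Suc n)
    have e: "t + of_nat (Suc n) = (t + of_nat n) + 1" by simp
    show ?case unfolding e theta2_T Suc by (simp add: power_add)
  qed simp
  show "eta (t + of_nat n) = omega ^ n * eta t"
  proof (induction n)
    case (Suc n)
    have e: "t + of_nat (Suc n) = (t + of_nat n) + 1" by simp
    show ?case unfolding e eta_T Suc by simp
  qed simp
  show "thetaX (t + of_nat n) = thetaX t"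
    using 1[of "2 * t" "2 * n"] by (simp add: thetaX_def distrib_left)
  show "thetaY (t + of_nat n) = \<i> ^ n * thetaY t"
    using 3[of "2 * t" "2 * n"] by (simp add: thetaY_def distrib_left power_mult omega_6)
qed

lemma thetaXY_S:
  assumes t: "Im t > 0"
  shows "thetaX (- 1 / t) = aut_root t * ((thetaX t + thetaY t) / sqrt 2)"
    and "thetaY (- 1 / t) = aut_root t * ((thetaX t - thetaY t) / sqrt 2)"
proof -
  have t2: "Im (t / 2) > 0" using t by simp
  have e: "2 * (- 1 / t) = - 1 / (t / 2)" "4 * (t / 2) = 2 * t" by simp_all
  have r: "aut_root (t / 2) = aut_root t / sqrt 2"
    using aut_root_scale[of "1/2" t] by (simp add: real_sqrt_divide)
  show "thetaX (- 1 / t) = aut_root t * ((thetaX t + thetaY t) / sqrt 2)"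
    unfolding thetaX_def thetaY_def e theta3_S[OF t2] theta3_quarter[OF t2] r by simp
  show "thetaY (- 1 / t) = aut_root t * ((thetaX t - thetaY t) / sqrt 2)"
    unfolding thetaX_def thetaY_def e theta2_S[OF t2] theta4_quarter[OF t2] r by simp
qed

lemmas theta_S = theta3_S theta4_S theta2_S eta_S thetaXY_S

lemma sqrt2_mult: "complex_of_real (sqrt 2) * complex_of_real (sqrt 2) = 2"
  by (simp flip: of_real_mult)

text \<open>The word S \<open>T^3\<close> S, with S the inversion and T the unit translation. With w
  = 3 - 1/r the factors of the two inversions combine to csqrt(-(w r)) = csqrt(1 - 3r). Fixing the
  word once spares tracking the multiplier of a general matrix.\<close>

lemma theta_word3:
  assumes r: "Im r > 0"
  defines "J \<equiv> csqrt (1 - 3 * r)" and "g \<equiv> - 1 / (3 - 1 / r)"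
  shows "theta3 g = J * theta2 r" "theta4 g = J * (omega ^ 9 * theta4 r)" "theta2 g = J * theta3 r"
    "eta g = J * (omega ^ 3 * eta r)"
    "thetaX g = J * (((1 - \<i>) * thetaX r + (1 + \<i>) * thetaY r) / 2)"
    "thetaY g = J * (((1 + \<i>) * thetaX r + (1 - \<i>) * thetaY r) / 2)"
proof -
  define w where "w = - 1 / r + of_nat 3"
  have w: "Im w > 0" using Im_minus_inverse_pos[OF r] by (simp add: w_def)
  have g: "g = - 1 / w" by (simp add: g_def w_def)
  have "r \<noteq> 0" using r by auto
  then have "- (w * r) = 1 - 3 * r" by (simp add: w_def field_simps)
  then have J: "aut_root w * aut_root r = J"
    using aut_root_mult[OF w r] by (simp add: J_def)
  note sh = theta_shift[of "- 1 / r" 3, folded w_def]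
  show "theta3 g = J * theta2 r" "theta4 g = J * (omega ^ 9 * theta4 r)" "theta2 g = J * theta3 r"
    "eta g = J * (omega ^ 3 * eta r)"
    unfolding g J[symmetric] theta_S[OF w] sh theta_S[OF r] by simp_all
  have "thetaX g = J * ((thetaX r + thetaY r + \<i> ^ 3 * (thetaX r - thetaY r)) / (complex_of_real (sqrt 2) * complex_of_real (sqrt 2)))"
    unfolding g J[symmetric] theta_S[OF w] sh theta_S[OF r] by (simp add: field_simps)
  then show "thetaX g = J * (((1 - \<i>) * thetaX r + (1 + \<i>) * thetaY r) / 2)"
    unfolding sqrt2_mult by (simp add: field_simps eval_nat_numeral)
  have "thetaY g = J * ((thetaX r + thetaY r - \<i> ^ 3 * (thetaX r - thetaY r)) / (complex_of_real (sqrt 2) * complex_of_real (sqrt 2)))"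
    unfolding g J[symmetric] theta_S[OF w] sh theta_S[OF r] by (simp add: field_simps)
  then show "thetaY g = J * (((1 + \<i>) * thetaX r + (1 - \<i>) * thetaY r) / 2)"
    unfolding sqrt2_mult by (simp add: field_simps eval_nat_numeral)
qed

text \<open>The word S \<open>T^(-2)\<close> S. The negative translation is handled by reading
  \<open>theta_shift\<close> backwards from w + 2 = -1/r.\<close>

lemma theta_word2:
  assumes r: "Im r > 0"
  defines "J \<equiv> csqrt (2 * r + 1)" and "g \<equiv> - 1 / (- 2 - 1 / r)"
  shows "theta3 g = J * theta3 r" "theta4 g = J * (- \<i> * theta4 r)" "theta2 g = J * theta2 r"
    "eta g = J * (omega ^ 22 * eta r)" "thetaX g = J * thetaY r" "thetaY g = J * thetaX r"
proof -
  define w where "w = - 2 - 1 / r"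
  have w2: "w + of_nat 2 = - 1 / r" by (simp add: w_def)
  have w: "Im w > 0" using Im_minus_inverse_pos[OF r] by (simp add: w_def)
  have g: "g = - 1 / w" by (simp add: g_def w_def)
  have "r \<noteq> 0" using r by auto
  then have "- (w * r) = 2 * r + 1" by (simp add: w_def field_simps)
  then have J: "aut_root w * aut_root r = J"
    using aut_root_mult[OF w r] by (simp add: J_def)
  note sh = theta_shift[of w 2, unfolded w2]
  have t2w: "theta2 w = - \<i> * theta2 (- 1 / r)"
    unfolding sh by (simp add: omega_6)
  have Yw: "thetaY w = - thetaY (- 1 / r)" and Xw: "thetaX w = thetaX (- 1 / r)"
    and t3w: "theta3 w = theta3 (- 1 / r)" and t4w: "theta4 w = theta4 (- 1 / r)"
    and ew: "omega ^ 2 * eta w = eta (- 1 / r)"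
    unfolding sh by simp_all
  show "theta3 g = J * theta3 r" "theta4 g = J * (- \<i> * theta4 r)" "theta2 g = J * theta2 r"
    unfolding g J[symmetric] theta_S[OF w] t2w t3w t4w theta_S[OF r] by simp_all
  have "omega ^ 22 * omega ^ 2 = (omega ^ 12)\<^sup>2" by (simp flip: power_add power_mult)
  then have "omega ^ 22 * (omega ^ 2 * eta w) = eta w" by (simp add: omega_12 mult.assoc[symmetric])
  then have "eta w = omega ^ 22 * (aut_root r * eta r)" unfolding ew theta_S[OF r] ..
  then show "eta g = J * (omega ^ 22 * eta r)"
    unfolding g J[symmetric] theta_S[OF w] by simp
  have "thetaX g = J * (((thetaX r + thetaY r) - (thetaX r - thetaY r)) / (complex_of_real (sqrt 2) * complex_of_real (sqrt 2)))"
    unfolding g J[symmetric] theta_S[OF w] Xw Yw theta_S[OF r] by (simp add: field_simps)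
  then show "thetaX g = J * thetaY r" unfolding sqrt2_mult by simp
  have "thetaY g = J * (((thetaX r + thetaY r) + (thetaX r - thetaY r)) / (complex_of_real (sqrt 2) * complex_of_real (sqrt 2)))"
    unfolding g J[symmetric] theta_S[OF w] Xw Yw theta_S[OF r] by (simp add: field_simps)
  then show "thetaY g = J * thetaX r" unfolding sqrt2_mult by simp
qed

subsection \<open>Atkin-Lehner elements of level 21\<close>

lemma csqrt_scale: "r > 0 \<Longrightarrow> csqrt (of_real r * z) = of_real (sqrt r) * csqrt z"
  using aut_root_scale[of r "\<i> * z"] by (simp add: aut_root_def mult_ac)

lemma omega_high:
  "omega ^ (12 + n) = - (omega ^ n)" "omega ^ (24 + n) = omega ^ n"
proof -
  show 1: "omega ^ (12 + n) = - (omega ^ n)" for n by (simp add: power_add omega_12)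
  show "omega ^ (24 + n) = omega ^ n" using 1[of "12 + n"] 1[of n] by (simp flip: add.assoc)
qed

text \<open>With \<open>j\<close> = 3, the products \<open>pair1 theta\<^sub>j\<close>, \<open>pair3 theta\<^sub>j\<close> and the sums \<open>A\<^sub>j\<close>, \<open>B\<^sub>j\<close> below are the
  series of the forms (1,0,21), (3,0,7), (2,2,11) and (5,4,5); for \<open>j\<close> = 4 and \<open>j\<close> = 2 they are the
  conjugates, \<open>mixed1\<close> and \<open>mixed3\<close> playing the roles of \<open>A\<^sub>2\<close> and \<open>B\<^sub>2\<close>.\<close>

definition pair1 :: "(complex \<Rightarrow> complex) \<Rightarrow> complex \<Rightarrow> complex" where
  "pair1 f t = f t * f (21 * t)"
definition pair3 :: "(complex \<Rightarrow> complex) \<Rightarrow> complex \<Rightarrow> complex" where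
  "pair3 f t = f (3 * t) * f (7 * t)"
definition mixed1 :: "complex \<Rightarrow> complex" where
  "mixed1 t = thetaX t * thetaY (21 * t) + thetaY t * thetaX (21 * t)"
definition mixed3 :: "complex \<Rightarrow> complex" where
  "mixed3 t = thetaX (3 * t) * thetaY (7 * t) + thetaY (3 * t) * thetaX (7 * t)"

definition A3 where "A3 t = pair1 thetaX t + pair1 thetaY t"
definition A4 where "A4 t = pair1 thetaX t - pair1 thetaY t"
definition B3 where "B3 t = pair3 thetaX t + pair3 thetaY t"
definition B4 where "B4 t = pair3 thetaX t - pair3 thetaY t"

lemmas pair_defs = pair1_def pair3_def mixed1_def mixed3_def A3_def A4_def B3_def B4_def

lemma pairs_T:
  shows "pair1 theta3 (t + 1) = pair1 theta4 t" "pair1 theta4 (t + 1) = pair1 theta3 t"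
    "pair3 theta3 (t + 1) = pair3 theta4 t" "pair3 theta4 (t + 1) = pair3 theta3 t"
    "pair1 theta2 (t + 1) = - \<i> * pair1 theta2 t" "pair3 theta2 (t + 1) = \<i> * pair3 theta2 t"
    "pair1 eta (t + 1) = - (omega ^ 10) * pair1 eta t" "pair3 eta (t + 1) = omega ^ 10 * pair3 eta t"
    "A3 (t + 1) = A4 t" "A4 (t + 1) = A3 t" "B3 (t + 1) = B4 t" "B4 (t + 1) = B3 t"
    "mixed1 (t + 1) = \<i> * mixed1 t" "mixed3 (t + 1) = - \<i> * mixed3 t"
proof -
  have e: "t + 1 = t + of_nat 1" "21 * (t + of_nat 1) = 21 * t + of_nat 21"
     "3 * (t + of_nat 1) = 3 * t + of_nat 3" "7 * (t + of_nat 1) = 7 * t + of_nat 7"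
    by (simp_all add: algebra_simps)
  have p: "omega ^ 3 * omega ^ 63 = - \<i>" "omega ^ 9 * omega ^ 21 = \<i>" "omega * omega ^ 21 = - (omega ^ 10)"
      "omega ^ 3 * omega ^ 7 = omega ^ 10"
    using omega_high(2)[of 42] omega_high(2)[of 18] omega_high(1)[of 6] omega_high(2)[of 6] omega_high(1)[of 10]
    by (simp_all add: omega_6 flip: power_add power_Suc)
  have i: "\<i> ^ 3 = - \<i>" "\<i> ^ 7 = - \<i>" "\<i> ^ 21 = \<i>" by (simp_all add: eval_nat_numeral)
  show "pair1 theta3 (t + 1) = pair1 theta4 t" "pair1 theta4 (t + 1) = pair1 theta3 t"
    "pair3 theta3 (t + 1) = pair3 theta4 t" "pair3 theta4 (t + 1) = pair3 theta3 t"
    "A3 (t + 1) = A4 t" "A4 (t + 1) = A3 t" "B3 (t + 1) = B4 t" "B4 (t + 1) = B3 t"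
    "mixed1 (t + 1) = \<i> * mixed1 t" "mixed3 (t + 1) = - \<i> * mixed3 t"
    unfolding pair_defs e theta_shift i by (simp_all add: algebra_simps)
  have "pair1 theta2 (t + 1) = (omega ^ 3 * omega ^ 63) * pair1 theta2 t"
    "pair3 theta2 (t + 1) = (omega ^ 9 * omega ^ 21) * pair3 theta2 t"
    "pair1 eta (t + 1) = (omega * omega ^ 21) * pair1 eta t"
    "pair3 eta (t + 1) = (omega ^ 3 * omega ^ 7) * pair3 eta t"
    unfolding pair_defs e theta_shift by simp_all
  then show "pair1 theta2 (t + 1) = - \<i> * pair1 theta2 t" "pair3 theta2 (t + 1) = \<i> * pair3 theta2 t"
    "pair1 eta (t + 1) = - (omega ^ 10) * pair1 eta t" "pair3 eta (t + 1) = omega ^ 10 * pair3 eta t"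
    unfolding p by simp_all
qed

text \<open>The Fricke involution sends kt to the inversion of (21/k)t. As k and 21/k belong to the
  same pair, each pair is preserved, up to exchanging the indices 4 and 2.\<close>

lemma pairs_S:
  assumes t: "Im t > 0"
  defines "u \<equiv> - 1 / (21 * t)" and "J \<equiv> of_real (sqrt 21) * (aut_root t)\<^sup>2"
  shows "J \<noteq> 0"
    "pair1 theta3 u = J * pair1 theta3 t" "pair1 theta4 u = J * pair1 theta2 t" "pair1 theta2 u = J * pair1 theta4 t"
    "pair3 theta3 u = J * pair3 theta3 t" "pair3 theta4 u = J * pair3 theta2 t" "pair3 theta2 u = J * pair3 theta4 t"
    "pair1 eta u = J * pair1 eta t" "pair3 eta u = J * pair3 eta t"
    "A3 u = J * A3 t" "A4 u = J * mixed1 t" "mixed1 u = J * A4 t"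
    "B3 u = J * B3 t" "B4 u = J * mixed3 t" "mixed3 u = J * B4 t"
proof -
  have t0: "t \<noteq> 0" using t by auto
  have im: "Im (3 * t) > 0" "Im (7 * t) > 0" "Im (21 * t) > 0" using t by simp_all
  have e: "21 * (- 1 / (21 * t)) = - 1 / t" "3 * (- 1 / (21 * t)) = - 1 / (7 * t)" "7 * (- 1 / (21 * t)) = - 1 / (3 * t)"
    by simp_all
  have r: "aut_root (3 * t) = of_real (sqrt 3) * aut_root t" "aut_root (7 * t) = of_real (sqrt 7) * aut_root t"
     "aut_root (21 * t) = of_real (sqrt 21) * aut_root t"
    using aut_root_scale[of 3 t] aut_root_scale[of 7 t] aut_root_scale[of 21 t] by simp_all
  have s: "complex_of_real (sqrt 7) * complex_of_real (sqrt 3) = complex_of_real (sqrt 21)"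
    by (simp flip: of_real_mult real_sqrt_mult)
  have J1: "aut_root (21 * t) * aut_root t = J" and J3: "aut_root (7 * t) * aut_root (3 * t) = J"
    unfolding J_def r power2_eq_square s[symmetric] by (simp_all add: mult_ac)
  show "J \<noteq> 0" using aut_root_nonzero[OF t] by (simp add: J_def)
  have alg1: "p * x * (q * y) = (p * q) * (y * x)" for p q x y :: complex by simp
  show "pair1 theta3 u = J * pair1 theta3 t" "pair1 theta4 u = J * pair1 theta2 t" "pair1 theta2 u = J * pair1 theta4 t"
    "pair1 eta u = J * pair1 eta t"
    unfolding u_def pair_defs e theta_S[OF t] theta_S[OF im(3)] alg1 J1 by (rule refl)+
  show "pair3 theta3 u = J * pair3 theta3 t" "pair3 theta4 u = J * pair3 theta2 t" "pair3 theta2 u = J * pair3 theta4 t"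
    "pair3 eta u = J * pair3 eta t"
    unfolding u_def pair_defs e theta_S[OF im(1)] theta_S[OF im(2)] alg1 J3 by (rule refl)+
  have alg2: "p * (x / complex_of_real (sqrt 2)) * (q * (y / complex_of_real (sqrt 2))) = (p * q) * ((y * x) / 2)" for p q x y :: complex
    by (simp add: sqrt2_mult)
  show "A3 u = J * A3 t" "A4 u = J * mixed1 t" "mixed1 u = J * A4 t"
    unfolding u_def pair_defs e theta_S[OF t] theta_S[OF im(3)] alg2 J1 by (simp_all add: field_simps)
  show "B3 u = J * B3 t" "B4 u = J * mixed3 t" "mixed3 u = J * B4 t"
    unfolding u_def pair_defs e theta_S[OF im(1)] theta_S[OF im(2)] alg2 J3 by (simp_all add: field_simps)
qed

text \<open>The matrix has determinant 7. For k = 1, 3, 7, 21 the point ku is a determinant 1 image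
  of 7t, 21t, t, 3t respectively; hence the two pairs are exchanged.\<close>

lemma pairs_W7:
  assumes t: "Im t > 0"
  defines "u \<equiv> (14 * t + 9) / (21 * t + 14)"
    and "J \<equiv> of_real (sqrt 7) * csqrt (- (3 * t + 2)) * aut_root (3 * t + 2)"
  shows "J \<noteq> 0"
    "pair1 theta3 u = J * (omega ^ 9 * pair3 theta3 t)" "pair1 theta4 u = J * (- (omega ^ 9) * pair3 theta2 t)"
    "pair1 theta2 u = J * (- (omega ^ 9) * pair3 theta4 t)"
    "pair3 theta3 u = J * (omega ^ 9 * pair1 theta3 t)" "pair3 theta4 u = J * (- (omega ^ 9) * pair1 theta2 t)"
    "pair3 theta2 u = J * (- (omega ^ 9) * pair1 theta4 t)"
    "pair1 eta u = J * (omega * pair3 eta t)" "pair3 eta u = J * (omega * pair1 eta t)"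
    "A3 u = J * (- (omega ^ 9) * B3 t)" "A4 u = J * (omega ^ 9 * mixed3 t)" "mixed1 u = J * (omega ^ 9 * B4 t)"
    "B3 u = J * (- (omega ^ 9) * A3 t)" "B4 u = J * (omega ^ 9 * mixed1 t)" "mixed3 u = J * (omega ^ 9 * A4 t)"
proof -
  define c where "c = 3 * t + 2"
  have c0: "c \<noteq> 0" using t by (auto simp: c_def complex_eq_iff)
  have u: "u = (14 * t + 9) / (7 * c)" by (simp add: u_def c_def)
  have g3: "- 1 / (3 - 1 / r) = - r / (3 * r - 1)" if "r \<noteq> 0" for r :: complex
    using that by (simp add: divide_simps)
  \<comment> \<open>The shifts come from factoring these unimodular matrices: u = T S
    \<open>T^3\<close> S \<open>T^5\<close> (7t), 7u = \<open>T^5\<close> S \<open>T^3\<close> S T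
    (t), 3u = \<open>T^2\<close> S \<open>T^14\<close> (21t), 21u = \<open>T^14\<close> S
    \<open>T^2\<close> (3t).\<close>
  define r1 where "r1 = 7 * t + of_nat 5"
  define r7 where "r7 = t + of_nat 1"
  define r3 where "r3 = 21 * t + of_nat 14"
  define r21 where "r21 = 3 * t + of_nat 2"
  have im: "Im r1 > 0" "Im r7 > 0" "Im r3 > 0" "Im r21 > 0" using t by (simp_all add: r1_def r7_def r3_def r21_def)
  have nz: "r1 \<noteq> 0" "r7 \<noteq> 0" "r3 \<noteq> 0" "r21 \<noteq> 0" using im by auto
  have d: "3 * r1 - 1 = 7 * c" "3 * r7 - 1 = c" "r3 = 7 * c" "r21 = c"
    by (simp_all add: r1_def r7_def r3_def r21_def c_def)
  have a1: "u = - 1 / (3 - 1 / r1) + of_nat 1"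
    unfolding g3[OF nz(1)] d u using c0 by (simp add: divide_simps) (simp add: r1_def c_def algebra_simps)
  have a7: "7 * u = - 1 / (3 - 1 / r7) + of_nat 5"
    unfolding g3[OF nz(2)] d u using c0 by (simp add: divide_simps) (simp add: r7_def c_def algebra_simps)
  have a3: "3 * u = - 1 / r3 + of_nat 2"
    unfolding d u using c0 by (simp add: divide_simps) (simp add: c_def algebra_simps)
  have a21: "21 * u = - 1 / r21 + of_nat 14"
    unfolding d u using c0 by (simp add: divide_simps) (simp add: c_def algebra_simps)
  have i: "\<i> ^ 5 = \<i>" "\<i> ^ 14 = -1" "\<i> ^ 2 = -1" by (simp_all add: eval_nat_numeral)
  define F1 where "F1 = csqrt (1 - 3 * r1)"
  define F7 where "F7 = csqrt (1 - 3 * r7)"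
  define F3 where "F3 = aut_root r3"
  define F21 where "F21 = aut_root r21"
  note w1 = theta_word3[OF im(1), folded F1_def]
  note w7 = theta_word3[OF im(2), folded F7_def]
  have k1: "theta3 u = F1 * (omega ^ 9 * theta3 (7 * t))" "theta4 u = F1 * (omega ^ 15 * theta2 (7 * t))"
     "theta2 u = F1 * (omega ^ 3 * theta4 (7 * t))" "eta u = F1 * (omega ^ 9 * eta (7 * t))"
     "thetaX u = F1 * ((1 - \<i>) / 2 * (thetaX (7 * t) - thetaY (7 * t)))"
     "thetaY u = F1 * (- ((1 - \<i>) / 2) * (thetaX (7 * t) + thetaY (7 * t)))"
    unfolding a1 theta_shift w1 unfolding r1_def theta_shift i
    by (simp_all add: field_simps flip: power_add power_Suc)
  have k7: "theta3 (7 * u) = F7 * (omega ^ 9 * theta3 t)" "theta4 (7 * u) = F7 * (omega ^ 3 * theta2 t)"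
     "theta2 (7 * u) = F7 * (omega ^ 15 * theta4 t)" "eta (7 * u) = F7 * (omega ^ 9 * eta t)"
     "thetaX (7 * u) = F7 * ((1 - \<i>) / 2 * (thetaX t - thetaY t))"
     "thetaY (7 * u) = F7 * (- ((1 - \<i>) / 2) * (thetaX t + thetaY t))"
    unfolding a7 theta_shift w7 unfolding r7_def theta_shift i
    by (simp_all add: field_simps flip: power_add power_Suc)
  have k3: "theta3 (3 * u) = F3 * theta3 (21 * t)" "theta4 (3 * u) = F3 * (omega ^ 42 * theta2 (21 * t))"
     "theta2 (3 * u) = F3 * (omega ^ 6 * theta4 (21 * t))" "eta (3 * u) = F3 * (omega ^ 16 * eta (21 * t))"
     "thetaX (3 * u) = F3 * ((thetaX (21 * t) - thetaY (21 * t)) / sqrt 2)"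
     "thetaY (3 * u) = F3 * (- (thetaX (21 * t) + thetaY (21 * t)) / sqrt 2)"
    unfolding a3 theta_shift theta_S[OF im(3)] F3_def[symmetric] unfolding r3_def theta_shift
    by (simp_all add: algebra_simps i flip: power_add power_Suc)
  have k21: "theta3 (21 * u) = F21 * theta3 (3 * t)" "theta4 (21 * u) = F21 * (omega ^ 6 * theta2 (3 * t))"
     "theta2 (21 * u) = F21 * (omega ^ 42 * theta4 (3 * t))" "eta (21 * u) = F21 * (omega ^ 16 * eta (3 * t))"
     "thetaX (21 * u) = F21 * ((thetaX (3 * t) - thetaY (3 * t)) / sqrt 2)"
     "thetaY (21 * u) = F21 * (- (thetaX (3 * t) + thetaY (3 * t)) / sqrt 2)"
    unfolding a21 theta_shift theta_S[OF im(4)] F21_def[symmetric] unfolding r21_def theta_shift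
    by (simp_all add: algebra_simps i flip: power_add power_Suc)
  \<comment> \<open>Both pairs get the same factor J: the sqrt 7 stems from the csqrt factor in one
    product and from \<open>aut_root\<close> in the other.\<close>
  have "1 - 3 * r1 = of_real 7 * (- c)" "1 - 3 * r7 = - c" "r3 = of_real 7 * c" using d by (simp_all add: algebra_simps)
  then have FF: "F1 * F21 = J" "F3 * F7 = J"
    unfolding F1_def F7_def F3_def F21_def J_def c_def[symmetric] d(4)
    using csqrt_scale[of 7 "- c"] aut_root_scale[of 7 c] by (simp_all add: mult_ac)
  have "Im c > 0" using t by (simp add: c_def)
  then show "J \<noteq> 0" unfolding J_def c_def[symmetric] using aut_root_nonzero[of c] c0 by simp
  have w: "omega ^ 21 = - (omega ^ 9)" "omega ^ 57 = omega ^ 9" "omega ^ 45 = - (omega ^ 9)" "omega ^ 25 = omega"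
    using omega_high(1)[of 9] omega_high(2)[of 33] omega_high(2)[of 9] omega_high(2)[of 21] omega_high(2)[of 1] by simp_all
  have half: "(1 - \<i>) / 2 / complex_of_real (sqrt 2) = - (omega ^ 9) / 2"
  proof -
    have "omega ^ 9 = \<i> * omega ^ 3" unfolding omega_6[symmetric] by (simp flip: power_add)
    also have "\<dots> = (\<i> - 1) / sqrt 2" unfolding omega_3 by (simp add: algebra_simps)
    finally have e: "omega ^ 9 = (\<i> - 1) / sqrt 2" .
    show ?thesis unfolding e by (simp add: divide_simps)
  qed
  have alg: "(F * (a * x)) * (G * (b * y)) = (F * G) * ((a * b) * (y * x))" for F G a b x y :: complex by simp
  have p: "omega ^ 15 * omega ^ 6 = - (omega ^ 9)" "omega ^ 6 * omega ^ 15 = - (omega ^ 9)"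
      "omega ^ 3 * omega ^ 42 = - (omega ^ 9)" "omega ^ 42 * omega ^ 3 = - (omega ^ 9)"
      "omega ^ 9 * omega ^ 16 = omega" "omega ^ 16 * omega ^ 9 = omega"
    using w by (simp_all flip: power_add)
  show "pair1 theta4 u = J * (- (omega ^ 9) * pair3 theta2 t)"
    "pair1 theta2 u = J * (- (omega ^ 9) * pair3 theta4 t)" "pair1 eta u = J * (omega * pair3 eta t)"
    unfolding pair_defs k1 k21 alg FF(1) p by (rule refl)+
  show "pair3 theta4 u = J * (- (omega ^ 9) * pair1 theta2 t)"
    "pair3 theta2 u = J * (- (omega ^ 9) * pair1 theta4 t)" "pair3 eta u = J * (omega * pair1 eta t)"
    unfolding pair_defs k3 k7 alg FF(2) p by (rule refl)+
  show "pair1 theta3 u = J * (omega ^ 9 * pair3 theta3 t)"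
    unfolding pair_defs k1 k21 FF(1)[symmetric] by simp
  show "pair3 theta3 u = J * (omega ^ 9 * pair1 theta3 t)"
    unfolding pair_defs k3 k7 FF(2)[symmetric] by simp
  have algx: "(F * ((1 - \<i>) / 2 * x)) * (G * (y / complex_of_real (sqrt 2))) = (F * G) * (- (omega ^ 9) / 2 * (y * x))" 
     "(F * (- ((1 - \<i>) / 2) * x)) * (G * (y / complex_of_real (sqrt 2))) = (F * G) * ((omega ^ 9) / 2 * (y * x))" 
     "(G * (y / complex_of_real (sqrt 2))) * (F * ((1 - \<i>) / 2 * x)) = (G * F) * (- (omega ^ 9) / 2 * (y * x))" 
     "(G * (y / complex_of_real (sqrt 2))) * (F * (- ((1 - \<i>) / 2) * x)) = (G * F) * ((omega ^ 9) / 2 * (y * x))" 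
     for F G x y :: complex
  proof -
    have h: "(F * (h * x)) * (G * (y / s)) = (F * G) * ((h / s) * (y * x))"
      "(F * (- h * x)) * (G * (y / s)) = (F * G) * (- (h / s) * (y * x))"
      "(G * (y / s)) * (F * (h * x)) = (G * F) * ((h / s) * (y * x))"
      "(G * (y / s)) * (F * (- h * x)) = (G * F) * (- (h / s) * (y * x))" for h s :: complex
      by (simp_all add: mult_ac)
    show "(F * ((1 - \<i>) / 2 * x)) * (G * (y / complex_of_real (sqrt 2))) = (F * G) * (- (omega ^ 9) / 2 * (y * x))"
     "(F * (- ((1 - \<i>) / 2) * x)) * (G * (y / complex_of_real (sqrt 2))) = (F * G) * ((omega ^ 9) / 2 * (y * x))"
     "(G * (y / complex_of_real (sqrt 2))) * (F * ((1 - \<i>) / 2 * x)) = (G * F) * (- (omega ^ 9) / 2 * (y * x))"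
     "(G * (y / complex_of_real (sqrt 2))) * (F * (- ((1 - \<i>) / 2) * x)) = (G * F) * ((omega ^ 9) / 2 * (y * x))"
      unfolding h(2,4) unfolding h(1,3) half by simp_all
  qed
  show "A3 u = J * (- (omega ^ 9) * B3 t)" "A4 u = J * (omega ^ 9 * mixed3 t)" "mixed1 u = J * (omega ^ 9 * B4 t)"
    unfolding pair_defs k1 k21 algx FF(1) by (simp_all add: field_simps)
  show "B3 u = J * (- (omega ^ 9) * A3 t)" "B4 u = J * (omega ^ 9 * mixed1 t)" "mixed3 u = J * (omega ^ 9 * A4 t)"
    unfolding pair_defs k3 k7 algx FF(2) by (simp_all add: field_simps)
qed

text \<open>The matrix has determinant 21 and exchanges k with 21/k, as the Fricke map does, but has
  its pole at -1/2. It is the identity mod 2, so the indices 3, 4, 2 stay fixed and only signs and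
  roots of unity appear.\<close>

lemma pairs_W2:
  assumes t: "Im t > 0"
  defines "u \<equiv> (21 * t + 10) / (42 * t + 21)"
    and "J \<equiv> of_real (sqrt 21) * (csqrt (2 * t + 1))\<^sup>2"
  shows "J \<noteq> 0"
    "pair1 theta3 u = J * pair1 theta3 t" "pair1 theta4 u = J * (- pair1 theta4 t)" "pair1 theta2 u = J * (- pair1 theta2 t)"
    "pair3 theta3 u = J * (- pair3 theta3 t)" "pair3 theta4 u = J * pair3 theta4 t" "pair3 theta2 u = J * pair3 theta2 t"
    "pair1 eta u = J * (- (omega ^ 4) * pair1 eta t)" "pair3 eta u = J * (omega ^ 4 * pair3 eta t)"
    "A3 u = J * (- A3 t)" "A4 u = J * A4 t" "mixed1 u = J * mixed1 t"
    "B3 u = J * B3 t" "B4 u = J * (- B4 t)" "mixed3 u = J * (- mixed3 t)"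
proof -
  define c where "c = 2 * t + 1"
  have c0: "c \<noteq> 0" using t by (auto simp: c_def complex_eq_iff)
  have u: "u = (21 * t + 10) / (21 * c)" by (simp add: u_def c_def)
  have g2: "- 1 / (- 2 - 1 / r) = r / (2 * r + 1)" if "r \<noteq> 0" "2 * r + 1 \<noteq> 0" for r :: complex
  proof -
    have "- 2 - 1 / r = - ((2 * r + 1) / r)" using that by (simp add: field_simps)
    then show ?thesis using that by simp
  qed
  \<comment> \<open>Here W = S \<open>T^(-2)\<close> S occurs in all four factorisations: u = W
    \<open>T^10\<close> (21t), 21u = \<open>T^10\<close> W (t), 3u = T W \<open>T^3\<close> (7t), 7u
    = \<open>T^3\<close> W T (3t).\<close>
  define r1 where "r1 = 21 * t + of_nat 10"
  define r3 where "r3 = 7 * t + of_nat 3"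
  define r7 where "r7 = 3 * t + of_nat 1"
  have im: "Im r1 > 0" "Im r7 > 0" "Im r3 > 0" using t by (simp_all add: r1_def r7_def r3_def)
  have nz: "r1 \<noteq> 0" "r7 \<noteq> 0" "r3 \<noteq> 0" "t \<noteq> 0" using im t by auto
  have d: "2 * r1 + 1 = 21 * c" "2 * r7 + 1 = 3 * c" "2 * r3 + 1 = 7 * c" "2 * t + 1 = c"
    by (simp_all add: r1_def r7_def r3_def c_def)
  have a1: "u = - 1 / (- 2 - 1 / r1)"
    using c0 by (subst g2[OF nz(1)]) (simp_all add: d u, simp add: r1_def)
  have a21: "21 * u = - 1 / (- 2 - 1 / t) + of_nat 10"
    using c0 by (subst g2[OF nz(4)]) (simp_all add: d u divide_simps, simp add: c_def algebra_simps)
  have a3: "3 * u = - 1 / (- 2 - 1 / r3) + of_nat 1"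
    using c0 by (subst g2[OF nz(3)]) (simp_all add: d u divide_simps, simp add: c_def r3_def algebra_simps)
  have a7: "7 * u = - 1 / (- 2 - 1 / r7) + of_nat 3"
    using c0 by (subst g2[OF nz(2)]) (simp_all add: d u divide_simps, simp add: c_def r7_def algebra_simps)
  have i: "\<i> ^ 10 = -1" "\<i> ^ 3 = - \<i>" by (simp_all add: eval_nat_numeral)
  define F1 where "F1 = csqrt (2 * r1 + 1)"
  define F7 where "F7 = csqrt (2 * r7 + 1)"
  define F3 where "F3 = csqrt (2 * r3 + 1)"
  define F21 where "F21 = csqrt (2 * t + 1)"
  note w1 = theta_word2[OF im(1), folded F1_def]
  note w7 = theta_word2[OF im(2), folded F7_def]
  note w3 = theta_word2[OF im(3), folded F3_def]
  note w21 = theta_word2[OF t, folded F21_def]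
  have om: "omega ^ 30 = \<i>" "omega ^ 32 = omega ^ 8" "omega ^ 26 = omega ^ 2" "omega ^ 16 = - (omega ^ 4)"
    using omega_high(2)[of 6] omega_high(2)[of 8] omega_high(2)[of 2] omega_high(1)[of 4] omega_6 by simp_all
  have k1: "theta3 u = F1 * theta3 (21 * t)" "theta4 u = F1 * (- \<i> * theta4 (21 * t))"
     "theta2 u = F1 * (\<i> * theta2 (21 * t))" "eta u = F1 * (omega ^ 8 * eta (21 * t))"
     "thetaX u = F1 * (- thetaY (21 * t))" "thetaY u = F1 * thetaX (21 * t)"
    unfolding a1 theta_shift w1 unfolding r1_def theta_shift
    by (simp_all add: i om flip: power_add power_Suc mult.assoc)
  have k21: "theta3 (21 * u) = F21 * theta3 t" "theta4 (21 * u) = F21 * (- \<i> * theta4 t)"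
     "theta2 (21 * u) = F21 * (\<i> * theta2 t)" "eta (21 * u) = F21 * (omega ^ 8 * eta t)"
     "thetaX (21 * u) = F21 * thetaY t" "thetaY (21 * u) = F21 * (- thetaX t)"
    unfolding a21 theta_shift w21 by (simp_all add: i om mult.left_commute[of _ F21] flip: power_add power_Suc mult.assoc)
  have rearr: "a * (F * (b * x)) = F * ((a * b) * x)" for a b F x :: complex by simp
  have om2: "omega ^ 3 * omega ^ 9 = - 1" "omega ^ 9 * omega ^ 3 = - 1" by (simp_all add: omega_12 flip: power_add)
  have om3: "omega ^ 25 * omega = omega ^ 2" using om(3) power_add[of omega 25 1] by simp
  have k3: "theta3 (3 * u) = F3 * (- \<i> * theta3 (7 * t))" "theta4 (3 * u) = F3 * theta4 (7 * t)"
     "theta2 (3 * u) = F3 * (- theta2 (7 * t))" "eta (3 * u) = F3 * (omega ^ 2 * eta (7 * t))"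
     "thetaX (3 * u) = F3 * (- \<i> * thetaY (7 * t))" "thetaY (3 * u) = F3 * (\<i> * thetaX (7 * t))"
    unfolding a3 theta_shift w3 unfolding r3_def theta_shift rearr
    by (simp_all add: i om om2 om3 omega_12 flip: power_add power_Suc mult.assoc)
  have k7: "theta3 (7 * u) = F7 * (- \<i> * theta3 (3 * t))" "theta4 (7 * u) = F7 * theta4 (3 * t)"
     "theta2 (7 * u) = F7 * (- theta2 (3 * t))" "eta (7 * u) = F7 * (omega ^ 2 * eta (3 * t))"
     "thetaX (7 * u) = F7 * (\<i> * thetaY (3 * t))" "thetaY (7 * u) = F7 * (- \<i> * thetaX (3 * t))"
    unfolding a7 theta_shift w7 unfolding r7_def theta_shift rearr
    by (simp_all add: i om om2 om3 omega_12 flip: power_add power_Suc mult.assoc)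
  have s: "complex_of_real (sqrt 7) * complex_of_real (sqrt 3) = complex_of_real (sqrt 21)"
    by (simp flip: of_real_mult real_sqrt_mult)
  have FF: "F1 * F21 = J" "F3 * F7 = J"
    unfolding F1_def F7_def F3_def F21_def J_def d
    using csqrt_scale[of 21 c] csqrt_scale[of 7 c] csqrt_scale[of 3 c] s by (simp_all add: power2_eq_square mult_ac)
  show "J \<noteq> 0" unfolding J_def c_def[symmetric] using c0 by simp
  show "pair1 theta3 u = J * pair1 theta3 t" "pair1 theta4 u = J * (- pair1 theta4 t)" "pair1 theta2 u = J * (- pair1 theta2 t)"
    "pair1 eta u = J * (- (omega ^ 4) * pair1 eta t)"
    "A3 u = J * (- A3 t)" "A4 u = J * A4 t" "mixed1 u = J * mixed1 t"
    unfolding pair_defs k1 k21 FF(1)[symmetric] om(4)[symmetric] by (simp_all add: algebra_simps flip: power_add)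
  show "pair3 theta3 u = J * (- pair3 theta3 t)" "pair3 theta4 u = J * pair3 theta4 t" "pair3 theta2 u = J * pair3 theta2 t"
    "pair3 eta u = J * (omega ^ 4 * pair3 eta t)"
    "B3 u = J * B3 t" "B4 u = J * (- B4 t)" "mixed3 u = J * (- mixed3 t)"
    unfolding pair_defs k3 k7 FF(2)[symmetric] by (simp_all add: algebra_simps flip: power_add)
qed

subsection \<open>Reduction and the maximum principle\<close>

text \<open>For s = -1, with u and v the eta pairs, vanishing of this is the first identity: the
  factor q is the quotient of the eta prefactors \<open>q^(11/6)\<close> and \<open>q^(5/6)\<close>.
  The letter Q denotes the series (3,0,7) here, not \<open>q^7\<close>.\<close>

definition combI :: "complex \<Rightarrow> complex \<Rightarrow> complex \<Rightarrow> complex \<Rightarrow> complex \<Rightarrow> complex \<Rightarrow> complex \<Rightarrow> complex" where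
  "combI s P Q A B u v = (P - B) / u + s * ((Q + A) / v)"

text \<open>By \<open>theta_phi_psi_cube\<close> the psi quotient of the second identity is a ratio
  of cubes of Euler products times Q / P; after cancelling, the identity says that this expression
  is 0.\<close>

definition combII :: "complex \<Rightarrow> complex \<Rightarrow> complex \<Rightarrow> complex \<Rightarrow> complex \<Rightarrow> complex \<Rightarrow> complex" where
  "combII P Q A B u v = (Q - A) * P / u\<^sup>2 + (P + B) * Q / v\<^sup>2"

text \<open>P and B carry the phase a, Q and A the phase b, u and v the phases c and d; J cancels
  since the weight is 0. The condition on the signs makes the phases of the two summands agree, so
  that a / c factors out.\<close>

lemma norm_combI_same:
  assumes "J \<noteq> 0" "norm a = 1" "norm c = 1" "norm d = 1" "s' * b * c = s * a * d"
    and "P' = J * (a * P)" "Q' = J * (b * Q)" "A' = J * (b * A)" "B' = J * (a * B)" "u' = J * (c * u)" "v' = J * (d * v)"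
  shows "norm (combI s' P' Q' A' B' u' v') = norm (combI s P Q A B u v)"
proof -
  have nz: "c \<noteq> 0" "d \<noteq> 0" using assms by auto
  have e1: "(P' - B') / u' = a / c * ((P - B) / u)"
  proof -
    have "P' - B' = J * (a * (P - B))" using assms by (simp add: algebra_simps)
    then show ?thesis using assms(1,10) by simp
  qed
  have e2: "(Q' + A') / v' = b / d * ((Q + A) / v)"
  proof -
    have "Q' + A' = J * (b * (Q + A))" using assms by (simp add: algebra_simps)
    then show ?thesis using assms(1,11) by simp
  qed
  have e3: "s' * (b / d) = a / c * s" using assms(5) nz by (simp add: field_simps)
  have "combI s' P' Q' A' B' u' v' = a / c * ((P - B) / u) + (s' * (b / d)) * ((Q + A) / v)"
    unfolding combI_def e1 e2 by simp
  also have "\<dots> = a / c * combI s P Q A B u v"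
    unfolding e3 combI_def by (simp only: distrib_left mult.assoc)
  finally show ?thesis using assms(2,3) by (simp add: norm_mult norm_divide)
qed

text \<open>If P goes to Q but B to -A, then P - B goes to Q + A: the two summands trade places, and
  s s = 1 restores the sum up to a phase.\<close>

lemma norm_combI_swap:
  assumes "J \<noteq> 0" "norm a = 1" "norm c = 1" "s * s = 1"
    and "P' = J * (a * Q)" "Q' = J * (a * P)" "A' = J * (- a * B)" "B' = J * (- a * A)" "u' = J * (c * v)" "v' = J * (c * u)"
  shows "norm (combI s P' Q' A' B' u' v') = norm (combI s P Q A B u v)"
proof -
  have e1: "(P' - B') / u' = a / c * ((Q + A) / v)"
  proof -
    have "P' - B' = J * (a * (Q + A))" using assms by (simp add: algebra_simps)
    then show ?thesis using assms(1,9) by simp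
  qed
  have e2: "(Q' + A') / v' = a / c * ((P - B) / u)"
  proof -
    have "Q' + A' = J * (a * (P - B))" using assms by (simp add: algebra_simps)
    then show ?thesis using assms(1,10) by simp
  qed
  have "combI s P' Q' A' B' u' v' = a / c * ((s * s) * ((Q + A) / v)) + s * (a / c * ((P - B) / u))"
    unfolding combI_def e1 e2 assms(4) by simp
  also have "\<dots> = (s * (a / c)) * combI s P Q A B u v"
    unfolding combI_def by (simp add: distrib_left mult_ac)
  finally have "norm (combI s P' Q' A' B' u' v') = norm s * norm (combI s P Q A B u v)"
    using assms(2,3) by (simp add: norm_mult norm_divide)
  moreover have "norm s = 1"
    using assms(4) by (metis norm_mult norm_one norm_ge_zero power2_eq_square power2_eq_1_iff abs_norm_cancel abs_1 real_sqrt_abs2 real_sqrt_one)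
  ultimately show ?thesis by simp
qed

lemma norm_combII_same:
  assumes "J \<noteq> 0" "norm a = 1" "norm b = 1" "norm c = 1" "c\<^sup>2 = d\<^sup>2"
    and "P' = J * (a * P)" "Q' = J * (b * Q)" "A' = J * (b * A)" "B' = J * (a * B)" "u' = J * (c * u)" "v' = J * (d * v)"
  shows "norm (combII P' Q' A' B' u' v') = norm (combII P Q A B u v)"
proof -
  have e1: "(Q' - A') * P' / u'\<^sup>2 = (a * b / c\<^sup>2) * ((Q - A) * P / u\<^sup>2)"
  proof -
    have "(Q' - A') * P' = J\<^sup>2 * ((a * b) * ((Q - A) * P))" using assms by (simp add: algebra_simps power2_eq_square)
    moreover have "u'\<^sup>2 = J\<^sup>2 * (c\<^sup>2 * u\<^sup>2)" using assms by (simp add: power_mult_distrib)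
    ultimately show ?thesis using assms(1) by simp
  qed
  have e2: "(P' + B') * Q' / v'\<^sup>2 = (a * b / c\<^sup>2) * ((P + B) * Q / v\<^sup>2)"
  proof -
    have "(P' + B') * Q' = J\<^sup>2 * ((a * b) * ((P + B) * Q))" using assms by (simp add: algebra_simps power2_eq_square)
    moreover have "v'\<^sup>2 = J\<^sup>2 * (c\<^sup>2 * v\<^sup>2)" using assms by (simp add: power_mult_distrib)
    ultimately show ?thesis using assms(1) by simp
  qed
  have "combII P' Q' A' B' u' v' = (a * b / c\<^sup>2) * combII P Q A B u v"
    unfolding combII_def e1 e2 by (simp add: distrib_left)
  then show ?thesis using assms(2-4) by (simp add: norm_mult norm_divide norm_power)
qed

lemma norm_combII_swap:
  assumes "J \<noteq> 0" "norm a = 1" "norm c = 1"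
    and "P' = J * (a * Q)" "Q' = J * (a * P)" "A' = J * (- a * B)" "B' = J * (- a * A)" "u' = J * (c * v)" "v' = J * (c * u)"
  shows "norm (combII P' Q' A' B' u' v') = norm (combII P Q A B u v)"
proof -
  have e1: "(Q' - A') * P' / u'\<^sup>2 = (a\<^sup>2 / c\<^sup>2) * ((P + B) * Q / v\<^sup>2)"
  proof -
    have "(Q' - A') * P' = J\<^sup>2 * (a\<^sup>2 * ((P + B) * Q))" using assms by (simp add: algebra_simps power2_eq_square)
    moreover have "u'\<^sup>2 = J\<^sup>2 * (c\<^sup>2 * v\<^sup>2)" using assms by (simp add: power_mult_distrib)
    ultimately show ?thesis using assms(1) by simp
  qed
  have e2: "(P' + B') * Q' / v'\<^sup>2 = (a\<^sup>2 / c\<^sup>2) * ((Q - A) * P / u\<^sup>2)"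
  proof -
    have "(P' + B') * Q' = J\<^sup>2 * (a\<^sup>2 * ((Q - A) * P))" using assms by (simp add: algebra_simps power2_eq_square)
    moreover have "v'\<^sup>2 = J\<^sup>2 * (c\<^sup>2 * u\<^sup>2)" using assms by (simp add: power_mult_distrib)
    ultimately show ?thesis using assms(1) by simp
  qed
  have "combII P' Q' A' B' u' v' = (a\<^sup>2 / c\<^sup>2) * combII P Q A B u v"
    unfolding combII_def e1 e2 by (simp add: distrib_left)
  then show ?thesis using assms(2-3) by (simp add: norm_mult norm_divide norm_power)
qed

text \<open>The sign -1 belongs to index 3 only: under translation the two eta pairs acquire
  opposite phases, which turns -1 into +1 for the conjugates.\<close>

definition gapI3 where "gapI3 t = combI (-1) (pair1 theta3 t) (pair3 theta3 t) (A3 t) (B3 t) (pair1 eta t) (pair3 eta t)"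
definition gapI4 where "gapI4 t = combI 1 (pair1 theta4 t) (pair3 theta4 t) (A4 t) (B4 t) (pair1 eta t) (pair3 eta t)"
definition gapI2 where "gapI2 t = combI 1 (pair1 theta2 t) (pair3 theta2 t) (mixed1 t) (mixed3 t) (pair1 eta t) (pair3 eta t)"
definition gapII3 where "gapII3 t = combII (pair1 theta3 t) (pair3 theta3 t) (A3 t) (B3 t) (pair1 eta t) (pair3 eta t)"
definition gapII4 where "gapII4 t = combII (pair1 theta4 t) (pair3 theta4 t) (A4 t) (B4 t) (pair1 eta t) (pair3 eta t)"
definition gapII2 where "gapII2 t = combII (pair1 theta2 t) (pair3 theta2 t) (mixed1 t) (mixed3 t) (pair1 eta t) (pair3 eta t)"

lemmas gap_defs = gapI3_def gapI4_def gapI2_def gapII3_def gapII4_def gapII2_def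

lemma norm_omega_power [simp]: "norm (omega ^ n) = 1" by (simp add: norm_power)

lemma gap_T:
  "norm (gapI3 (t + 1)) = norm (gapI4 t)" "norm (gapI4 (t + 1)) = norm (gapI3 t)" "norm (gapI2 (t + 1)) = norm (gapI2 t)"
  "norm (gapII3 (t + 1)) = norm (gapII4 t)" "norm (gapII4 (t + 1)) = norm (gapII3 t)" "norm (gapII2 (t + 1)) = norm (gapII2 t)"
proof -
  note T1 = norm_combI_same[of 1 1 "- (omega ^ 10)" "omega ^ 10" _ 1]
  note T2 = norm_combII_same[of 1 1 1 "- (omega ^ 10)" "omega ^ 10"]
  show "norm (gapI3 (t + 1)) = norm (gapI4 t)" unfolding gap_defs pairs_T by (rule T1; simp)
  show "norm (gapI4 (t + 1)) = norm (gapI3 t)" unfolding gap_defs pairs_T by (rule T1; simp)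
  show "norm (gapI2 (t + 1)) = norm (gapI2 t)" unfolding gap_defs pairs_T
    by (rule norm_combI_same[of 1 "- \<i>" "- (omega ^ 10)" "omega ^ 10" _ \<i>]; simp)
  show "norm (gapII3 (t + 1)) = norm (gapII4 t)" unfolding gap_defs pairs_T by (rule T2; simp)
  show "norm (gapII4 (t + 1)) = norm (gapII3 t)" unfolding gap_defs pairs_T by (rule T2; simp)
  show "norm (gapII2 (t + 1)) = norm (gapII2 t)" unfolding gap_defs pairs_T
    by (rule norm_combII_same[of 1 "- \<i>" \<i> "- (omega ^ 10)" "omega ^ 10"]; simp)
qed

lemma gap_S:
  assumes t: "Im t > 0"
  defines "u \<equiv> - 1 / (21 * t)"
  shows "norm (gapI3 u) = norm (gapI3 t)" "norm (gapI4 u) = norm (gapI2 t)" "norm (gapI2 u) = norm (gapI4 t)"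
    "norm (gapII3 u) = norm (gapII3 t)" "norm (gapII4 u) = norm (gapII2 t)" "norm (gapII2 u) = norm (gapII4 t)"
proof -
  note p = pairs_S[OF t, folded u_def]
  show "norm (gapI3 u) = norm (gapI3 t)" "norm (gapI4 u) = norm (gapI2 t)" "norm (gapI2 u) = norm (gapI4 t)"
    unfolding gap_defs p(2-15) by (rule norm_combI_same[OF p(1), of 1 1 1 _ 1]; simp)+
  show "norm (gapII3 u) = norm (gapII3 t)" "norm (gapII4 u) = norm (gapII2 t)" "norm (gapII2 u) = norm (gapII4 t)"
    unfolding gap_defs p(2-15) by (rule norm_combII_same[OF p(1), of 1 1 1 1]; simp)+
qed

lemma gap_W7:
  assumes t: "Im t > 0"
  defines "u \<equiv> (14 * t + 9) / (21 * t + 14)"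
  shows "norm (gapI3 u) = norm (gapI3 t)" "norm (gapI4 u) = norm (gapI2 t)" "norm (gapI2 u) = norm (gapI4 t)"
    "norm (gapII3 u) = norm (gapII3 t)" "norm (gapII4 u) = norm (gapII2 t)" "norm (gapII2 u) = norm (gapII4 t)"
proof -
  note p = pairs_W7[OF t, folded u_def]
  show "norm (gapI3 u) = norm (gapI3 t)"
    unfolding gap_defs p(2-15) by (rule norm_combI_swap[OF p(1), of "omega ^ 9" omega]; simp)
  show "norm (gapI4 u) = norm (gapI2 t)" "norm (gapI2 u) = norm (gapI4 t)"
    unfolding gap_defs p(2-15) by (rule norm_combI_swap[OF p(1), of "- (omega ^ 9)" omega]; simp)+
  show "norm (gapII3 u) = norm (gapII3 t)"
    unfolding gap_defs p(2-15) by (rule norm_combII_swap[OF p(1), of "omega ^ 9" omega]; simp)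
  show "norm (gapII4 u) = norm (gapII2 t)" "norm (gapII2 u) = norm (gapII4 t)"
    unfolding gap_defs p(2-15) by (rule norm_combII_swap[OF p(1), of "- (omega ^ 9)" omega]; simp)+
qed

lemma gap_W2:
  assumes t: "Im t > 0"
  defines "u \<equiv> (21 * t + 10) / (42 * t + 21)"
  shows "norm (gapI3 u) = norm (gapI3 t)" "norm (gapI4 u) = norm (gapI4 t)" "norm (gapI2 u) = norm (gapI2 t)"
    "norm (gapII3 u) = norm (gapII3 t)" "norm (gapII4 u) = norm (gapII4 t)" "norm (gapII2 u) = norm (gapII2 t)"
proof -
  note p = pairs_W2[OF t, folded u_def]
  show "norm (gapI3 u) = norm (gapI3 t)"
    unfolding gap_defs p(2-15) by (rule norm_combI_same[OF p(1), of 1 "- (omega ^ 4)" "omega ^ 4" _ "- 1"]; simp)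
  show "norm (gapI4 u) = norm (gapI4 t)" "norm (gapI2 u) = norm (gapI2 t)"
    unfolding gap_defs p(2-15) by (rule norm_combI_same[OF p(1), of "- 1" "- (omega ^ 4)" "omega ^ 4" _ 1]; simp)+
  show "norm (gapII3 u) = norm (gapII3 t)"
    unfolding gap_defs p(2-15) by (rule norm_combII_same[OF p(1), of 1 "- 1" "- (omega ^ 4)" "omega ^ 4"]; simp)
  show "norm (gapII4 u) = norm (gapII4 t)" "norm (gapII2 u) = norm (gapII2 t)"
    unfolding gap_defs p(2-15) by (rule norm_combII_same[OF p(1), of "- 1" 1 "- (omega ^ 4)" "omega ^ 4"]; simp)+
qed

section \<open>Reduction to height 1/50\<close>

lemma Im_moebius:
  fixes a b c d :: real and z :: complex
  shows "Im ((of_real a * z + of_real b) / (of_real c * z + of_real d)) =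
    (a * d - b * c) * Im z / ((c * Re z + d)\<^sup>2 + (c * Im z)\<^sup>2)"
  by (simp add: Im_divide algebra_simps)

lemma modular_reduction_step:
  fixes M :: "complex \<Rightarrow> real"
  assumes T: "\<And>t. Im t > 0 \<Longrightarrow> M (t + 1) = M t"
    and S: "\<And>t. Im t > 0 \<Longrightarrow> M (- 1 / (21 * t)) = M t"
    and W7: "\<And>t. Im t > 0 \<Longrightarrow> M ((14 * t + 9) / (21 * t + 14)) = M t"
    and W2: "\<And>t. Im t > 0 \<Longrightarrow> M ((21 * t + 10) / (42 * t + 21)) = M t"
    and t: "Im t > 0" "Im t < 1 / 50" "\<bar>Re t\<bar> \<le> 1 / 2"
  shows "\<exists>t'. M t' = M t \<and> Im t' \<ge> Im t * (101 / 100)"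
proof -
  define x y where "x = Re t" and "y = Im t"
  have y: "y > 0" "y < 1 / 50" using t by (auto simp: y_def)
  have y2: "y\<^sup>2 \<le> 1 / 2500" using power_mono[of y "1/50" 2] y by (simp add: power2_eq_square)
  have ge: "k * y / D \<ge> y * (101 / 100)" if "D > 0" "D * (101 / 100) \<le> k" for k D
  proof -
    have "y * (101 / 100) * D \<le> k * y" using mult_left_mono[OF that(2), of y] y by (simp add: mult_ac)
    then show ?thesis using that by (simp add: le_divide_eq)
  qed
  have posD: "(c * X + d)\<^sup>2 + (c * y)\<^sup>2 > 0" if "c \<noteq> 0" for c d X :: real
    using that y by (simp add: add_nonneg_pos)
  have sq: "(x - c)\<^sup>2 \<le> r\<^sup>2" if "\<bar>x - c\<bar> \<le> r" for c r
    using power_mono[OF that, of 2] by simp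
  \<comment> \<open>The isometric circles about 0, +-1/3, +-1/2 have radii 1/sqrt 21, sqrt 7 / 21,
    sqrt 21 / 42, slightly more than the half-widths 21/100, 37/300, 1/10 used here. The excess pays
    for the height 1/50 and the gain 101/100; the circles about +-1/3 are the tightest.\<close>
  consider "\<bar>x\<bar> \<le> 21/100" | "21/100 \<le> x" "x \<le> 40/100" | "40/100 \<le> x" "x \<le> 1/2"
    | "- (40/100) \<le> x" "x \<le> - (21/100)" | "- (1/2) \<le> x" "x \<le> - (40/100)"
    using t(3) unfolding x_def[symmetric] by linarith
  then show ?thesis
  proof cases
    case 1
    have "Im (- 1 / (21 * t)) = Im ((of_real 0 * t + of_real (-1)) / (of_real 21 * t + of_real 0))" by simp
    also have "\<dots> = 21 * y / ((21 * x + 0)\<^sup>2 + (21 * y)\<^sup>2)"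
      unfolding Im_moebius x_def[symmetric] y_def[symmetric] by simp
    also have "\<dots> \<ge> y * (101 / 100)"
      using posD[of 21 x 0] sq[of 0 "21/100"] 1 y2 by (intro ge) (auto simp: power_mult_distrib power_divide)
    finally show ?thesis using S[OF t(1)] by (auto simp: y_def)
  next
    case 2
    have t': "Im (t - 1) > 0" "M (t - 1) = M t" using t T[of "t - 1"] by auto
    have "Im ((14 * (t - 1) + 9) / (21 * (t - 1) + 14)) = Im ((of_real 14 * t + of_real (-5)) / (of_real 21 * t + of_real (-7)))"
      by (simp add: algebra_simps)
    also have "\<dots> = 7 * y / ((21 * x + (-7))\<^sup>2 + (21 * y)\<^sup>2)"
      unfolding Im_moebius x_def[symmetric] y_def[symmetric] by simp
    also have "\<dots> \<ge> y * (101 / 100)"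
    proof (rule ge)
      have "21 * x + (-7) = 21 * (x - 1/3)" by simp
      then have "(21 * x + (-7))\<^sup>2 = 441 * (x - 1/3)\<^sup>2" by (simp only: power_mult_distrib) simp
      moreover have "(x - 1/3)\<^sup>2 \<le> (37/300)\<^sup>2" using 2 by (intro sq) linarith
      ultimately show "((21 * x + (-7))\<^sup>2 + (21 * y)\<^sup>2) * (101 / 100) \<le> 7"
        using y2 by (simp add: power_mult_distrib power_divide)
    qed (rule posD, simp)
    finally show ?thesis using W7[OF t'(1)] t'(2) by (auto simp: y_def)
  next
    case 3
    have t': "Im (t - 1) > 0" "M (t - 1) = M t" using t T[of "t - 1"] by auto
    have "Im ((21 * (t - 1) + 10) / (42 * (t - 1) + 21)) = Im ((of_real 21 * t + of_real (-11)) / (of_real 42 * t + of_real (-21)))"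
      by (simp add: algebra_simps)
    also have "\<dots> = 21 * y / ((42 * x + (-21))\<^sup>2 + (42 * y)\<^sup>2)"
      unfolding Im_moebius x_def[symmetric] y_def[symmetric] by simp
    also have "\<dots> \<ge> y * (101 / 100)"
    proof (rule ge)
      have "42 * x + (-21) = 42 * (x - 1/2)" by simp
      then have "(42 * x + (-21))\<^sup>2 = 1764 * (x - 1/2)\<^sup>2" by (simp only: power_mult_distrib) simp
      moreover have "(x - 1/2)\<^sup>2 \<le> (1/10)\<^sup>2" using 3 by (intro sq) linarith
      ultimately show "((42 * x + (-21))\<^sup>2 + (42 * y)\<^sup>2) * (101 / 100) \<le> 21"
        using y2 by (simp add: power_mult_distrib power_divide)
    qed (rule posD, simp)
    finally show ?thesis using W2[OF t'(1)] t'(2) by (auto simp: y_def)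
  next
    case 4
    \<comment> \<open>The pole -2/3 translates to 1/3 but not to -1/3. The inverse map
      \<open>u\<close> has its pole at 2/3, so it serves x near -1/3, and the invariance is applied
      at \<open>u\<close> instead of at t.\<close>
    define s where "s = t + 1"
    define u where "u = (14 * s - 9) / (- 21 * s + 14)"
    have s: "Im s > 0" "M s = M t" using t T[of t] by (auto simp: s_def)
    have "Im u = Im ((of_real 14 * t + of_real 5) / (of_real (-21) * t + of_real (-7)))"
      by (simp add: u_def s_def algebra_simps)
    also have "\<dots> = 7 * y / (((-21) * x + (-7))\<^sup>2 + ((-21) * y)\<^sup>2)"
      unfolding Im_moebius x_def[symmetric] y_def[symmetric] by simp
    finally have Imu: "Im u = 7 * y / (((-21) * x + (-7))\<^sup>2 + ((-21) * y)\<^sup>2)" .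
    also have "\<dots> \<ge> y * (101 / 100)"
    proof (rule ge)
      have "(-21) * x + (-7) = (-21) * (x - (-1/3))" by simp
      then have "((-21) * x + (-7))\<^sup>2 = 441 * (x - (-1/3))\<^sup>2" by (simp only: power_mult_distrib) simp
      moreover have "(x - (-1/3))\<^sup>2 \<le> (37/300)\<^sup>2" using 4 by (intro sq) linarith
      ultimately show "(((-21) * x + (-7))\<^sup>2 + ((-21) * y)\<^sup>2) * (101 / 100) \<le> 7"
        using y2 by (simp add: power_mult_distrib power_divide)
    qed (rule posD, simp)
    finally have le: "y * (101 / 100) \<le> Im u" .
    then have "Im u > 0" using y by linarith
    have nz: "- 21 * s + 14 \<noteq> 0" using s(1) by (auto simp: complex_eq_iff)
    have "(14 * u + 9) / (21 * u + 14) = s"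
    proof -
      have "14 * u + 9 = 7 * s / (- 21 * s + 14)" "21 * u + 14 = 7 / (- 21 * s + 14)"
        using nz by (simp_all add: u_def field_simps)
      then show ?thesis using nz by simp
    qed
    then have "M u = M t" using W7[OF \<open>Im u > 0\<close>] s(2) by simp
    then show ?thesis using le by (auto simp: y_def)
  next
    case 5
    have "Im ((21 * t + 10) / (42 * t + 21)) = Im ((of_real 21 * t + of_real 10) / (of_real 42 * t + of_real 21))"
      by simp
    also have "\<dots> = 21 * y / ((42 * x + 21)\<^sup>2 + (42 * y)\<^sup>2)"
      unfolding Im_moebius x_def[symmetric] y_def[symmetric] by simp
    also have "\<dots> \<ge> y * (101 / 100)"
    proof (rule ge)
      have "42 * x + 21 = 42 * (x - (-1/2))" by simp
      then have "(42 * x + 21)\<^sup>2 = 1764 * (x - (-1/2))\<^sup>2" by (simp only: power_mult_distrib) simp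
      moreover have "(x - (-1/2))\<^sup>2 \<le> (1/10)\<^sup>2" using 5 by (intro sq) linarith
      ultimately show "((42 * x + 21)\<^sup>2 + (42 * y)\<^sup>2) * (101 / 100) \<le> 21"
        using y2 by (simp add: power_mult_distrib power_divide)
    qed (rule posD, simp)
    finally show ?thesis using W2[OF t(1)] by (auto simp: y_def)
  qed
qed

text \<open>Translation into the strip keeps the height, and each step below 1/50 multiplies it by
  at least 101/100, so finitely many steps suffice.\<close>

lemma modular_reduction:
  fixes M :: "complex \<Rightarrow> real"
  assumes T: "\<And>t. Im t > 0 \<Longrightarrow> M (t + 1) = M t"
    and S: "\<And>t. Im t > 0 \<Longrightarrow> M (- 1 / (21 * t)) = M t"
    and W7: "\<And>t. Im t > 0 \<Longrightarrow> M ((14 * t + 9) / (21 * t + 14)) = M t"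
    and W2: "\<And>t. Im t > 0 \<Longrightarrow> M ((21 * t + 10) / (42 * t + 21)) = M t"
    and t: "Im t > 0"
  shows "\<exists>t'. M t' = M t \<and> Im t' \<ge> 1 / 50 \<and> \<bar>Re t'\<bar> \<le> 1 / 2"
proof -
  have Tn: "M (t + of_nat n) = M t" if "Im t > 0" for t n
    using that by (induction n) (auto simp: T add.assoc[symmetric] add.commute[of 1])
  have Ti: "M (t + of_int k) = M t" if "Im t > 0" for t k
  proof (cases "k \<ge> 0")
    case True
    then show ?thesis using Tn[OF that, of "nat k"] by simp
  next
    case False
    then show ?thesis using Tn[of "t + of_int k" "nat (- k)"] that by simp
  qed
  have strip: "\<exists>t'. M t' = M t \<and> Im t' = Im t \<and> \<bar>Re t'\<bar> \<le> 1 / 2" if "Im t > 0" for t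
  proof -
    have "\<bar>Re (t + of_int (- round (Re t)))\<bar> \<le> 1 / 2"
      using of_int_round_abs_le[of "Re t"] by (simp add: abs_minus_commute)
    then show ?thesis using Ti[OF that, of "- round (Re t)"]
      by (intro exI[of _ "t + of_int (- round (Re t))"]) simp
  qed
  have main: "\<exists>t'. M t' = M t \<and> Im t' \<ge> 1 / 50 \<and> \<bar>Re t'\<bar> \<le> 1 / 2"
    if "Im t > 0" "Im t * (101 / 100) ^ n \<ge> 1 / 50" for n t
    using that
  proof (induction n arbitrary: t)
    case 0
    then show ?case using strip[of t] by (metis mult.right_neutral power_0)
  next
    case (Suc n)
    obtain t1 where t1: "M t1 = M t" "Im t1 = Im t" "\<bar>Re t1\<bar> \<le> 1 / 2" using strip[OF Suc.prems(1)] by auto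
    show ?case
    proof (cases "Im t \<ge> 1 / 50")
      case True
      then show ?thesis using t1 by metis
    next
      case False
      then obtain t2 where t2: "M t2 = M t1" "Im t2 \<ge> Im t1 * (101 / 100)"
        using modular_reduction_step[of M t1, OF T S W7 W2] t1 Suc.prems(1) by auto
      have "Im t2 > 0" using t2(2) t1(2) Suc.prems(1) by linarith
      moreover have "Im t2 * (101 / 100) ^ n \<ge> 1 / 50"
      proof -
        have "1 / 50 \<le> Im t * (101 / 100) * (101 / 100) ^ n"
          using Suc.prems(2) by (simp only: power_Suc mult.assoc)
        also have "\<dots> \<le> Im t2 * (101 / 100) ^ n"
          using t2(2) t1(2) by (intro mult_right_mono) auto
        finally show ?thesis .
      qed
      ultimately show ?thesis using Suc.IH[of t2] t2(1) t1(1) by metis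
    qed
  qed
  obtain n where "(101 / 100 :: real) ^ n > 1 / 50 / Im t"
    using real_arch_pow[of "101 / 100" "1 / 50 / Im t"] by auto
  then have "Im t * (101 / 100) ^ n \<ge> 1 / 50"
    using t by (simp add: divide_less_eq mult.commute)
  then show ?thesis using main[OF t] by blast
qed

text \<open>The individual moduli are only permuted, but their maximum \<open>M\<close> is
  invariant, so \<open>M\<close> attains a global maximum on the compact part of the strip.
  Whichever function realises it is constant, against its smallness high up. The decay of
  \<open>f4\<close> is inherited from \<open>f3\<close> by translation.\<close>

lemma modular_vanishing:
  fixes f2 f3 f4 :: "complex \<Rightarrow> complex"
  assumes hol: "f2 holomorphic_on uhp" "f3 holomorphic_on uhp" "f4 holomorphic_on uhp"
    and T: "\<And>t. Im t > 0 \<Longrightarrow> norm (f3 (t + 1)) = norm (f4 t) \<and> norm (f4 (t + 1)) = norm (f3 t) \<and> norm (f2 (t + 1)) = norm (f2 t)"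
    and S: "\<And>t u. Im t > 0 \<Longrightarrow> u = - 1 / (21 * t) \<or> u = (14 * t + 9) / (21 * t + 14) \<Longrightarrow>
       norm (f3 u) = norm (f3 t) \<and> norm (f4 u) = norm (f2 t) \<and> norm (f2 u) = norm (f4 t)"
    and W: "\<And>t u. Im t > 0 \<Longrightarrow> u = (21 * t + 10) / (42 * t + 21) \<Longrightarrow>
       norm (f3 u) = norm (f3 t) \<and> norm (f4 u) = norm (f4 t) \<and> norm (f2 u) = norm (f2 t)"
    and lim: "(f2 \<longlongrightarrow> 0) (filtercomap Im at_top)" "(f3 \<longlongrightarrow> 0) (filtercomap Im at_top)"
    and t: "Im t > 0"
  shows "f3 t = 0"
proof (rule ccontr)
  assume nz: "f3 t \<noteq> 0"
  define M where "M t = max (norm (f2 t)) (max (norm (f3 t)) (norm (f4 t)))" for t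
  have red: "\<exists>t'. M t' = M t \<and> Im t' \<ge> 1 / 50 \<and> \<bar>Re t'\<bar> \<le> 1 / 2" if "Im t > 0" for t
  proof (rule modular_reduction[of M, OF _ _ _ _ that])
    fix t :: complex assume "Im t > 0"
    then show "M (t + 1) = M t" "M (- 1 / (21 * t)) = M t" "M ((14 * t + 9) / (21 * t + 14)) = M t"
      "M ((21 * t + 10) / (42 * t + 21)) = M t"
      using T[of t] S[of t "- 1 / (21 * t)"] S[of t "(14 * t + 9) / (21 * t + 14)"] W[of t "(21 * t + 10) / (42 * t + 21)"]
      unfolding M_def by (simp_all add: max.commute max.left_commute)
  qed
  have M0: "M t > 0" using nz by (simp add: M_def less_max_iff_disj)
  have small: "\<exists>Y. \<forall>s. Im s > Y \<longrightarrow> norm (f s) < M t" if "(f \<longlongrightarrow> 0) (filtercomap Im at_top)" for f :: "complex \<Rightarrow> complex"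
  proof -
    have "\<forall>\<^sub>F s in filtercomap Im at_top. norm (f s) < M t"
      using that M0 by (auto simp: tendsto_iff dist_norm)
    then show ?thesis
      unfolding eventually_filtercomap_at_top_dense by blast
  qed
  obtain Y2 where Y2: "\<And>s. Im s > Y2 \<Longrightarrow> norm (f2 s) < M t" using small[OF lim(1)] by blast
  obtain Y3 where Y3: "\<And>s. Im s > Y3 \<Longrightarrow> norm (f3 s) < M t" using small[OF lim(2)] by blast
  \<comment> \<open>The 1 guarantees that points above \<open>Y\<close> lie in the half-plane and
    that the box \<open>K\<close> below is nonempty.\<close>
  define Y where "Y = max 1 (max Y2 Y3)"
  have Y: "M s < M t" if "Im s > Y" for s
  proof -
    have "norm (f4 s) = norm (f3 (s + 1))" using T[of s] that by (simp add: Y_def)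
    then show ?thesis unfolding M_def using Y2[of s] Y3[of s] Y3[of "s + 1"] that by (auto simp: Y_def M_def)
  qed
  define K where "K = cbox (Complex (- 1/2) (1/50)) (Complex (1/2) Y)"
  have K: "s \<in> K \<longleftrightarrow> \<bar>Re s\<bar> \<le> 1/2 \<and> 1/50 \<le> Im s \<and> Im s \<le> Y" for s
    by (auto simp: K_def in_cbox_complex_iff abs_le_iff)
  have Kuhp: "K \<subseteq> uhp" using K by force
  have "continuous_on K M"
  proof -
    have "continuous_on K f2" "continuous_on K f3" "continuous_on K f4"
      using hol Kuhp by (meson holomorphic_on_imp_continuous_on continuous_on_subset)+
    then show ?thesis unfolding M_def by (intro continuous_intros)
  qed
  moreover have "K \<noteq> {}"
  proof -
    have "Complex 0 (1/50) \<in> K" unfolding K by (simp add: Y_def)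
    then show ?thesis by blast
  qed
  moreover have "compact K" by (simp add: K_def compact_cbox)
  ultimately obtain w where w: "w \<in> K" "\<And>s. s \<in> K \<Longrightarrow> M s \<le> M w"
    using continuous_attains_sup[of K M] by blast
  \<comment> \<open>A reduced representative of t cannot lie above \<open>Y\<close>, where
    \<open>M\<close> is smaller than \<open>M t\<close>; so it is in \<open>K\<close>. The same
    comparison makes the maximum over \<open>K\<close> global.\<close>
  have tw: "M t \<le> M w"
  proof -
    obtain s where s: "M s = M t" "Im s \<ge> 1/50" "\<bar>Re s\<bar> \<le> 1/2" using red[OF t] by blast
    then have "s \<in> K" using Y[of s] K[of s] by (cases "Im s \<le> Y") auto
    then show ?thesis using w(2) s(1) by metis
  qed
  have max: "M s \<le> M w" if "Im s > 0" for s
  proof -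
    obtain s' where s': "M s' = M s" "Im s' \<ge> 1/50" "\<bar>Re s'\<bar> \<le> 1/2" using red[OF \<open>Im s > 0\<close>] by blast
    show ?thesis
    proof (cases "Im s' \<le> Y")
      case True
      then have "s' \<in> K" using K s' by simp
      then show ?thesis using w(2) s'(1) by metis
    next
      case False
      then show ?thesis using Y[of s'] s'(1) tw by simp
    qed
  qed
  have wu: "w \<in> uhp" using w(1) Kuhp by blast
  have contra: False if f: "f holomorphic_on uhp" "norm (f w) = M w" "\<And>s. norm (f s) \<le> M s" for f :: "complex \<Rightarrow> complex"
  proof -
    have "f constant_on uhp"
      by (rule maximum_modulus_principle[OF f(1) open_uhp connected_uhp open_uhp order.refl wu])
         (use f max in \<open>auto intro: order.trans\<close>)
    then have "f (\<i> * of_real (Y + 1)) = f w"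
      using wu unfolding constant_on_def by (auto simp: Y_def) 
    moreover have "norm (f (\<i> * of_real (Y + 1))) < M t"
      using f(3)[of "\<i> * of_real (Y + 1)"] Y[of "\<i> * of_real (Y + 1)"] by simp
    ultimately show False using f(2) tw by simp
  qed
  have "M w = norm (f2 w) \<or> M w = norm (f3 w) \<or> M w = norm (f4 w)" by (auto simp: M_def max_def)
  moreover have "norm (f2 s) \<le> M s" "norm (f3 s) \<le> M s" "norm (f4 s) \<le> M s" for s by (auto simp: M_def)
  ultimately show False
    using contra[OF hol(1)] contra[OF hol(2)] contra[OF hol(3)] by metis
qed

subsection \<open>Behaviour at the cusp\<close>

text \<open>The real power \<open>q^a\<close>; defining it through t settles the branch of all
  fractional powers.\<close>

definition nome :: "real \<Rightarrow> complex \<Rightarrow> complex" where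
  "nome a t = exp (\<i> * pi * (of_real a * t))"

lemma nome_add: "nome (a + b) t = nome a t * nome b t"
  by (simp add: nome_def distrib_right distrib_left exp_add)

lemma nome_0 [simp]: "nome 0 t = 1"
  by (simp add: nome_def)

lemma nome_nonzero [simp]: "nome a t \<noteq> 0"
  by (simp add: nome_def)

lemma nome_power: "nome a t ^ n = nome (real n * a) t"
  by (simp add: nome_def exp_of_nat_mult[symmetric] mult_ac)

lemma norm_nome: "norm (nome a t) = exp (- pi * a * Im t)"
  by (simp add: nome_def norm_exp_eq_Re)

lemma theta_nome:
  fixes k :: nat
  shows "theta3 (of_nat k * t) = theta_phi (nome 1 t ^ k)"
    and "theta2 (of_nat k * t) = 2 * nome (k / 4) t * ramanujan_psi (nome 1 t ^ (2 * k))"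
    and "eta (of_nat k * t) = nome (k / 12) t * euler_E (nome 1 t ^ (2 * k))"
    and "thetaX (of_nat k * t) = theta_phi (nome 1 t ^ (2 * k))"
    and "thetaY (of_nat k * t) = 2 * nome (k / 2) t * ramanujan_psi (nome 1 t ^ (4 * k))"
  unfolding nome_power thetaX_def thetaY_def theta3_def theta2_def eta_def
  unfolding nome_def by (simp_all add: mult_ac)

lemma tendsto_nome:
  assumes "b > 0"
  shows "(nome b \<longlongrightarrow> 0) (filtercomap Im at_top)"
proof (rule Lim_null_comparison)
  have "((\<lambda>y. exp (- pi * b * y)) \<longlongrightarrow> 0) at_top"
    using assms by real_asymp
  then have "((\<lambda>t. exp (- pi * b * Im t)) \<longlongrightarrow> 0) (filtercomap Im at_top)"
    by (rule filterlim_compose) (rule filterlim_filtercomap)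
  then show "((\<lambda>t. exp (- pi * b * Im t)) \<longlongrightarrow> 0) (filtercomap Im at_top)" .
qed (simp add: norm_nome)

lemma cusp_limit:
  assumes h: "isCont h 0" and b: "b > 0"
    and f: "\<And>t. Im t > 0 \<Longrightarrow> f t = nome b t * h (nome 1 t)"
  shows "(f \<longlongrightarrow> 0) (filtercomap Im at_top)"
proof -
  have "((\<lambda>t. h (nome 1 t)) \<longlongrightarrow> h 0) (filtercomap Im at_top)"
    using isCont_tendsto_compose[OF h] tendsto_nome[of 1] by simp
  then have "((\<lambda>t. nome b t * h (nome 1 t)) \<longlongrightarrow> 0 * h 0) (filtercomap Im at_top)"
    by (intro tendsto_mult tendsto_nome b)
  moreover have "\<forall>\<^sub>F t in filtercomap Im at_top. nome b t * h (nome 1 t) = f t"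
    unfolding eventually_filtercomap_at_top_dense by (intro exI[of _ 0]) (simp add: f)
  ultimately show ?thesis by (simp add: tendsto_cong)
qed

lemma holomorphic_divide_variable:
  assumes D: "D holomorphic_on ball 0 1" "D 0 = 0"
  obtains g where "g holomorphic_on ball 0 1" "\<And>q. D q = q * g q" "g 0 = deriv D 0"
proof
  define g where "g q = (if q = 0 then deriv D 0 else (D q - D 0) / (q - 0))" for q
  show "g holomorphic_on ball 0 1"
    unfolding g_def by (rule pole_lemma[OF D(1)]) (simp add: interior_open)
  show "D q = q * g q" for q using D(2) by (simp add: g_def)
  show "g 0 = deriv D 0" by (simp add: g_def)
qed

lemma holomorphic_divide_square:
  assumes D: "D holomorphic_on ball 0 1" "D 0 = 0" "(D has_field_derivative 0) (at 0)"
  obtains g where "g holomorphic_on ball 0 1" "\<And>q. D q = q\<^sup>2 * g q"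
proof -
  obtain g where g: "g holomorphic_on ball 0 1" "\<And>q. D q = q * g q" "g 0 = deriv D 0"
    using holomorphic_divide_variable[OF D(1,2)] by blast
  have "g 0 = 0" using g(3) DERIV_imp_deriv[OF D(3)] by simp
  then obtain h where "h holomorphic_on ball 0 1" "\<And>q. g q = q * h q"
    using holomorphic_divide_variable[OF g(1)] by metis
  then show thesis using that g(2) by (metis mult.assoc power2_eq_square)
qed

lemma holomorphic_power_arg:
  assumes "f holomorphic_on ball 0 1" "k > 0"
  shows "(\<lambda>q. f (q ^ k)) holomorphic_on ball 0 1"
proof -
  have "(f \<circ> (\<lambda>q. q ^ k)) holomorphic_on ball 0 1"
    by (rule holomorphic_on_compose_gen[OF _ assms(1)])
       (use norm_power_less_1 assms(2) in \<open>auto intro!: holomorphic_intros\<close>)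
  then show ?thesis by (simp add: o_def)
qed

lemmas holomorphic_q = holomorphic_power_arg[OF holomorphic_theta_phi] holomorphic_power_arg[OF holomorphic_psi]
  holomorphic_power_arg[OF holomorphic_euler_E]

lemma holomorphic_isCont_0: "f holomorphic_on ball 0 1 \<Longrightarrow> isCont f (0::complex)"
  by (meson centre_in_ball continuous_on_eq_continuous_at holomorphic_on_imp_continuous_on open_ball zero_less_one)

text \<open>The Taylor series of \<open>f (q ^ k)\<close> has no linear term when k is at least 2,
  so most factors contribute nothing to the first-order coefficients at the cusp.\<close>

lemma DERIV_power_arg_0:
  assumes "f holomorphic_on ball 0 1" "k \<ge> 2"
  shows "((\<lambda>q. f (q ^ k)) has_field_derivative 0) (at (0::complex))"
proof -
  have k: "(0::complex) ^ k = 0" "(0::complex) ^ (k - 1) = 0" using assms(2) by (auto simp: power_0_left)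
  have "(f has_field_derivative deriv f 0) (at 0)"
    using assms(1) by (intro holomorphic_derivI[of f "ball 0 1"]) auto
  then have f: "(f has_field_derivative deriv f 0) (at (0 ^ k))" unfolding k(1) .
  have "((\<lambda>q::complex. q ^ k) has_field_derivative of_nat k * 0 ^ (k - 1)) (at 0)"
    using DERIV_pow[of k 0] by (auto intro!: derivative_eq_intros)
  from DERIV_chain2[OF f this] show ?thesis unfolding k(2) by simp
qed

lemma theta_phi_0 [simp]: "theta_phi 0 = 1"
proof -
  have "(0::complex) ^ (Suc n)\<^sup>2 = 0" for n by (simp add: power2_eq_square)
  then show ?thesis unfolding theta_phi_def by (simp only:) simp
qed

lemma psi_0 [simp]: "ramanujan_psi 0 = 1"
proof -
  have "(0::complex) ^ (n * (n + 1) div 2) = 0" if "n \<noteq> 0" for n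
  proof -
    have "2 \<le> n * (n + 1)" using that by (cases n) auto
    then have "n * (n + 1) div 2 > 0" by linarith
    then show ?thesis by (simp only: power_0_left) simp
  qed
  then have "(\<Sum>n. (0::complex) ^ (n * (n + 1) div 2)) = (\<Sum>n\<in>{0}. 0 ^ (n * (n + 1) div 2))"
    by (intro suminf_finite) auto
  then show ?thesis unfolding ramanujan_psi_def by simp
qed

lemma euler_E_0 [simp]: "euler_E 0 = 1"
  by (simp add: euler_E_def)

text \<open>The power series of (phi(q) - 1) / (2q), with the removable singularity at 0 filled
  in.\<close>

definition phi_tail :: "complex \<Rightarrow> complex" where
  "phi_tail q = (\<Sum>n. q ^ ((Suc n)\<^sup>2 - 1))"

lemma holomorphic_phi_tail: "phi_tail holomorphic_on ball 0 1"
  unfolding phi_tail_def[abs_def] by (rule holomorphic_power_sum) (simp add: power2_eq_square)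

lemma phi_tail_0 [simp]: "phi_tail 0 = 1"
proof -
  have "(0::complex) ^ ((Suc n)\<^sup>2 - 1) = 0" if "n \<noteq> 0" for n
    using that by (simp add: power_0_left power2_eq_square)
  then have "(\<Sum>n. (0::complex) ^ ((Suc n)\<^sup>2 - 1)) = (\<Sum>n\<in>{0}. 0 ^ ((Suc n)\<^sup>2 - 1))"
    by (intro suminf_finite) auto
  then show ?thesis unfolding phi_tail_def by simp
qed

lemma theta_phi_tail:
  assumes "norm q < 1"
  shows "theta_phi q = 1 + 2 * q * phi_tail q"
proof -
  have "summable (\<lambda>n. norm (q ^ ((Suc n)\<^sup>2 - 1)))"
    by (rule norm_summable_power[OF assms]) (simp add: power2_eq_square)
  then have "(\<Sum>n. q * q ^ ((Suc n)\<^sup>2 - 1)) = q * phi_tail q"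
    unfolding phi_tail_def by (intro suminf_mult) (rule summable_norm_cancel)
  moreover have "q * q ^ ((Suc n)\<^sup>2 - 1) = q ^ (Suc n)\<^sup>2" for n
  proof -
    have "Suc ((Suc n)\<^sup>2 - 1) = (Suc n)\<^sup>2" by (simp add: power2_eq_square)
    then show ?thesis by (metis power_Suc)
  qed
  ultimately show ?thesis by (simp add: theta_phi_def)
qed

lemma DERIV_theta_phi_0: "(theta_phi has_field_derivative 2) (at 0)"
proof -
  have "(phi_tail has_field_derivative deriv phi_tail 0) (at 0)"
    using holomorphic_phi_tail by (intro holomorphic_derivI[of _ "ball 0 1"]) auto
  then have "((\<lambda>q. 1 + 2 * q * phi_tail q) has_field_derivative 2) (at 0)"
    by (auto intro!: derivative_eq_intros)
  then show ?thesis
    by (rule has_field_derivative_transform_within_open[of _ _ _ "ball 0 1"]) (auto simp: theta_phi_tail)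
qed

text \<open>P, Q, A, B are the forms (1,0,21), (3,0,7), (2,2,11), (5,4,5), and U, V the eta pairs
  without their fractional powers, all as functions on the disc, where orders of vanishing at 0 can
  be read off.\<close>

definition qP :: "complex \<Rightarrow> complex" where "qP q = theta_phi q * theta_phi (q ^ 21)"
definition qQ :: "complex \<Rightarrow> complex" where "qQ q = theta_phi (q ^ 3) * theta_phi (q ^ 7)"
definition qA :: "complex \<Rightarrow> complex" where
  "qA q = theta_phi (q ^ 2) * theta_phi (q ^ 42) + 4 * q ^ 11 * ramanujan_psi (q ^ 4) * ramanujan_psi (q ^ 84)"
definition qB :: "complex \<Rightarrow> complex" where
  "qB q = theta_phi (q ^ 14) * theta_phi (q ^ 6) + 4 * q ^ 5 * ramanujan_psi (q ^ 28) * ramanujan_psi (q ^ 12)"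
definition qU :: "complex \<Rightarrow> complex" where "qU q = euler_E (q ^ 2) * euler_E (q ^ 42)"
definition qV :: "complex \<Rightarrow> complex" where "qV q = euler_E (q ^ 6) * euler_E (q ^ 14)"

lemmas q_defs = qP_def qQ_def qA_def qB_def qU_def qV_def

lemma holomorphic_q_forms:
  "qP holomorphic_on ball 0 1" "qQ holomorphic_on ball 0 1" "qA holomorphic_on ball 0 1" "qB holomorphic_on ball 0 1"
  "qU holomorphic_on ball 0 1" "qV holomorphic_on ball 0 1"
  unfolding q_defs[abs_def] by (intro holomorphic_intros holomorphic_q holomorphic_theta_phi; simp)+

lemma q_forms_0: "qP 0 = 1" "qQ 0 = 1" "qA 0 = 1" "qB 0 = 1" "qU 0 = 1" "qV 0 = 1"
  by (simp_all add: q_defs)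

lemma qUV_nonzero: "norm q < 1 \<Longrightarrow> qU q \<noteq> 0" "norm q < 1 \<Longrightarrow> qV q \<noteq> 0"
  unfolding q_defs by (simp_all add: euler_E_nonzero norm_power_less_1)

lemma DERIV_q_forms_0:
  "(qP has_field_derivative 2) (at 0)" "(qQ has_field_derivative 0) (at 0)"
  "(qB has_field_derivative 0) (at 0)" "(qU has_field_derivative 0) (at 0)" "(qV has_field_derivative 0) (at 0)"
proof -
  note p = DERIV_power_arg_0[OF holomorphic_theta_phi] and e = DERIV_power_arg_0[OF holomorphic_euler_E]
    and r = DERIV_power_arg_0[OF holomorphic_psi]
  show "(qP has_field_derivative 2) (at 0)"
    unfolding qP_def[abs_def] using DERIV_mult[OF DERIV_theta_phi_0 p[of 21]] by simp
  show "(qQ has_field_derivative 0) (at 0)"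
    unfolding qQ_def[abs_def] using DERIV_mult[OF p[of 3] p[of 7]] by simp
  show "(qU has_field_derivative 0) (at 0)"
    unfolding qU_def[abs_def] using DERIV_mult[OF e[of 2] e[of 42]] by simp
  show "(qV has_field_derivative 0) (at 0)"
    unfolding qV_def[abs_def] using DERIV_mult[OF e[of 6] e[of 14]] by simp
  have 1: "((\<lambda>q. theta_phi (q ^ 14) * theta_phi (q ^ 6)) has_field_derivative 0) (at 0)"
    using DERIV_mult[OF p[of 14] p[of 6]] by simp
  have 2: "((\<lambda>q::complex. 4 * q ^ 5) has_field_derivative 0) (at 0)"
    by (auto intro!: derivative_eq_intros)
  have 3: "((\<lambda>q. 4 * q ^ 5 * ramanujan_psi (q ^ 28) * ramanujan_psi (q ^ 12)) has_field_derivative 0) (at 0)"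
    using DERIV_mult[OF DERIV_mult[OF 2 r[of 28]] r[of 12]] by simp
  show "(qB has_field_derivative 0) (at 0)"
    unfolding qB_def[abs_def] using DERIV_add[OF 1 3] by simp
qed

lemma pairs_nome:
  shows "pair1 theta3 t = qP (nome 1 t)" "pair3 theta3 t = qQ (nome 1 t)"
    "A3 t = qA (nome 1 t)" "B3 t = qB (nome 1 t)"
    "pair1 eta t = nome (11 / 6) t * qU (nome 1 t)" "pair3 eta t = nome (5 / 6) t * qV (nome 1 t)"
proof -
  note n1 = theta_nome[of 1 t, simplified] and n3 = theta_nome[of 3 t, simplified]
    and n7 = theta_nome[of 7 t, simplified] and n21 = theta_nome[of 21 t, simplified]
  have e: "nome (1/12) t * nome (21/12) t = nome (11/6) t" "nome (3/12) t * nome (7/12) t = nome (5/6) t"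
      "nome (1/2) t * nome (21/2) t = nome 1 t ^ 11" "nome (3/2) t * nome (7/2) t = nome 1 t ^ 5"
    unfolding nome_add[symmetric] nome_power by simp_all
  show "pair1 theta3 t = qP (nome 1 t)" "pair3 theta3 t = qQ (nome 1 t)"
    unfolding pair_defs q_defs n1 n3 n7 n21 by simp_all
  show "pair1 eta t = nome (11 / 6) t * qU (nome 1 t)" "pair3 eta t = nome (5 / 6) t * qV (nome 1 t)"
    unfolding pair_defs q_defs n1 n3 n7 n21 e[symmetric] by simp_all
  show "A3 t = qA (nome 1 t)" "B3 t = qB (nome 1 t)"
    unfolding pair_defs q_defs n1 n3 n7 n21 e[symmetric] by simp_all
qed

text \<open>Clearing denominators leaves D over \<open>q^(11/6)\<close>. Since P - B = 2q + ... and
  q(Q + A) = 2q + ..., D vanishes to order 2 and \<open>q^(1/6)\<close> remains.\<close>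

lemma gapI3_cusp: "(gapI3 \<longlongrightarrow> 0) (filtercomap Im at_top)"
proof -
  define D where "D q = (qP q - qB q) * qV q - q * ((qQ q + qA q) * qU q)" for q
  have hol: "D holomorphic_on ball 0 1"
    unfolding D_def[abs_def] by (intro holomorphic_intros holomorphic_q_forms)
  have D0: "D 0 = 0" by (simp add: D_def q_forms_0)
  have "(qA has_field_derivative deriv qA 0) (at 0)"
    using holomorphic_q_forms(3) by (intro holomorphic_derivI[of _ "ball 0 1"]) auto
  then have "(D has_field_derivative 0) (at 0)"
    unfolding D_def[abs_def]
    by (auto intro!: derivative_eq_intros DERIV_q_forms_0 simp: q_forms_0)
  then obtain g where g: "g holomorphic_on ball 0 1" "\<And>q. D q = q\<^sup>2 * g q"
    using holomorphic_divide_square[OF hol D0] by blast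
  show ?thesis
  proof (rule cusp_limit)
    show "isCont (\<lambda>q. g q / (qU q * qV q)) 0"
      using g(1) holomorphic_q_forms by (intro continuous_intros holomorphic_isCont_0) (auto simp: q_forms_0)
    show "(1/6 :: real) > 0" by simp
    fix t :: complex assume t: "Im t > 0"
    define q where "q = nome 1 t"
    define N where "N = nome (11/6) t"
    have q: "norm q < 1" using t by (simp add: q_def norm_nome)
    note nz = qUV_nonzero[OF q]
    have n5: "nome (5/6) t * q = N" "N * nome (1/6) t = q\<^sup>2"
      unfolding N_def q_def nome_add[symmetric] nome_power by simp_all
    have nzN: "N \<noteq> 0" "q \<noteq> 0" by (simp_all add: N_def q_def)
    then have v: "nome (5/6) t = N / q" using n5(1) by (simp add: field_simps)
    have "gapI3 t = D q / (N * (qU q * qV q))"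
      unfolding gapI3_def combI_def pairs_nome q_def[symmetric] N_def[symmetric] v D_def
      using nz nzN by (simp add: field_simps)
    also have "\<dots> = (N * nome (1/6) t) * g q / (N * (qU q * qV q))"
      unfolding g(2) n5(2) by simp
    also have "\<dots> = nome (1/6) t * (g q / (qU q * qV q))"
      using nzN by simp
    finally show "gapI3 t = nome (1/6) t * (g (nome 1 t) / (qU (nome 1 t) * qV (nome 1 t)))"
      by (simp add: q_def)
  qed
qed

text \<open>Q - A = \<open>q^2\<close> K with K = -2 + 2q + ...; hence D has constant term -2 + 2 =
  0 and linear coefficient 2 - 4 + 2 = 0. The exponent left is 2 + 2 - 11/3 = 1/3.\<close>

lemma gapII3_cusp: "(gapII3 \<longlongrightarrow> 0) (filtercomap Im at_top)"
proof -
  define K where "K q = 2 * q * phi_tail (q ^ 3) + 2 * q ^ 5 * (phi_tail (q ^ 7) * theta_phi (q ^ 3)) - 2 * phi_tail (q ^ 2)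
     - 2 * q ^ 40 * (phi_tail (q ^ 42) * theta_phi (q ^ 2)) - 4 * q ^ 9 * (ramanujan_psi (q ^ 4) * ramanujan_psi (q ^ 84))" for q
  define D where "D q = K q * (qP q * (qV q)\<^sup>2) + (qP q + qB q) * (qQ q * (qU q)\<^sup>2)" for q
  have QA: "qQ q - qA q = q\<^sup>2 * K q" if q: "norm q < 1" for q
  proof -
    have e: "theta_phi (q ^ 3) = 1 + 2 * q ^ 3 * phi_tail (q ^ 3)" "theta_phi (q ^ 7) = 1 + 2 * q ^ 7 * phi_tail (q ^ 7)"
      "theta_phi (q ^ 2) = 1 + 2 * q ^ 2 * phi_tail (q ^ 2)" "theta_phi (q ^ 42) = 1 + 2 * q ^ 42 * phi_tail (q ^ 42)"
      using q by (simp_all add: theta_phi_tail norm_power_less_1)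
    have p: "q ^ 3 = q\<^sup>2 * q" "q ^ 7 = q\<^sup>2 * q ^ 5" "q ^ 42 = q\<^sup>2 * q ^ 40" "q ^ 11 = q\<^sup>2 * q ^ 9"
      by (simp_all flip: power_add power_Suc power_Suc2)
    have alg: "(1 + 2 * a * x) * (1 + 2 * b * y) - ((1 + 2 * q\<^sup>2 * z) * (1 + 2 * c * w) + 4 * d * u * v) =
        2 * a * x + 2 * b * (y * (1 + 2 * a * x)) - 2 * q\<^sup>2 * z - 2 * c * (w * (1 + 2 * q\<^sup>2 * z)) - 4 * d * (u * v)"
      for a b c d x y z w u v by (simp add: algebra_simps)
    have gen: "2 * (q\<^sup>2 * q) * x + 2 * (q\<^sup>2 * a) * y - 2 * q\<^sup>2 * z - 2 * (q\<^sup>2 * b) * w - 4 * (q\<^sup>2 * c) * u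
        = q\<^sup>2 * (2 * q * x + 2 * a * y - 2 * z - 2 * b * w - 4 * c * u)" for a b c x y z w u
      by (simp add: algebra_simps)
    define x3 x7 x2 x42 y4 y84 where "x3 = phi_tail (q ^ 3)" and "x7 = phi_tail (q ^ 7)" and "x2 = phi_tail (q ^ 2)"
      and "x42 = phi_tail (q ^ 42)" and "y4 = ramanujan_psi (q ^ 4)" and "y84 = ramanujan_psi (q ^ 84)"
    show ?thesis
      unfolding qQ_def qA_def K_def e alg
      unfolding x3_def[symmetric] x7_def[symmetric] x2_def[symmetric] x42_def[symmetric] y4_def[symmetric] y84_def[symmetric]
      unfolding p by (rule gen)
  qed
  have hK: "K holomorphic_on ball 0 1"
    unfolding K_def[abs_def] by (intro holomorphic_intros holomorphic_q holomorphic_power_arg[OF holomorphic_phi_tail]) simp_all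
  have hol: "D holomorphic_on ball 0 1"
    unfolding D_def[abs_def] by (intro holomorphic_intros holomorphic_q_forms hK)
  have K0: "K 0 = - 2" by (simp add: K_def)
  have D0: "D 0 = 0" by (simp add: D_def K0 q_forms_0)
  have dK: "(K has_field_derivative 2) (at 0)"
    unfolding K_def[abs_def]
    by (rule derivative_eq_intros DERIV_power_arg_0 holomorphic_phi_tail holomorphic_theta_phi holomorphic_psi refl | simp)+
  have "(D has_field_derivative 0) (at 0)"
    unfolding D_def[abs_def]
    by (auto intro!: derivative_eq_intros DERIV_q_forms_0 dK simp: q_forms_0 K0)
  then obtain g where g: "g holomorphic_on ball 0 1" "\<And>q. D q = q\<^sup>2 * g q"
    using holomorphic_divide_square[OF hol D0] by blast
  show ?thesis
  proof (rule cusp_limit)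
    show "isCont (\<lambda>q. g q / ((qU q)\<^sup>2 * (qV q)\<^sup>2)) 0"
      using g(1) holomorphic_q_forms by (intro continuous_intros holomorphic_isCont_0) (auto simp: q_forms_0)
    show "(1/3 :: real) > 0" by simp
    fix t :: complex assume t: "Im t > 0"
    define q where "q = nome 1 t"
    define N where "N = nome (11/6) t"
    have q: "norm q < 1" using t by (simp add: q_def norm_nome)
    note nz = qUV_nonzero[OF q]
    have n5: "nome (5/6) t * q = N" "N\<^sup>2 * nome (1/3) t = q ^ 4"
      unfolding N_def q_def nome_power nome_add[symmetric] by simp_all
    have nzN: "N \<noteq> 0" "q \<noteq> 0" by (simp_all add: N_def q_def)
    then have v: "nome (5/6) t = N / q" using n5(1) by (simp add: field_simps)
    have alg: "q\<^sup>2 * k * P / (N * U)\<^sup>2 + PB * Q / (N / q * V)\<^sup>2 = q\<^sup>2 * (k * (P * V\<^sup>2) + PB * (Q * U\<^sup>2)) / (N\<^sup>2 * (U\<^sup>2 * V\<^sup>2))"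
      if "U \<noteq> 0" "V \<noteq> 0" for k P U V PB Q
      using that nzN by (simp add: field_simps)
    have "gapII3 t = q\<^sup>2 * D q / (N\<^sup>2 * ((qU q)\<^sup>2 * (qV q)\<^sup>2))"
      unfolding gapII3_def combII_def pairs_nome q_def[symmetric] N_def[symmetric] v D_def QA[OF q] alg[OF nz] ..
    also have "q\<^sup>2 * D q = (N\<^sup>2 * nome (1/3) t) * g q"
      unfolding g(2) n5(2) by (simp add: mult.assoc[symmetric] flip: power_add)
    also have "(N\<^sup>2 * nome (1/3) t) * g q / (N\<^sup>2 * ((qU q)\<^sup>2 * (qV q)\<^sup>2)) = nome (1/3) t * (g q / ((qU q)\<^sup>2 * (qV q)\<^sup>2))"
      using nzN by simp
    finally show "gapII3 t = nome (1/3) t * (g (nome 1 t) / ((qU (nome 1 t))\<^sup>2 * (qV (nome 1 t))\<^sup>2))"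
      by (simp add: q_def)
  qed
qed

text \<open>Power series of the index 2 conjugates after removal of the common factor
  \<open>q^(1/2)\<close> and the further integral powers recorded in
  \<open>pairs2_nome\<close>.\<close>

definition psi_pair1 where "psi_pair1 q = 4 * (ramanujan_psi (q ^ 2) * ramanujan_psi (q ^ 42))"
definition psi_pair3 where "psi_pair3 q = 4 * (ramanujan_psi (q ^ 6) * ramanujan_psi (q ^ 14))"
definition mixed_series1 where "mixed_series1 q = 2 * q ^ 10 * (theta_phi (q ^ 2) * ramanujan_psi (q ^ 84)) + 2 * (ramanujan_psi (q ^ 4) * theta_phi (q ^ 42))"
definition mixed_series3 where "mixed_series3 q = 2 * q ^ 2 * (theta_phi (q ^ 6) * ramanujan_psi (q ^ 28)) + 2 * (ramanujan_psi (q ^ 12) * theta_phi (q ^ 14))"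

lemmas theta2_series_defs = psi_pair1_def psi_pair3_def mixed_series1_def mixed_series3_def

lemma holomorphic_theta2_series: "psi_pair1 holomorphic_on ball 0 1" "psi_pair3 holomorphic_on ball 0 1" "mixed_series1 holomorphic_on ball 0 1" "mixed_series3 holomorphic_on ball 0 1"
  unfolding theta2_series_defs[abs_def] by (intro holomorphic_intros holomorphic_q; simp)+

lemma theta2_series_0: "psi_pair1 0 = 4" "psi_pair3 0 = 4" "mixed_series1 0 = 2" "mixed_series3 0 = 2"
  by (simp_all add: theta2_series_defs)

lemma pairs2_nome:
  fixes t :: complex
  defines "q \<equiv> nome 1 t" and "h \<equiv> nome (1/2) t"
  shows "pair1 theta2 t = h * (q ^ 5 * psi_pair1 q)" "pair3 theta2 t = h * (q ^ 2 * psi_pair3 q)"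
    "mixed1 t = h * mixed_series1 q" "mixed3 t = h * (q * mixed_series3 q)"
proof -
  note n1 = theta_nome[of 1 t, simplified, folded q_def] and n3 = theta_nome[of 3 t, simplified, folded q_def]
    and n7 = theta_nome[of 7 t, simplified, folded q_def] and n21 = theta_nome[of 21 t, simplified, folded q_def]
  have e: "nome (1/4) t * nome (21/4) t = h * q ^ 5" "nome (3/4) t * nome (7/4) t = h * q ^ 2"
      and f: "nome (21/2) t = h * q ^ 10" "nome (7/2) t = h * q ^ 3" "nome (3/2) t = h * q"
    unfolding h_def q_def nome_power nome_add[symmetric] by simp_all
  have "pair1 theta2 t = (nome (1/4) t * nome (21/4) t) * psi_pair1 q" "pair3 theta2 t = (nome (3/4) t * nome (7/4) t) * psi_pair3 q"
    unfolding pair_defs theta2_series_defs n1 n3 n7 n21 by simp_all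
  then show "pair1 theta2 t = h * (q ^ 5 * psi_pair1 q)" "pair3 theta2 t = h * (q ^ 2 * psi_pair3 q)"
    unfolding e by simp_all
  show "mixed1 t = h * mixed_series1 q" 
    unfolding pair_defs theta2_series_defs n1 n21 f h_def[symmetric] by (simp add: algebra_simps)
  show "mixed3 t = h * (q * mixed_series3 q)"
    unfolding pair_defs theta2_series_defs n3 n7 f by (simp add: algebra_simps eval_nat_numeral)
qed

text \<open>The leading terms \<open>-2 q^(-1/3)\<close>, from \<open>mixed3\<close>, and
  \<open>2 q^(-1/3)\<close>, from \<open>mixed1\<close>, cancel; the next order is
  \<open>q^(2/3)\<close>.\<close>

lemma gapI2_cusp: "(gapI2 \<longlongrightarrow> 0) (filtercomap Im at_top)"
proof -
  define D where "D q = (q ^ 4 * psi_pair1 q - mixed_series3 q) * qV q + (q ^ 2 * psi_pair3 q + mixed_series1 q) * qU q" for q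
  have hol: "D holomorphic_on ball 0 1"
    unfolding D_def[abs_def] by (intro holomorphic_intros holomorphic_q_forms holomorphic_theta2_series)
  have D0: "D 0 = 0" by (simp add: D_def q_forms_0 theta2_series_0)
  obtain g where g: "g holomorphic_on ball 0 1" "\<And>q. D q = q * g q"
    using holomorphic_divide_variable[OF hol D0] by metis
  show ?thesis
  proof (rule cusp_limit)
    show "isCont (\<lambda>q. g q / (qU q * qV q)) 0"
      using g(1) holomorphic_q_forms by (intro continuous_intros holomorphic_isCont_0) (auto simp: q_forms_0)
    show "(2/3 :: real) > 0" by simp
    fix t :: complex assume t: "Im t > 0"
    define q where "q = nome 1 t"
    define N where "N = nome (11/6) t"
    define h where "h = nome (1/2) t"
    have q: "norm q < 1" using t by (simp add: q_def norm_nome)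
    note nz = qUV_nonzero[OF q]
    have n5: "nome (5/6) t * q = N" "N * nome (2/3) t = h * q\<^sup>2"
      unfolding N_def q_def h_def nome_power nome_add[symmetric] by simp_all
    have nzN: "N \<noteq> 0" "q \<noteq> 0" by (simp_all add: N_def q_def)
    then have v: "nome (5/6) t = N / q" using n5(1) by (simp add: field_simps)
    have alg: "(h * (q ^ 5 * a) - h * (q * b)) / (N * U) + 1 * ((h * (q ^ 2 * c) + h * d) / (N / q * V))
       = h * q * ((q ^ 4 * a - b) * V + (q ^ 2 * c + d) * U) / (N * (U * V))" if "U \<noteq> 0" "V \<noteq> 0" for a b c d U V
    proof -
      have "h * (q ^ 5 * a) - h * (q * b) = h * q * (q ^ 4 * a - b)" by (simp add: algebra_simps eval_nat_numeral)
      moreover have "(h * (q ^ 2 * c) + h * d) / (N / q * V) = h * q * (q ^ 2 * c + d) / (N * V)"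
        using nzN by (simp add: field_simps)
      moreover have "X / (N * U) + Y / (N * V) = (X * V + Y * U) / (N * (U * V))" for X Y
        using that nzN by (simp add: field_simps)
      ultimately show ?thesis by (simp only: mult_1) (simp add: algebra_simps)
    qed
    have "gapI2 t = h * q * D q / (N * (qU q * qV q))"
      unfolding gapI2_def combI_def pairs_nome pairs2_nome q_def[symmetric] N_def[symmetric] h_def[symmetric] v D_def alg[OF nz] ..
    also have "h * q * D q = (N * nome (2/3) t) * g q"
      unfolding g(2) n5(2) by (simp add: power2_eq_square)
    also have "(N * nome (2/3) t) * g q / (N * (qU q * qV q)) = nome (2/3) t * (g q / (qU q * qV q))"
      using nzN by simp
    finally show "gapI2 t = nome (2/3) t * (g (nome 1 t) / (qU (nome 1 t) * qV (nome 1 t)))"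
      by (simp add: q_def)
  qed
qed

text \<open>No cancellation occurs here: both summands already have the factor
  \<open>q^(7/3)\<close>.\<close>

lemma gapII2_cusp: "(gapII2 \<longlongrightarrow> 0) (filtercomap Im at_top)"
proof -
  define H where "H q = (q ^ 2 * psi_pair3 q - mixed_series1 q) * psi_pair1 q / (qU q)\<^sup>2 + (q ^ 4 * psi_pair1 q + mixed_series3 q) * psi_pair3 q / (qV q)\<^sup>2" for q
  show ?thesis
  proof (rule cusp_limit)
    show "isCont H 0"
      unfolding H_def[abs_def] using holomorphic_q_forms holomorphic_theta2_series
      by (intro continuous_intros holomorphic_isCont_0) (auto simp: q_forms_0)
    show "(7/3 :: real) > 0" by simp
    fix t :: complex assume t: "Im t > 0"
    define q where "q = nome 1 t"
    define N where "N = nome (11/6) t"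
    define h where "h = nome (1/2) t"
    have q: "norm q < 1" using t by (simp add: q_def norm_nome)
    note nz = qUV_nonzero[OF q]
    have n5: "nome (5/6) t * q = N" "N\<^sup>2 * nome (7/3) t = h\<^sup>2 * q ^ 5"
      unfolding N_def q_def h_def nome_power nome_add[symmetric] by simp_all
    have nzN: "N \<noteq> 0" "q \<noteq> 0" by (simp_all add: N_def q_def)
    then have v: "nome (5/6) t = N / q" using n5(1) by (simp add: field_simps)
    have alg: "(h * (q ^ 2 * c) - h * d) * (h * (q ^ 5 * a)) / (N * U)\<^sup>2 + (h * (q ^ 5 * a) + h * (q * b)) * (h * (q ^ 2 * c)) / (N / q * V)\<^sup>2
       = h\<^sup>2 * q ^ 5 / N\<^sup>2 * ((q ^ 2 * c - d) * a / U\<^sup>2 + (q ^ 4 * a + b) * c / V\<^sup>2)" if "U \<noteq> 0" "V \<noteq> 0" for a b c d U V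
    proof -
      have "(h * (q ^ 2 * c) - h * d) * (h * (q ^ 5 * a)) / (N * U)\<^sup>2 = h\<^sup>2 * q ^ 5 / N\<^sup>2 * ((q ^ 2 * c - d) * a / U\<^sup>2)"
        by (simp add: power_mult_distrib power2_eq_square algebra_simps)
      moreover have "(h * (q ^ 5 * a) + h * (q * b)) * (h * (q ^ 2 * c)) / (N / q * V)\<^sup>2 = h\<^sup>2 * q ^ 5 / N\<^sup>2 * ((q ^ 4 * a + b) * c / V\<^sup>2)"
        using nzN that by (simp add: field_simps eval_nat_numeral)
      ultimately show ?thesis by (simp only: distrib_left)
    qed
    have "gapII2 t = h\<^sup>2 * q ^ 5 / N\<^sup>2 * H q"
      unfolding gapII2_def combII_def pairs_nome pairs2_nome q_def[symmetric] N_def[symmetric] h_def[symmetric] v H_def alg[OF nz] ..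
    also have "h\<^sup>2 * q ^ 5 / N\<^sup>2 = nome (7/3) t" unfolding n5(2)[symmetric] using nzN by simp
    finally show "gapII2 t = nome (7/3) t * H (nome 1 t)" by (simp add: q_def)
  qed
qed

section \<open>Vanishing of the gaps and return to q-series\<close>

lemma holomorphic_scale_arg:
  assumes "f holomorphic_on uhp" "k > 0"
  shows "(\<lambda>t. f (of_real k * t)) holomorphic_on uhp"
proof -
  have "(f \<circ> (\<lambda>t. of_real k * t)) holomorphic_on uhp"
    by (rule holomorphic_on_compose_gen[OF _ assms(1)]) (use assms(2) in \<open>auto intro!: holomorphic_intros\<close>)
  then show ?thesis by (simp add: o_def)
qed

lemma holomorphic_pairs:
  assumes "f holomorphic_on uhp"
  shows "pair1 f holomorphic_on uhp" "pair3 f holomorphic_on uhp"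
  unfolding pair1_def[abs_def] pair3_def[abs_def]
  using holomorphic_scale_arg[OF assms, of 21] holomorphic_scale_arg[OF assms, of 3] holomorphic_scale_arg[OF assms, of 7] assms
  by (auto intro!: holomorphic_intros)

lemma holomorphic_thetaXY: "thetaX holomorphic_on uhp" "thetaY holomorphic_on uhp"
  unfolding thetaX_def[abs_def] thetaY_def[abs_def]
  using holomorphic_scale_arg[OF holomorphic_theta(1), of 2] holomorphic_scale_arg[OF holomorphic_theta(3), of 2] by simp_all

lemma holomorphic_mixed: "mixed1 holomorphic_on uhp" "mixed3 holomorphic_on uhp"
  unfolding mixed1_def[abs_def] mixed3_def[abs_def]
  using holomorphic_scale_arg[OF holomorphic_thetaXY(1), of 21] holomorphic_scale_arg[OF holomorphic_thetaXY(1), of 3]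
    holomorphic_scale_arg[OF holomorphic_thetaXY(1), of 7] holomorphic_scale_arg[OF holomorphic_thetaXY(2), of 21]
    holomorphic_scale_arg[OF holomorphic_thetaXY(2), of 3] holomorphic_scale_arg[OF holomorphic_thetaXY(2), of 7]
    holomorphic_thetaXY
  by (auto intro!: holomorphic_intros)

lemma pair_eta_nonzero: "Im t > 0 \<Longrightarrow> pair1 eta t \<noteq> 0" "Im t > 0 \<Longrightarrow> pair3 eta t \<noteq> 0"
  by (simp_all add: pair1_def pair3_def eta_nonzero)

lemma holomorphic_gap:
  "gapI3 holomorphic_on uhp" "gapI4 holomorphic_on uhp" "gapI2 holomorphic_on uhp"
  "gapII3 holomorphic_on uhp" "gapII4 holomorphic_on uhp" "gapII2 holomorphic_on uhp"
  unfolding gap_defs[abs_def] combI_def combII_def A3_def A4_def B3_def B4_def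
  by (intro holomorphic_intros holomorphic_pairs holomorphic_theta holomorphic_thetaXY holomorphic_mixed;
      simp add: pair_eta_nonzero)+

lemma gapI3_zero: "Im t > 0 \<Longrightarrow> gapI3 t = 0"
proof (rule modular_vanishing[of gapI2 gapI3 gapI4])
  show "norm (gapI3 u) = norm (gapI3 t) \<and> norm (gapI4 u) = norm (gapI2 t) \<and> norm (gapI2 u) = norm (gapI4 t)"
    if "Im t > 0" "u = - 1 / (21 * t) \<or> u = (14 * t + 9) / (21 * t + 14)" for t u
    using that gap_S[OF that(1)] gap_W7[OF that(1)] by auto
qed (use holomorphic_gap gap_T gap_W2 gapI2_cusp gapI3_cusp in auto)

lemma gapII3_zero: "Im t > 0 \<Longrightarrow> gapII3 t = 0"
proof (rule modular_vanishing[of gapII2 gapII3 gapII4])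
  show "norm (gapII3 u) = norm (gapII3 t) \<and> norm (gapII4 u) = norm (gapII2 t) \<and> norm (gapII2 u) = norm (gapII4 t)"
    if "Im t > 0" "u = - 1 / (21 * t) \<or> u = (14 * t + 9) / (21 * t + 14)" for t u
    using that gap_S[OF that(1)] gap_W7[OF that(1)] by auto
qed (use holomorphic_gap gap_T gap_W2 gapII2_cusp gapII3_cusp in auto)

lemma q_identities:
  assumes q: "norm q < 1" "q \<noteq> 0"
  shows "(qP q - qB q) * qV q = q * ((qQ q + qA q) * qU q)"
    and "(qQ q - qA q) * qP q * (qV q)\<^sup>2 = - (q\<^sup>2) * ((qP q + qB q) * qQ q * (qU q)\<^sup>2)"
proof -
  \<comment> \<open>A logarithm lifts the punctured disc to the upper half-plane; 0 has no preimage
    and is treated in the final proof.\<close>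
  define t where "t = Ln q / (\<i> * pi)"
  have "Im t = - ln (norm q) / pi" by (simp add: t_def Im_divide q power2_eq_square)
  then have t: "Im t > 0" using q by (simp add: divide_neg_pos)
  have nq: "nome 1 t = q" using q by (simp add: nome_def t_def)
  define N where "N = nome (11/6) t"
  note nz = qUV_nonzero[OF q(1)]
  have n5: "nome (5/6) t * q = N" unfolding N_def nq[symmetric] nome_add[symmetric] by simp
  have nzN: "N \<noteq> 0" by (simp add: N_def)
  have v: "nome (5/6) t = N / q" using n5 q by (simp add: field_simps)
  have "(qP q - qB q) / (N * qU q) = (qQ q + qA q) / (N / q * qV q)"
    using gapI3_zero[OF t] unfolding gapI3_def combI_def pairs_nome nq N_def[symmetric] v by simp
  moreover have "X * V = q * (Y * U)" if "X / (N * U) = Y / (N / q * V)" "U \<noteq> 0" "V \<noteq> 0" for X Y U V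
    using that nzN q by (simp add: field_simps)
  ultimately show "(qP q - qB q) * qV q = q * ((qQ q + qA q) * qU q)"
    using nz by blast
  have "(qQ q - qA q) * qP q / (N * qU q)\<^sup>2 = - ((qP q + qB q) * qQ q / (N / q * qV q)\<^sup>2)"
    using gapII3_zero[OF t] unfolding gapII3_def combII_def pairs_nome nq N_def[symmetric] v
    by (simp add: eq_neg_iff_add_eq_0)
  moreover have "X * V\<^sup>2 = - (q\<^sup>2) * (Y * U\<^sup>2)" if "X / (N * U)\<^sup>2 = - (Y / (N / q * V)\<^sup>2)" "U \<noteq> 0" "V \<noteq> 0" for X Y U V
    using that nzN q by (simp add: field_simps power2_eq_square)
  ultimately show "(qQ q - qA q) * qP q * (qV q)\<^sup>2 = - (q\<^sup>2) * ((qP q + qB q) * qQ q * (qU q)\<^sup>2)"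
    using nz by blast
qed

theorem theorem4p8:
  fixes q Q :: complex
  assumes "norm q < 1" and "Q = q ^ 7"
  shows "(qf_theta 3 0 7 q + qf_theta 2 2 11 q \<noteq> 0 \<longrightarrow>
           (qf_theta 1 0 21 q - qf_theta 5 4 5 q) / (qf_theta 3 0 7 q + qf_theta 2 2 11 q) =
           q * ((euler_E (q ^ 2) * euler_E (Q ^ 6)) / (euler_E (q ^ 6) * euler_E (Q ^ 2)))) \<and>
         (qf_theta 1 0 21 q + qf_theta 5 4 5 q \<noteq> 0 \<longrightarrow>
           (qf_theta 3 0 7 q - qf_theta 2 2 11 q) / (qf_theta 1 0 21 q + qf_theta 5 4 5 q) =
           - (q ^ 2) *
             ((euler_E (q ^ 6) * euler_E (Q ^ 2) * (ramanujan_psi (- q))\<^sup>2 * (ramanujan_psi (- (Q ^ 3)))\<^sup>2) /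
              (euler_E (q ^ 2) * euler_E (Q ^ 6) * (ramanujan_psi (- (q ^ 3)))\<^sup>2 * (ramanujan_psi (- Q))\<^sup>2)))"
proof -
  note q = assms(1)
  have forms: "qf_theta 1 0 21 q = qP q" "qf_theta 3 0 7 q = qQ q" "qf_theta 2 2 11 q = qA q" "qf_theta 5 4 5 q = qB q"
    using qf_theta_diagonal[OF q, of 1 21] qf_theta_diagonal[OF q, of 3 7] qf_theta_2_2_11[OF q] qf_theta_5_4_5[OF q]
    by (simp_all add: q_defs)
  have Qp: "Q ^ 6 = q ^ 42" "Q ^ 2 = q ^ 14" "Q ^ 3 = q ^ 21" by (simp_all add: assms(2) flip: power_mult)
  note nz = qUV_nonzero[OF q]
  have UV: "euler_E (q ^ 2) * euler_E (Q ^ 6) = qU q" "euler_E (q ^ 6) * euler_E (Q ^ 2) = qV q"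
    unfolding Qp by (simp_all add: q_defs)
  have phi_nz: "theta_phi (q ^ k) \<noteq> 0" if "k > 0" for k using theta_phi_nonzero norm_power_less_1[OF q that] by blast
  have P0: "qP q \<noteq> 0" "qQ q \<noteq> 0" using phi_nz[of 1] phi_nz[of 21] phi_nz[of 3] phi_nz[of 7] by (simp_all add: q_defs)
  \<comment> \<open>For k = 1, 21 and k = 3, 7 the products of these squares are cubes of U and V
    divided by P and Q, so the right-hand side reduces to the quotient controlled by
    \<open>combII\<close>.\<close>
  have psi: "(ramanujan_psi (- (q ^ k)))\<^sup>2 = euler_E (q ^ (2 * k)) ^ 3 / theta_phi (q ^ k)" if "k > 0" for k
  proof -
    have "(q ^ k)\<^sup>2 = q ^ (2 * k)" by (simp only: power_mult[symmetric] mult.commute)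
    then have "theta_phi (q ^ k) * (ramanujan_psi (- (q ^ k)))\<^sup>2 = euler_E (q ^ (2 * k)) ^ 3"
      using theta_phi_psi_cube[OF norm_power_less_1[OF q that]] by simp
    then show ?thesis using phi_nz[OF that] by (metis nonzero_mult_div_cancel_left)
  qed
  have psi1: "(ramanujan_psi (- q))\<^sup>2 * (ramanujan_psi (- (Q ^ 3)))\<^sup>2 = qU q ^ 3 / qP q"
    using psi[of 1] psi[of 21] unfolding Qp by (simp add: q_defs power_mult_distrib)
  have psi3: "(ramanujan_psi (- (q ^ 3)))\<^sup>2 * (ramanujan_psi (- Q))\<^sup>2 = qV q ^ 3 / qQ q"
    using psi[of 3] psi[of 7] unfolding assms(2) by (simp add: q_defs power_mult_distrib)
  have ids: "(qP q - qB q) * qV q = q * ((qQ q + qA q) * qU q) \<and>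
    (qQ q - qA q) * qP q * (qV q)\<^sup>2 = - (q\<^sup>2) * ((qP q + qB q) * qQ q * (qU q)\<^sup>2)"
  proof (cases "q = 0")
    \<comment> \<open>At q = 0 all six series equal 1, so both sides of each identity are 0.\<close>
    case True
    show ?thesis unfolding True q_forms_0 by simp
  next
    case False
    show ?thesis using q_identities[OF q False] by (rule conjI)
  qed
  show ?thesis
    unfolding forms UV mult.assoc[of "qU q"] mult.assoc[of "qV q"] psi1 psi3
  proof (intro conjI impI)
    assume "qQ q + qA q \<noteq> 0"
    then show "(qP q - qB q) / (qQ q + qA q) = q * (qU q / qV q)"
      using conjunct1[OF ids] nz by (simp add: field_simps)
  next
    assume "qP q + qB q \<noteq> 0"
    moreover have "X / Y = - (q\<^sup>2) * (V * (U ^ 3 / P) / (U * (V ^ 3 / R)))"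
      if "X * P * V\<^sup>2 = - (q\<^sup>2) * (Y * R * U\<^sup>2)" "Y \<noteq> 0" "U \<noteq> 0" "V \<noteq> 0" "P \<noteq> 0" "R \<noteq> 0" for X Y P R U V
    proof -
      have "V * (U ^ 3 / P) / (U * (V ^ 3 / R)) = R * U\<^sup>2 / (P * V\<^sup>2)"
        using that by (simp add: field_simps eval_nat_numeral)
      then have "- (q\<^sup>2) * (V * (U ^ 3 / P) / (U * (V ^ 3 / R))) * Y = - (q\<^sup>2) * (Y * R * U\<^sup>2) / (P * V\<^sup>2)" by simp
      also have "\<dots> = X" unfolding that(1)[symmetric] using that(4,5) by simp
      finally show ?thesis using that(2) by (simp add: field_simps)
    qed
    ultimately show "(qQ q - qA q) / (qP q + qB q) = - (q\<^sup>2) * (qV q * (qU q ^ 3 / qP q) / (qU q * (qV q ^ 3 / qQ q)))"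
      using conjunct2[OF ids] nz P0 by blast
  qed
qed

end
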